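(* Let $(P,\le)$ be a homogeneous weakly ordered set. Suppose there exists an automorphism $\varphi:P\to P$ which generates $\le$ such that (1) $\varphi(x)>x$ for any $x\in P$; (2) $X_\varphi$ is simply connected; (3) $[x,\varphi(x)]$ is a lattice for any $x\in P$. Then $\le$ generates a partial order $\le_t$ on $P$, and $(P_{\ge_t x},\le_t)$ and $(P_{\le_t x},\le_t)$ are homogeneous lattices for any $x\in P$. Moreover, $X_\varphi$ is contractible.
   Context: A weakly ordered set is a set $P$ with a reflexive and antisymmetric binary relation $\le$ (not necessarily transitive) satisfying the following condition. Call $(a,b,c)\in P^3$ a transitive triple if $a\le b$, $b\le c$ and $a\le c$. For all $a,b,c,d\in P$ with $a\le b$, $b\le c$, $c\le d$: $(b,c,d)$ and $(a,b,d)$ are transitive triples if and only if $(a,b,c)$ and $(a,c,d)$ are transitive triples. Write $a<b$ for $a\le b$, $a\ne b$. The interval $[a,b]$ (for $a\le b$) is $\{z\in P: a\le z,\ z\le b\}$. For $x\in P$, $P_{\ge x}=\{z: z\ge x\}$ and $P_{\le x}=\{z: z\le x\}$; with the restriction of $\le$ these (and hence intervals) are posets. A weakly ordered set (in particular a poset) $P$ is homogeneous if there is a function $\ell$ from comparable pairs $a\le b$ to the non-negative integers such that $\ell(a\le c)=\ell(a\le b)+\ell(b\le c)$ for every transitive triple $(a,b,c)$, and $\ell(a\le b)=0$ if and only if $a=b$. A lattice is a poset in which any two elements have a join and a meet. A weak chain is a sequence $c_1<c_2<\dots<c_n$ in which consecutive elements are related as indicated. If $P$ contains no non-trivial weak chain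 starting and ending at the same element, then $\le$ generates a partial order $\le_t$: $a\le_t b$ if and only if $a$ and $b$ are the first and last elements of a weak chain. The assertion that $\le$ generates a partial order means that there are no such non-trivial closed weak chains. $P_{\ge_t x}$ and $P_{\le_t x}$ are the sets of elements $\ge_t x$, resp. $\le_t x$. An automorphism of $(P,\le)$ is a bijection of $P$ preserving the relation $\le$. Given an automorphism $\varphi$ with $\varphi(x)>x$ for all $x$, let $\le_\varphi$ be the subrelation of $\le$ consisting of all $a\le b$ such that $a,b\in[x,\varphi(x)]$ for some $x\in P$. We say $\varphi$ generates $\le$ if whenever $a\le b$, $a$ and $b$ are the first and last elements of a weak chain with respect to $\le_\varphi$. $X_\varphi$ is the simplicial complex with vertex set $P$, two distinct vertices $a,b$ being joined by an edge if $a\le_\varphi b$ (or $b\le_\varphi a$), whose simplices are the weak chains of $P$ contained in an interval of the form $[x,\varphi(x)]$, $x\in P$. *)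

theory Defs
  imports "HOL-Analysis.Analysis" "HOL-Algebra.Lattice"
begin

section \<open>Weakly ordered sets\<close>

text \<open>A relation on a set is a pair of a carrier \<open>P\<close> and a predicate \<open>r\<close> whose values outside
  \<open>P\<close> are irrelevant.\<close>

definition transitive_triple :: "('a \<Rightarrow> 'a \<Rightarrow> bool) \<Rightarrow> 'a \<Rightarrow> 'a \<Rightarrow> 'a \<Rightarrow> bool" where
  "transitive_triple r a b c \<longleftrightarrow> r a b \<and> r b c \<and> r a c"

definition weakly_ordered :: "'a set \<Rightarrow> ('a \<Rightarrow> 'a \<Rightarrow> bool) \<Rightarrow> bool" where
  "weakly_ordered P r \<longleftrightarrow>
     (\<forall>a\<in>P. r a a) \<and>
     (\<forall>a\<in>P. \<forall>b\<in>P. r a b \<and> r b a \<longrightarrow> a = b) \<and>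
     (\<forall>a\<in>P. \<forall>b\<in>P. \<forall>c\<in>P. \<forall>d\<in>P. r a b \<and> r b c \<and> r c d \<longrightarrow>
        (transitive_triple r b c d \<and> transitive_triple r a b d \<longleftrightarrow>
         transitive_triple r a b c \<and> transitive_triple r a c d))"

definition homogeneous :: "'a set \<Rightarrow> ('a \<Rightarrow> 'a \<Rightarrow> bool) \<Rightarrow> bool" where
  "homogeneous P r \<longleftrightarrow> (\<exists>len :: 'a \<Rightarrow> 'a \<Rightarrow> nat.
     (\<forall>a\<in>P. \<forall>b\<in>P. \<forall>c\<in>P. transitive_triple r a b c \<longrightarrow> len a c = len a b + len b c) \<and>
     (\<forall>a\<in>P. \<forall>b\<in>P. r a b \<longrightarrow> (len a b = 0 \<longleftrightarrow> a = b)))"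

definition order_interval :: "'a set \<Rightarrow> ('a \<Rightarrow> 'a \<Rightarrow> bool) \<Rightarrow> 'a \<Rightarrow> 'a \<Rightarrow> 'a set" where
  "order_interval P r a b = {z \<in> P. r a z \<and> r z b}"

definition up_set :: "'a set \<Rightarrow> ('a \<Rightarrow> 'a \<Rightarrow> bool) \<Rightarrow> 'a \<Rightarrow> 'a set" where
  "up_set P r x = {z \<in> P. r x z}"

definition down_set :: "'a set \<Rightarrow> ('a \<Rightarrow> 'a \<Rightarrow> bool) \<Rightarrow> 'a \<Rightarrow> 'a set" where
  "down_set P r x = {z \<in> P. r z x}"

text \<open>The lattice locale of HOL-Algebra includes the partial order axioms; it does not require a
  top or bottom element.\<close>

definition lattice_on :: "'a set \<Rightarrow> ('a \<Rightarrow> 'a \<Rightarrow> bool) \<Rightarrow> bool" where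
  "lattice_on A r \<longleftrightarrow> Lattice.lattice \<lparr>carrier = A, eq = (=), le = r\<rparr>"

text \<open>Chains \<open>c\<^sub>1 < \<dots> < c\<^sub>n\<close> with \<open>n \<ge> 1\<close>; the chain is trivial if \<open>n = 1\<close>.\<close>

definition weak_chain :: "'a set \<Rightarrow> ('a \<Rightarrow> 'a \<Rightarrow> bool) \<Rightarrow> 'a list \<Rightarrow> bool" where
  "weak_chain P r cs \<longleftrightarrow>
     cs \<noteq> [] \<and> set cs \<subseteq> P \<and> successively (\<lambda>a b. r a b \<and> a \<noteq> b) cs"

definition chain_le :: "'a set \<Rightarrow> ('a \<Rightarrow> 'a \<Rightarrow> bool) \<Rightarrow> 'a \<Rightarrow> 'a \<Rightarrow> bool" where
  "chain_le P r a b \<longleftrightarrow> (\<exists>cs. weak_chain P r cs \<and> hd cs = a \<and> last cs = b)"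

definition generates_partial_order :: "'a set \<Rightarrow> ('a \<Rightarrow> 'a \<Rightarrow> bool) \<Rightarrow> bool" where
  "generates_partial_order P r \<longleftrightarrow>
     \<not> (\<exists>cs. weak_chain P r cs \<and> length cs \<ge> 2 \<and> hd cs = last cs)"

definition automorphism_on :: "'a set \<Rightarrow> ('a \<Rightarrow> 'a \<Rightarrow> bool) \<Rightarrow> ('a \<Rightarrow> 'a) \<Rightarrow> bool" where
  "automorphism_on P r \<phi> \<longleftrightarrow>
     bij_betw \<phi> P P \<and> (\<forall>a\<in>P. \<forall>b\<in>P. r a b \<longleftrightarrow> r (\<phi> a) (\<phi> b))"

definition sub_rel :: "'a set \<Rightarrow> ('a \<Rightarrow> 'a \<Rightarrow> bool) \<Rightarrow> ('a \<Rightarrow> 'a) \<Rightarrow> 'a \<Rightarrow> 'a \<Rightarrow> bool" where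
  "sub_rel P r \<phi> a b \<longleftrightarrow>
     r a b \<and> (\<exists>x\<in>P. a \<in> order_interval P r x (\<phi> x) \<and> b \<in> order_interval P r x (\<phi> x))"

definition generates_rel :: "'a set \<Rightarrow> ('a \<Rightarrow> 'a \<Rightarrow> bool) \<Rightarrow> ('a \<Rightarrow> 'a) \<Rightarrow> bool" where
  "generates_rel P r \<phi> \<longleftrightarrow>
     (\<forall>a\<in>P. \<forall>b\<in>P. r a b \<longrightarrow> chain_le P (sub_rel P r \<phi>) a b)"


section \<open>Simplicial complexes and their topology\<close>

text \<open>An abstract simplicial complex is given by its set of (nonempty, finite) simplices.\<close>

definition X_complex :: "'a set \<Rightarrow> ('a \<Rightarrow> 'a \<Rightarrow> bool) \<Rightarrow> ('a \<Rightarrow> 'a) \<Rightarrow> 'a set set" where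
  "X_complex P r \<phi> =
     {set cs | cs. weak_chain P r cs \<and> (\<exists>x\<in>P. set cs \<subseteq> order_interval P r x (\<phi> x))}"

text \<open>The closed cell of a finite simplex in barycentric coordinates.\<close>

definition closed_cell :: "'a set \<Rightarrow> ('a \<Rightarrow> real) set" where
  "closed_cell s = {f. (\<forall>v. 0 \<le> f v) \<and> (\<forall>v. v \<notin> s \<longrightarrow> f v = 0) \<and> (\<Sum>v\<in>s. f v) = 1}"

text \<open>The geometric realization carries the weak (coherent) topology: a set is open iff its trace
  on every closed cell is open there. On a single cell, the product topology of
  \<open>'a \<Rightarrow> real\<close> induces the Euclidean one. The complex need not be locally finite, so the subspace
  topology on the whole union would in general be different.\<close>

definition geometric_realization :: "'a set set \<Rightarrow> ('a \<Rightarrow> real) topology" where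
  "geometric_realization K = topology (\<lambda>U. U \<subseteq> (\<Union>s\<in>K. closed_cell s) \<and>
     (\<forall>s\<in>K. openin (top_of_set (closed_cell s)) (U \<inter> closed_cell s)))"

lemma openin_geometric_realization:
  "openin (geometric_realization K) U \<longleftrightarrow> U \<subseteq> (\<Union>s\<in>K. closed_cell s) \<and>
     (\<forall>s\<in>K. openin (top_of_set (closed_cell s)) (U \<inter> closed_cell s))"
proof -
  let ?O = "\<lambda>U. U \<subseteq> (\<Union>s\<in>K. closed_cell s) \<and>
     (\<forall>s\<in>K. openin (top_of_set (closed_cell s)) (U \<inter> closed_cell s))"
  have "?O (U \<inter> V)" if "?O U" "?O V" for U V
  proof -
    have "(U \<inter> V) \<inter> closed_cell s = (U \<inter> closed_cell s) \<inter> (V \<inter> closed_cell s)" for s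
      by blast
    then have "\<forall>s\<in>K. openin (top_of_set (closed_cell s)) ((U \<inter> V) \<inter> closed_cell s)"
      using that by (metis openin_Int)
    moreover have "U \<inter> V \<subseteq> (\<Union>s\<in>K. closed_cell s)"
      using that by blast
    ultimately show ?thesis by blast
  qed
  moreover have "?O (\<Union>\<U>)" if "\<forall>U\<in>\<U>. ?O U" for \<U>
  proof -
    have "\<Union>\<U> \<inter> closed_cell s = (\<Union>U\<in>\<U>. U \<inter> closed_cell s)" for s
      by blast
    moreover have "openin (top_of_set (closed_cell s)) (\<Union>U\<in>\<U>. U \<inter> closed_cell s)"
      if "s \<in> K" for s
      using that \<open>\<forall>U\<in>\<U>. ?O U\<close> by (intro openin_clauses(3)) blast
    moreover have "\<Union>\<U> \<subseteq> (\<Union>s\<in>K. closed_cell s)"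
      using that by blast
    ultimately show ?thesis by (simp only:) blast
  qed
  ultimately have "istopology ?O"
    unfolding istopology_def by blast
  then show ?thesis
    unfolding geometric_realization_def by (simp add: topology_inverse')
qed

lemma topspace_geometric_realization:
  "topspace (geometric_realization K) = (\<Union>s\<in>K. closed_cell s)"
proof -
  have "openin (geometric_realization K) (\<Union>s\<in>K. closed_cell s)"
    unfolding openin_geometric_realization
  proof (intro conjI ballI)
    fix s assume "s \<in> K"
    then have "(\<Union>s\<in>K. closed_cell s) \<inter> closed_cell s = closed_cell s" by blast
    then show "openin (top_of_set (closed_cell s)) ((\<Union>s\<in>K. closed_cell s) \<inter> closed_cell s)"
      by simp
  qed simp
  moreover have "topspace (geometric_realization K) \<subseteq> (\<Union>s\<in>K. closed_cell s)"
    using openin_geometric_realization openin_topspace by blast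
  ultimately show ?thesis
    by (meson openin_subset subset_antisym)
qed

text \<open>Path connected with trivial fundamental group at every base point. This is the
  counterpart of \<^const>\<open>simply_connected\<close> for abstract topologies; as there, the empty space is
  included.\<close>

definition simply_connected_space :: "'b topology \<Rightarrow> bool" where
  "simply_connected_space X \<longleftrightarrow> path_connected_space X \<and>
     (\<forall>p. pathin X p \<and> p 1 = p 0 \<longrightarrow>
        homotopic_with (\<lambda>q. q 0 = p 0 \<and> q 1 = p 0) (top_of_set {0..1}) X p (\<lambda>_. p 0))"

lemma simply_connected_space_top_of_set:
  fixes S :: "'b::real_normed_vector set"
  shows "simply_connected_space (top_of_set S) \<longleftrightarrow> simply_connected S"
proof -
  have lp: "linepath (p 0) (p 0) = (\<lambda>_. p 0)" for p :: "real \<Rightarrow> 'b"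
    by (auto simp: linepath_def algebra_simps simp flip: scaleR_add_left)
  have 1: "pathin (top_of_set S) p \<longleftrightarrow> path p \<and> path_image p \<subseteq> S" for p
    by (auto simp: pathin_def path_def path_image_def)
  have 3: "path_connected_space (top_of_set S) \<longleftrightarrow> path_connected S"
    by simp
  have 2: "homotopic_with (\<lambda>q. q 0 = p 0 \<and> q 1 = p 0) (top_of_set {0..1}) (top_of_set S) p (\<lambda>_. p 0)
      \<longleftrightarrow> homotopic_paths S p (linepath (pathstart p) (pathstart p))"
    if "p 1 = p 0" for p :: "real \<Rightarrow> 'b"
    using that by (simp add: homotopic_paths_def pathstart_def pathfinish_def lp)
  show ?thesis
    unfolding simply_connected_space_def simply_connected_eq_contractible_path 1 3
    using 2 by (auto simp: pathfinish_def pathstart_def)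
qed

end

theory Submission
  imports Defs
begin

text \<open>Call a pair \<open>a \<le> b \<le> \<phi> a\<close> simple. The simple pairs are the germ of a Garside category with
  Garside element \<open>\<phi>\<close>, whose classifying space is \<open>X\<^sub>\<phi>\<close>. Its groupoid of fractions is encoded by
  bi-infinite greedy sequences: left multiplication by a simple pair acts on them by a bijection, and
  functorially, so the sequences form a local system on \<open>X\<^sub>\<phi>\<close>. As \<open>X\<^sub>\<phi>\<close> is simply connected, this local
  system has global sections, so that the greedy normal form of a weak chain from \<open>x\<close> to \<open>b\<close> depends only on
  its end points. Its first term is the greatest \<open>z \<in> [x, \<phi> x]\<close> with \<open>z \<le>\<^sub>t b\<close>; such heads give meets
  for \<open>\<le>\<^sub>t\<close>, and joins follow since orbits of \<open>\<phi>\<close> are cofinal and heights are bounded. The height itself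
  is a global section of the local system with fibre \<open>\<int>\<close> defined by the length. Finally
  \<open>y \<mapsto> (y \<squnion> x) \<sqinter> \<phi>\<^sup>j x\<close> and \<open>y \<mapsto> y \<squnion> \<phi>\<^sup>-\<^sup>j x\<close>, for growing \<open>j\<close>, connect the identity of \<open>X\<^sub>\<phi>\<close>
  to the constant map \<open>x\<close> through contiguous monotone maps.\<close>

section \<open>Geometric realizations\<close>

text \<open>The obstacle is that \<open>r\<close> is not transitive and that nothing is known about
  weak chains at the start: \<open>tle\<close> might be cyclic, and a chain has no canonical form.
  Computing is possible only inside the intervals \<open>[x, \<phi> x]\<close>. Simple connectivity
  is used for sections of two local systems, heights and normal sequences, and through
  connectedness. Normal sequences are infinite to the left so that the step from \<open>x\<close> to
  \<open>\<phi> x\<close> acts as a shift of indices. Every simple pair is a factor of such a step,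
  on either side, which makes each \<open>lift\<close> bijective although chains cannot be inverted.
  The decisive gain from heads is \<open>simple_iff_tle\<close>: a pair with
  \<open>x \<le> z \<le> \<phi> x\<close> in the generated order is already simple. Simplices can
  then be recognized through \<open>tle\<close> alone, so lattice operations of \<open>tle\<close>
  give maps of the complex. The contraction has infinitely many stages, and no single stage need
  work for all of \<open>P\<close>. Each simplex sees only finitely many changes, which suffices in
  the weak topology.\<close>

definition abstract_complex :: "'a set set \<Rightarrow> bool" where
  "abstract_complex K \<longleftrightarrow>
     (\<forall>s\<in>K. finite s \<and> s \<noteq> {}) \<and> (\<forall>s\<in>K. \<forall>t. t \<subseteq> s \<and> t \<noteq> {} \<longrightarrow> t \<in> K)"

definition supp :: "('a \<Rightarrow> real) \<Rightarrow> 'a set" where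
  "supp f = {v. f v \<noteq> 0}"

lemma closed_cell_supp:
  assumes "f \<in> closed_cell s" "finite s"
  shows "supp f \<subseteq> s" "finite (supp f)" "supp f \<noteq> {}" "f \<in> closed_cell (supp f)"
proof -
  show 1: "supp f \<subseteq> s"
    using assms by (auto simp: supp_def closed_cell_def)
  then show 2: "finite (supp f)"
    using assms finite_subset by blast
  have "sum f (supp f) = sum f s"
    using 1 assms(2) by (intro sum.mono_neutral_left) (auto simp: supp_def)
  then have 3: "sum f (supp f) = 1"
    using assms by (auto simp: closed_cell_def)
  then show "supp f \<noteq> {}" by auto
  show "f \<in> closed_cell (supp f)"
    using 3 assms by (auto simp: supp_def closed_cell_def)
qed

lemma closed_cell_mono:
  assumes "s \<subseteq> t" "finite t"
  shows "closed_cell s \<subseteq> closed_cell t"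
proof
  fix f :: "'a \<Rightarrow> real" assume f: "f \<in> closed_cell s"
  have "sum f t = sum f s"
    using assms f by (intro sum.mono_neutral_right) (auto simp: closed_cell_def)
  then show "f \<in> closed_cell t"
    using f assms by (auto simp: closed_cell_def)
qed

lemma in_realization_iff:
  assumes "abstract_complex K"
  shows "f \<in> topspace (geometric_realization K) \<longleftrightarrow>
     (\<forall>v. 0 \<le> f v) \<and> supp f \<in> K \<and> sum f (supp f) = 1"
proof
  assume "f \<in> topspace (geometric_realization K)"
  then obtain s where s: "s \<in> K" "f \<in> closed_cell s"
    by (auto simp: topspace_geometric_realization)
  have "finite s" using s assms by (auto simp: abstract_complex_def)
  note * = closed_cell_supp[OF s(2) this]
  then show "(\<forall>v. 0 \<le> f v) \<and> supp f \<in> K \<and> sum f (supp f) = 1"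
    using s assms unfolding abstract_complex_def closed_cell_def by blast
next
  assume "(\<forall>v. 0 \<le> f v) \<and> supp f \<in> K \<and> sum f (supp f) = 1"
  then have "f \<in> closed_cell (supp f)" "supp f \<in> K"
    by (auto simp: closed_cell_def supp_def)
  then show "f \<in> topspace (geometric_realization K)"
    by (auto simp: topspace_geometric_realization)
qed

section \<open>Continuity into and out of a realization\<close>

lemma closed_closed_cell:
  assumes "finite s"
  shows "closed (closed_cell s)"
proof -
  have "closed_cell s =
      (\<Inter>v. {f. 0 \<le> f v}) \<inter> (\<Inter>v\<in>-s. {f. f v = 0}) \<inter> {f. (\<Sum>v\<in>s. f v) = 1}"
    by (auto simp: closed_cell_def)
  also have "closed \<dots>"
    by (intro closed_Int closed_INT ballI closed_Collect_le closed_Collect_eq continuous_intros) auto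
  finally show ?thesis .
qed

lemma closedin_geometric_realization:
  "closedin (geometric_realization K) C \<longleftrightarrow> C \<subseteq> topspace (geometric_realization K) \<and>
     (\<forall>s\<in>K. closedin (top_of_set (closed_cell s)) (C \<inter> closed_cell s))"
proof -
  have "openin (top_of_set (closed_cell s)) ((topspace (geometric_realization K) - C) \<inter> closed_cell s)
     \<longleftrightarrow> closedin (top_of_set (closed_cell s)) (C \<inter> closed_cell s)" if "s \<in> K" for s
  proof -
    have "(topspace (geometric_realization K) - C) \<inter> closed_cell s = closed_cell s - C \<inter> closed_cell s"
      using that by (auto simp: topspace_geometric_realization)
    then show ?thesis
      by (simp add: closedin_def)
  qed
  then show ?thesis
    unfolding closedin_def[of "geometric_realization K"] openin_geometric_realization
      topspace_geometric_realization[symmetric] by blast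
qed

text \<open>The finite vertex set \<open>W\<close> confines the image to finitely many cells. Each
  is closed in the product topology, so the weak topology is tested on a finite union of closed sets
  and only coordinates matter.\<close>

lemma continuous_map_into_realization:
  fixes g :: "'b \<Rightarrow> 'a \<Rightarrow> real"
  assumes K: "abstract_complex K" and W: "finite W"
    and into: "\<And>x. x \<in> topspace A \<Longrightarrow> g x \<in> topspace (geometric_realization K)"
    and sW: "\<And>x. x \<in> topspace A \<Longrightarrow> supp (g x) \<subseteq> W"
    and cont: "\<And>v. v \<in> W \<Longrightarrow> continuous_map A euclideanreal (\<lambda>x. g x v)"
  shows "continuous_map A (geometric_realization K) g"
proof -
  have "continuous_map A euclideanreal (\<lambda>x. g x v)" for v
  proof (cases "v \<in> W")
    case False
    then have "g x v = 0" if "x \<in> topspace A" for x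
      using sW[OF that] by (auto simp: supp_def)
    then show ?thesis
      using continuous_map_eq[of A euclideanreal "\<lambda>x. 0" "\<lambda>x. g x v"] by auto
  qed (rule cont)
  then have ge: "continuous_map A euclidean g"
    by (simp add: continuous_map_componentwise_UNIV flip: euclidean_product_topology)
  show ?thesis
    unfolding continuous_map_closedin
  proof (intro conjI allI impI ballI)
    show "g \<in> topspace A \<rightarrow> topspace (geometric_realization K)"
      using into by blast
    fix C assume C: "closedin (geometric_realization K) C"
    let ?S = "{s\<in>K. s \<subseteq> W}"
    have eq: "{x \<in> topspace A. g x \<in> C} = (\<Union>s\<in>?S. {x \<in> topspace A. g x \<in> C \<inter> closed_cell s})"
    proof (intro equalityI subsetI)
      fix x assume x: "x \<in> {x \<in> topspace A. g x \<in> C}"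
      then have "supp (g x) \<in> ?S" "g x \<in> closed_cell (supp (g x))"
        using into[of x] sW[of x] K in_realization_iff[OF K, of "g x"]
        by (auto simp: closed_cell_def supp_def)
      then show "x \<in> (\<Union>s\<in>?S. {x \<in> topspace A. g x \<in> C \<inter> closed_cell s})"
        using x by blast
    qed auto
    have "closedin A {x \<in> topspace A. g x \<in> C \<inter> closed_cell s}" if "s \<in> ?S" for s
    proof (rule closedin_continuous_map_preimage[OF ge])
      have "finite s" using that K by (auto simp: abstract_complex_def)
      then show "closedin euclidean (C \<inter> closed_cell s)"
        using that C closed_closed_cell[of s]
        by (auto simp: closedin_geometric_realization intro: closedin_closed_trans)
    qed
    moreover have "finite ?S"
      using W by (rule finite_subset[rotated, OF finite_Pow_iff[THEN iffD2]]) auto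
    ultimately show "closedin A {x \<in> topspace A. g x \<in> C}"
      unfolding eq by (intro closedin_Union) auto
  qed
qed

lemma openin_open_star:
  "openin (geometric_realization K) {f \<in> topspace (geometric_realization K). 0 < f v}"
  unfolding openin_geometric_realization
proof (intro conjI ballI)
  fix s assume "s \<in> K"
  then have "{f \<in> topspace (geometric_realization K). 0 < f v} \<inter> closed_cell s
      = closed_cell s \<inter> {f. 0 < f v}"
    by (auto simp: topspace_geometric_realization)
  moreover have "open {f :: 'a \<Rightarrow> real. 0 < f v}"
    by (intro open_Collect_less continuous_intros) auto
  ultimately show "openin (top_of_set (closed_cell s))
      ({f \<in> topspace (geometric_realization K). 0 < f v} \<inter> closed_cell s)"
    by (simp add: openin_open_Int)
qed (auto simp: topspace_geometric_realization)

text \<open>The weak topology in the form in which products with an interval can be handled: a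
  quotient of the disjoint union of the cells.\<close>

lemma quotient_map_cells:
  "quotient_map (sum_topology (\<lambda>s. top_of_set (closed_cell s)) K) (geometric_realization K) snd"
  unfolding quotient_map_def
proof (intro conjI allI impI)
  show "snd ` topspace (sum_topology (\<lambda>s. top_of_set (closed_cell s)) K)
      = topspace (geometric_realization K)"
    by (force simp: topspace_geometric_realization)
  fix U assume U: "U \<subseteq> topspace (geometric_realization K)"
  have "{x. (i, x) \<in> {x \<in> topspace (sum_topology (\<lambda>s. top_of_set (closed_cell s)) K). snd x \<in> U}}
      = U \<inter> closed_cell i" if "i \<in> K" for i
    using that by auto
  then show "openin (sum_topology (\<lambda>s. top_of_set (closed_cell s)) K)
      {x \<in> topspace (sum_topology (\<lambda>s. top_of_set (closed_cell s)) K). snd x \<in> U}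
      = openin (geometric_realization K) U"
    using U unfolding openin_sum_topology openin_geometric_realization topspace_geometric_realization
    by (auto simp: subset_iff)
qed

text \<open>The product of a quotient map with \<open>[0,1]\<close> is again a quotient map, because
  \<open>[0,1]\<close> is locally compact Hausdorff. This allows homotopies to be checked cell by
  cell.\<close>

lemma continuous_map_prod_realization:
  fixes h :: "real \<times> ('a \<Rightarrow> real) \<Rightarrow> 'b"
  assumes "\<And>s. s \<in> K \<Longrightarrow>
     continuous_map (prod_topology (top_of_set {0..1}) (top_of_set (closed_cell s))) Y h"
  shows "continuous_map (prod_topology (top_of_set {0..1}) (geometric_realization K)) Y h"
proof -
  let ?I = "top_of_set {0..1::real}"
  let ?D = "sum_topology (\<lambda>s. top_of_set (closed_cell s)) K"
  have q: "quotient_map (prod_topology ?I ?D) (prod_topology ?I (geometric_realization K))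
      (\<lambda>(x,y). (x, snd y))"
    by (intro quotient_map_prod_right quotient_map_cells compact_imp_locally_compact_space)
      (auto simp: compact_space_subtopology compactin_euclidean_iff Hausdorff_space_subtopology)
  have "continuous_map (prod_topology ?I ?D) Y (h \<circ> (\<lambda>(x,y). (x, snd y)))"
    unfolding continuous_map_def
  proof (intro conjI allI impI)
    show "h \<circ> (\<lambda>(x,y). (x, snd y)) \<in> topspace (prod_topology ?I ?D) \<rightarrow> topspace Y"
      using assms by (fastforce simp: continuous_map_def)
    fix U assume U: "openin Y U"
    show "openin (prod_topology ?I ?D)
        {x \<in> topspace (prod_topology ?I ?D). (h \<circ> (\<lambda>(x,y). (x, snd y))) x \<in> U}"
      unfolding openin_prod_topology_alt
    proof (intro allI impI)
      fix t z assume "(t, z) \<in> {x \<in> topspace (prod_topology ?I ?D). (h \<circ> (\<lambda>(x,y). (x, snd y))) x \<in> U}"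
      then obtain s f where z: "z = (s, f)" "s \<in> K" "f \<in> closed_cell s" "t \<in> {0..1}" "h (t, f) \<in> U"
        by auto
      have "openin (prod_topology ?I (top_of_set (closed_cell s)))
          {x \<in> topspace (prod_topology ?I (top_of_set (closed_cell s))). h x \<in> U}"
        using assms[OF z(2)] U by (rule openin_continuous_map_preimage)
      then obtain A B where AB: "openin ?I A" "openin (top_of_set (closed_cell s)) B" "t \<in> A" "f \<in> B"
        "A \<times> B \<subseteq> {x \<in> topspace (prod_topology ?I (top_of_set (closed_cell s))). h x \<in> U}"
        unfolding openin_prod_topology_alt using z by (smt (verit) SigmaI mem_Collect_eq topspace_euclidean_subtopology topspace_prod_topology)
      have "openin ?D ({s} \<times> B)"
        unfolding openin_sum_topology
      proof (intro conjI ballI)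
        show "{s} \<times> B \<subseteq> Sigma K (topspace \<circ> (\<lambda>s. top_of_set (closed_cell s)))"
          using z(2) openin_subset[OF AB(2)] by auto
        fix i assume "i \<in> K"
        have "{x. (i, x) \<in> {s} \<times> B} = (if i = s then B else {})"
          by auto
        then show "openin (top_of_set (closed_cell i)) {x. (i, x) \<in> {s} \<times> B}"
          using AB(2) by simp
      qed
      moreover have "A \<times> ({s} \<times> B) \<subseteq>
          {x \<in> topspace (prod_topology ?I ?D). (h \<circ> (\<lambda>(x,y). (x, snd y))) x \<in> U}"
        using AB(5) z(2) by fastforce
      ultimately show "\<exists>Ua V. openin ?I Ua \<and> openin ?D V \<and> t \<in> Ua \<and> z \<in> V \<and>
          Ua \<times> V \<subseteq> {x \<in> topspace (prod_topology ?I ?D). (h \<circ> (\<lambda>(x,y). (x, snd y))) x \<in> U}"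
        using AB z(1) by blast
    qed
  qed
  then show ?thesis
    using continuous_compose_quotient_map[OF q] by blast
qed

section \<open>Local systems on simply connected complexes\<close>

definition vertex_point :: "'a \<Rightarrow> 'a \<Rightarrow> real" where
  "vertex_point a = (\<lambda>v. if v = a then 1 else 0)"

definition open_star :: "'a set set \<Rightarrow> 'a \<Rightarrow> ('a \<Rightarrow> real) set" where
  "open_star K v = {f \<in> topspace (geometric_realization K). 0 < f v}"

definition edge :: "'a set set \<Rightarrow> 'a \<Rightarrow> 'a \<Rightarrow> bool" where
  "edge K a b \<longleftrightarrow> (\<exists>s\<in>K. a \<in> s \<and> b \<in> s)"

primrec transport :: "('a \<Rightarrow> 'a \<Rightarrow> 's \<Rightarrow> 's) \<Rightarrow> (nat \<Rightarrow> 'a) \<Rightarrow> nat \<Rightarrow> 's \<Rightarrow> 's" where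
  "transport T a 0 s = s"
| "transport T a (Suc n) s = T (a n) (a (Suc n)) (transport T a n s)"

text \<open>The cocycle condition is imposed only inside a simplex, so transport may still depend on
  the path. Its case \<open>c = a\<close> makes transport along an edge invertible.\<close>

definition local_system ::
  "'a set set \<Rightarrow> ('a \<Rightarrow> 's set) \<Rightarrow> ('a \<Rightarrow> 'a \<Rightarrow> 's \<Rightarrow> 's) \<Rightarrow> bool" where
  "local_system K S T \<longleftrightarrow>
     (\<forall>t\<in>K. \<forall>a\<in>t. \<forall>b\<in>t. \<forall>s\<in>S a. T a b s \<in> S b) \<and>
     (\<forall>t\<in>K. \<forall>a\<in>t. \<forall>s\<in>S a. T a a s = s) \<and>
     (\<forall>t\<in>K. \<forall>a\<in>t. \<forall>b\<in>t. \<forall>c\<in>t. \<forall>s\<in>S a. T b c (T a b s) = T a c s)"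

lemma local_systemD:
  assumes "local_system K S T" "t \<in> K" "a \<in> t" "b \<in> t" "s \<in> S a"
  shows "T a b s \<in> S b" "T a a s = s" "T b a (T a b s) = s" "c \<in> t \<Longrightarrow> T b c (T a b s) = T a c s"
proof -
  note ls = assms(1)[unfolded local_system_def]
  note ls1 = conjunct1[OF ls] and ls2 = conjunct1[OF conjunct2[OF ls]] and ls3 = conjunct2[OF conjunct2[OF ls]]
  show 1: "T a b s \<in> S b" by (rule ls1[rule_format, OF assms(2-5)])
  show 2: "T a a s = s" by (rule ls2[rule_format, OF assms(2,3,5)])
  have comp: "T b c (T a b s) = T a c s" if "c \<in> t" for c
    by (rule ls3[rule_format, OF assms(2-4) that assms(5)])
  then show "c \<in> t \<Longrightarrow> T b c (T a b s) = T a c s" .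
  show "T b a (T a b s) = s" using comp[OF assms(3)] 2 by simp
qed

lemma edge_sym: "edge K a b \<Longrightarrow> edge K b a"
  by (auto simp: edge_def)

lemma edge_transport:
  assumes "local_system K S T" "edge K a b" "s \<in> S a"
  shows "T a b s \<in> S b" "T a a s = s" "T b a (T a b s) = s"
proof -
  obtain t where "t \<in> K" "a \<in> t" "b \<in> t" using assms(2) by (auto simp: edge_def)
  from local_systemD[OF assms(1) this assms(3)]
  show "T a b s \<in> S b" "T a a s = s" "T b a (T a b s) = s" by simp_all
qed

lemma transport_in:
  assumes "local_system K S T" "\<And>i. i < n \<Longrightarrow> edge K (a i) (a (Suc i))" "s \<in> S (a 0)"
  shows "transport T a n s \<in> S (a n)"
  using assms(2)
proof (induction n)
  case 0
  then show ?case using assms by simp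
next
  case (Suc n)
  then have "transport T a n s \<in> S (a n)" "edge K (a n) (a (Suc n))" by auto
  then show ?case using edge_transport(1)[OF assms(1)] by simp
qed

text \<open>All vertices in question have positive weight at \<open>f\<close>, hence lie in the
  simplex \<open>supp f\<close>.\<close>

lemma open_star_common_simplex:
  assumes "abstract_complex K" "\<And>v. v \<in> A \<Longrightarrow> f \<in> open_star K v" "A \<noteq> {}"
  shows "\<exists>s\<in>K. A \<subseteq> s"
proof
  show "supp f \<in> K"
    using assms in_realization_iff[OF assms(1), of f] by (auto simp: open_star_def)
  show "A \<subseteq> supp f"
    using assms by (force simp: open_star_def supp_def)
qed

lemma vertex_point_in_open_star: "vertex_point a \<in> open_star K v \<Longrightarrow> v = a"
  by (auto simp: open_star_def vertex_point_def split: if_splits)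

lemma vertex_point_in_realization:
  assumes "abstract_complex K" "a \<in> \<Union>K"
  shows "vertex_point a \<in> topspace (geometric_realization K)"
proof -
  have "supp (vertex_point a) = {a}"
    by (auto simp: supp_def vertex_point_def)
  moreover have "{a} \<in> K"
    using assms by (auto simp: abstract_complex_def)
  ultimately show ?thesis
    using in_realization_iff[OF assms(1)] by (simp add: vertex_point_def)
qed

lemma topspace_subset_open_stars:
  assumes "abstract_complex K"
  shows "topspace (geometric_realization K) \<subseteq> (\<Union>v\<in>\<Union>K. open_star K v)"
proof
  fix f assume f: "f \<in> topspace (geometric_realization K)"
  then have *: "\<forall>v. 0 \<le> f v" "supp f \<in> K"
    using in_realization_iff[OF assms] by auto
  then obtain v where "v \<in> supp f"
    using assms by (force simp: abstract_complex_def)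
  then have "f \<in> open_star K v" "v \<in> \<Union>K"
    using f * by (auto simp: open_star_def supp_def order_less_le)
  then show "f \<in> (\<Union>v\<in>\<Union>K. open_star K v)" by blast
qed

text \<open>Each square lies in one simplex, where both ways around equal the direct transport along
  the diagonal.\<close>

lemma ladder:
  assumes ls: "local_system K S T"
    and sq: "\<And>i. i < n \<Longrightarrow> \<exists>t\<in>K. {a i, a (Suc i), b i, b (Suc i)} \<subseteq> t"
    and s: "s \<in> S (a 0)" "edge K (a 0) (b 0)"
  shows "T (a n) (b n) (transport T a n s) = transport T b n (T (a 0) (b 0) s)"
  using sq
proof (induction n)
  case (Suc n)
  have "edge K (a i) (a (Suc i))" if "i < Suc n" for i
    using Suc.prems[OF that] by (auto simp: edge_def)
  then have X: "transport T a n s \<in> S (a n)"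
    using transport_in[OF ls, of n a s] s by simp
  obtain t where t: "t \<in> K" "{a n, a (Suc n), b n, b (Suc n)} \<subseteq> t"
    using Suc.prems by blast
  have "T (a (Suc n)) (b (Suc n)) (transport T a (Suc n) s) = T (a n) (b (Suc n)) (transport T a n s)"
    using local_systemD(4)[OF ls t(1) _ _ X] t(2) by simp
  also have "\<dots> = T (b n) (b (Suc n)) (T (a n) (b n) (transport T a n s))"
    using local_systemD(4)[OF ls t(1) _ _ X] t(2) by simp
  finally show ?case
    using Suc by simp
qed simp

section \<open>Subdividing a homotopy of edge loops\<close>

lemma diameter_square_le:
  fixes x y d :: real
  assumes "0 \<le> d"
  shows "diameter ({x..x+d} \<times> {y..y+d}) \<le> 2 * d"
proof (rule diameter_le)
  fix u v :: "real \<times> real"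
  assume "u \<in> {x..x+d} \<times> {y..y+d}" "v \<in> {x..x+d} \<times> {y..y+d}"
  then have "\<bar>fst u - fst v\<bar> \<le> d" "\<bar>snd u - snd v\<bar> \<le> d" by auto
  then show "norm (u - v) \<le> 2 * d"
    using norm_Pair_le[of "fst (u - v)" "snd (u - v)"] unfolding prod.collapse by simp
qed (use assms in auto)

text \<open>The Lebesgue number of the cover by preimages of open stars bounds the mesh. The grid
  size is a multiple of \<open>m\<close> so that the vertices of an edge path with \<open>m\<close>
  edges are grid points.\<close>

lemma fine_grid:
  fixes H :: "real \<times> real \<Rightarrow> 'a \<Rightarrow> real"
  assumes K: "abstract_complex K" and m: "0 < m"
    and H: "continuous_map (prod_topology (top_of_set {0..1}) (top_of_set {0..1}))
        (geometric_realization K) H"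
  shows "\<exists>q>0. \<exists>v. \<forall>i j x y. i < m * q \<longrightarrow> j < m * q \<longrightarrow> real i / real (m * q) \<le> x \<longrightarrow>
       x \<le> real (Suc i) / real (m * q) \<longrightarrow> real j / real (m * q) \<le> y \<longrightarrow>
       y \<le> real (Suc j) / real (m * q) \<longrightarrow> H (x, y) \<in> open_star K (v i j)"
proof -
  let ?S = "{0..1::real} \<times> {0..1::real}"
  have H': "continuous_map (top_of_set ?S) (geometric_realization K) H"
    using H by (simp add: prod_topology_subtopology_eu)
  have "openin (top_of_set ?S) {x \<in> ?S. H x \<in> open_star K v}" for v
    using openin_continuous_map_preimage[OF H' openin_open_star[of K v]] by (simp add: open_star_def)
  then have "\<exists>U. open U \<and> {x \<in> ?S. H x \<in> open_star K v} = ?S \<inter> U" for v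
    by (simp add: openin_open)
  then obtain U where U: "\<And>v. open (U v)" "\<And>v. {x \<in> ?S. H x \<in> open_star K v} = ?S \<inter> U v"
    by metis
  have "?S \<subseteq> (\<Union>v. U v)"
  proof
    fix x assume x: "x \<in> ?S"
    then have "H x \<in> topspace (geometric_realization K)"
      using H' by (auto simp: continuous_map_def)
    then obtain v where "H x \<in> open_star K v"
      using topspace_subset_open_stars[OF K] by blast
    then show "x \<in> (\<Union>v. U v)" using U(2)[of v] x by blast
  qed
  moreover have "compact ?S" by (intro compact_Times compact_Icc)
  moreover have "open B" if "B \<in> range U" for B using that U(1) by blast
  ultimately obtain \<delta> where \<delta>: "0 < \<delta>" "\<And>T. \<lbrakk>T \<subseteq> ?S; diameter T < \<delta>\<rbrakk> \<Longrightarrow> \<exists>B \<in> range U. T \<subseteq> B"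
    using Lebesgue_number_lemma[of ?S "range U"] by (metis UNIV_not_empty image_is_empty)
  \<comment> \<open>The factor 2 is that of \<open>diameter_square_le\<close>, for squares of side
    \<open>1 / (m * q)\<close>.\<close>
  obtain q :: nat where q: "2 / \<delta> < q"
    using reals_Archimedean2 by blast
  then have q0: "0 < q"
    using \<delta>(1) by (metis divide_pos_pos gr0I of_nat_0 order_less_asym zero_less_numeral)
  let ?n = "real (m * q)"
  have n: "2 * (1 / ?n) < \<delta>"
  proof -
    have "q \<le> m * q" using m by simp
    then have "real q \<le> ?n" by (simp only: of_nat_le_iff)
    then have "2 / \<delta> < ?n" using q by linarith
    then show ?thesis using \<delta>(1) m q0 by (simp add: field_simps)
  qed
  have sub: "{real k / ?n .. real (Suc k) / ?n} \<subseteq> {0..1}" if "k < m * q" for k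
  proof -
    have "real (Suc k) \<le> ?n" using that by (simp only: of_nat_le_iff Suc_le_eq)
    then have "real (Suc k) / ?n \<le> 1" by (simp add: divide_le_eq_1)
    moreover have "0 \<le> real k / ?n" by simp
    ultimately show ?thesis unfolding atLeastatMost_subset_iff by blast
  qed
  have ex: "\<exists>v. {real i / ?n .. real (Suc i) / ?n} \<times> {real j / ?n .. real (Suc j) / ?n} \<subseteq> U v"
    if "i < m * q" "j < m * q" for i j
  proof -
    have suc: "real (Suc k) / ?n = real k / ?n + 1 / ?n" for k
      by (simp add: add_divide_distrib)
    have "{real i / ?n .. real (Suc i) / ?n} \<times> {real j / ?n .. real (Suc j) / ?n} \<subseteq> ?S"
      by (intro Sigma_mono sub that)
    moreover have "diameter ({real i / ?n .. real (Suc i) / ?n} \<times> {real j / ?n .. real (Suc j) / ?n}) < \<delta>"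
      unfolding suc by (rule le_less_trans[OF diameter_square_le n]) simp
    ultimately show ?thesis using \<delta>(2) by blast
  qed
  define v where "v = (\<lambda>i j. SOME v.
     {real i / ?n .. real (Suc i) / ?n} \<times> {real j / ?n .. real (Suc j) / ?n} \<subseteq> U v)"
  have v: "{real i / ?n .. real (Suc i) / ?n} \<times> {real j / ?n .. real (Suc j) / ?n} \<subseteq> U (v i j)"
    if "i < m * q" "j < m * q" for i j
    unfolding v_def using ex[OF that] by (rule someI_ex)
  show ?thesis
  proof (rule exI[of _ q], rule conjI[OF q0], rule exI[of _ v], intro allI impI)
    fix i j x y
    assume ij: "i < m * q" "j < m * q" and xy: "real i / real (m * q) \<le> x" "x \<le> real (Suc i) / real (m * q)"
       "real j / real (m * q) \<le> y" "y \<le> real (Suc j) / real (m * q)"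
    then have *: "x \<in> {real i / ?n .. real (Suc i) / ?n}" "y \<in> {real j / ?n .. real (Suc j) / ?n}"
      unfolding atLeastAtMost_iff by blast+
    then have "(x, y) \<in> U (v i j)"
      using v[OF ij] by blast
    moreover have "(x, y) \<in> ?S"
      using * sub[OF ij(1)] sub[OF ij(2)] by blast
    ultimately show "H (x, y) \<in> open_star K (v i j)"
      using U(2)[of "v i j"] by blast
  qed
qed

text \<open>The piecewise linear path through the vertices \<open>a 0, \<dots>, a m\<close>, as a sum of tent functions.\<close>

definition edge_path_map :: "(nat \<Rightarrow> 'a) \<Rightarrow> nat \<Rightarrow> real \<Rightarrow> 'a \<Rightarrow> real" where
  "edge_path_map a m t v = (\<Sum>k\<le>m. if a k = v then max 0 (1 - \<bar>m * t - k\<bar>) else 0)"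

text \<open>On this segment all tents but two vanish, and these two sum to 1. Weights are collected
  by index, since the two vertices may coincide.\<close>

lemma edge_path_map_in_cell:
  fixes t :: real
  assumes "k < m" "real k \<le> real m * t" "real m * t \<le> real (Suc k)"
  shows "edge_path_map a m t \<in> closed_cell {a k, a (Suc k)}"
proof -
  define c where "c = (\<lambda>j. max 0 (1 - \<bar>real m * t - real j\<bar>))"
  have c0: "c j = 0" if "j \<noteq> k" "j \<noteq> Suc k" for j
  proof -
    have "j < k \<or> Suc k < j" using that by linarith
    then have "real j + 1 \<le> real k \<or> real k + 2 \<le> real j"
      by linarith
    then show ?thesis unfolding c_def using assms by auto
  qed
  have *: "(\<Sum>j\<le>m. g j * c j) = g k * c k + g (Suc k) * c (Suc k)" for g :: "nat \<Rightarrow> real"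
  proof -
    have "(\<Sum>j\<le>m. g j * c j) = (\<Sum>j\<in>{k, Suc k}. g j * c j)"
      using assms(1) c0 by (intro sum.mono_neutral_right) auto
    then show ?thesis by simp
  qed
  have e: "edge_path_map a m t v = (if a k = v then c k else 0) + (if a (Suc k) = v then c (Suc k) else 0)"
    for v
  proof -
    have "edge_path_map a m t v = (\<Sum>j\<le>m. (if a j = v then 1 else 0) * c j)"
      unfolding edge_path_map_def c_def by (intro sum.cong) auto
    then show ?thesis using *[of "\<lambda>j. if a j = v then 1 else 0"] by auto
  qed
  have "c k + c (Suc k) = 1" "0 \<le> c k" "0 \<le> c (Suc k)"
    unfolding c_def using assms by auto
  then show ?thesis
    by (cases "a k = a (Suc k)") (auto simp: closed_cell_def e)
qed

lemma edge_path_map_vertex: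
  assumes "k \<le> m" "0 < m"
  shows "edge_path_map a m (real k / m) = vertex_point (a k)"
proof
  fix v
  have "edge_path_map a m (real k / m) v = (\<Sum>j\<le>m. if a j = v then max 0 (1 - \<bar>real k - j\<bar>) else 0)"
    unfolding edge_path_map_def using assms by (intro sum.cong) auto
  also have "\<dots> = (\<Sum>j\<le>m. if j = k then (if a k = v then 1 else 0) else 0)"
  proof (rule sum.cong)
    fix j
    have "max 0 (1 - \<bar>real k - real j\<bar>) = 0" if "j \<noteq> k"
    proof -
      have "j + 1 \<le> k \<or> k + 1 \<le> j" using that by linarith
      then have "real j + 1 \<le> real k \<or> real k + 1 \<le> real j" by linarith
      then show ?thesis by auto
    qed
    then show "(if a j = v then max 0 (1 - \<bar>real k - real j\<bar>) else 0)
        = (if j = k then (if a k = v then 1 else 0) else 0)" by auto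
  qed simp
  also have "\<dots> = vertex_point (a k) v"
    using assms by (simp add: vertex_point_def)
  finally show "edge_path_map a m (real k / m) v = vertex_point (a k) v" .
qed

lemma edge_path_map_segment:
  fixes t :: real
  assumes "0 < m" "0 \<le> t" "t \<le> 1"
  obtains k where "k < m" "real k \<le> real m * t" "real m * t \<le> real (Suc k)"
\<comment> \<open>At \<open>t = 1\<close> the floor of \<open>m * t\<close> would be
  \<open>m\<close>, which is not the index of a segment.\<close>
proof (cases "t = 1")
  case True
  then show ?thesis using that[of "m - 1"] assms by auto
next
  case False
  define k where "k = nat \<lfloor>real m * t\<rfloor>"
  have "0 \<le> real m * t" using assms by simp
  then have k: "real k \<le> real m * t" "real m * t < real (Suc k)"
    unfolding k_def by linarith+
  have "real m * t < real m" using False assms by simp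
  then have "k < m" using k by linarith
  then show ?thesis using k that by auto
qed

lemma continuous_map_edge_path:
  assumes K: "abstract_complex K" and m: "0 < m"
    and e: "\<And>k. k < m \<Longrightarrow> edge K (a k) (a (Suc k))"
  shows "continuous_map (top_of_set {0..1}) (geometric_realization K) (edge_path_map a m)"
proof (rule continuous_map_into_realization[OF K, of "a ` {..m}"])
  fix t assume "t \<in> topspace (top_of_set {0..1::real})"
  then obtain k where k: "k < m" "real k \<le> real m * t" "real m * t \<le> real (Suc k)"
    using edge_path_map_segment[OF m, of t] by auto
  note c = edge_path_map_in_cell[OF k, of a]
  obtain s where s: "s \<in> K" "{a k, a (Suc k)} \<subseteq> s"
    using e[OF k(1)] by (auto simp: edge_def)
  then have "finite s" using K by (auto simp: abstract_complex_def)
  then show "edge_path_map a m t \<in> topspace (geometric_realization K)"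
    using c s closed_cell_mono[OF s(2)] by (auto simp: topspace_geometric_realization)
  show "supp (edge_path_map a m t) \<subseteq> a ` {..m}"
    using closed_cell_supp(1)[OF c] k(1) by (simp add: subset_iff) (metis Suc_leI atMost_iff image_eqI less_imp_le_nat)
next
  fix v
  show "continuous_map (top_of_set {0..1}) euclideanreal (\<lambda>t. edge_path_map a m t v)"
    unfolding edge_path_map_def continuous_map_iff_continuous
  proof (rule continuous_on_sum)
    fix k
    show "continuous_on {0..1} (\<lambda>t. if a k = v then max 0 (1 - \<bar>real m * t - real k\<bar>) else 0)"
      by (cases "a k = v") (auto intro!: continuous_intros)
  qed
qed auto

text \<open>The squares of a fine grid on a null homotopy are labelled by vertices whose open stars
  contain their images. Consecutive rows of labels have equal transport by \<open>ladder\<close>;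
  the last row is constant and the first one follows the loop.\<close>

lemma edge_loop_transport:
  assumes K: "abstract_complex K" and sc: "simply_connected_space (geometric_realization K)"
    and ls: "local_system K S T"
    and e: "\<And>k. k < m \<Longrightarrow> edge K (a k) (a (Suc k))" and cl: "a m = a 0" and s: "s \<in> S (a 0)"
  shows "transport T a m s = s"
proof (cases "m = 0")
  case False
  then have m: "0 < m" by simp
  define p where "p = edge_path_map a m"
  have p: "continuous_map (top_of_set {0..1}) (geometric_realization K) p"
    unfolding p_def using continuous_map_edge_path[OF K m, of a] e by simp
  have p0: "p 0 = vertex_point (a 0)" and p1: "p 1 = vertex_point (a 0)"
    using edge_path_map_vertex[of 0 m a] edge_path_map_vertex[of m m a] m cl by (auto simp: p_def)
  have "homotopic_with (\<lambda>q. q 0 = p 0 \<and> q 1 = p 0) (top_of_set {0..1}) (geometric_realization K) p (\<lambda>_. p 0)"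
    using sc p p0 p1 by (auto simp: simply_connected_space_def pathin_def)
  from this[unfolded homotopic_with_def] obtain H :: "real \<times> real \<Rightarrow> 'a \<Rightarrow> real" where H:
    "continuous_map (prod_topology (top_of_set {0..1}) (top_of_set {0..1})) (geometric_realization K) H \<and>
     (\<forall>x. H (0, x) = p x) \<and> (\<forall>x. H (1, x) = p 0) \<and> (\<forall>t\<in>{0..1}. H (t, 0) = p 0 \<and> H (t, 1) = p 0)"
    by (rule exE)
  have Hc: "continuous_map (prod_topology (top_of_set {0..1}) (top_of_set {0..1})) (geometric_realization K) H"
    and H0: "\<And>x. H (0, x) = p x" and H1: "\<And>x. H (1, x) = p 0"
    and Hs: "\<And>t. t \<in> {0..1} \<Longrightarrow> H (t, 0) = p 0 \<and> H (t, 1) = p 0"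
    using H by simp_all
  obtain q v where q: "0 < q" and v:
    "\<And>i j x y. \<lbrakk>i < m * q; j < m * q; real i / real (m * q) \<le> x; x \<le> real (Suc i) / real (m * q);
       real j / real (m * q) \<le> y; y \<le> real (Suc j) / real (m * q)\<rbrakk> \<Longrightarrow> H (x, y) \<in> open_star K (v i j)"
    using fine_grid[OF K m Hc] by blast
  define n where "n = m * q"
  have n: "0 < n" using m q by (simp add: n_def)
  \<comment> \<open>A grid point is a corner of up to four squares and lies in the stars of all
    their labels.\<close>
  have corner: "H (real (i + di) / n, real (j + dj) / n) \<in> open_star K (v i j)"
    if "i < n" "j < n" "di \<le> 1" "dj \<le> 1" for i j di dj
  proof -
    have *: "real k / n \<le> real (k + d) / n" "real (k + d) / n \<le> real (Suc k) / n" if "d \<le> 1" for k d :: nat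
      using that by (auto intro!: divide_right_mono)
    show ?thesis
      using v[folded n_def, OF that(1,2) *[OF that(3)] *[OF that(4)]] .
  qed
  have frac: "real i / n \<in> {0..1}" if "i \<le> n" for i
    using that n by (auto simp: divide_le_eq_1)
  \<comment> \<open>A vertex lies in no open star but its own, so the labels along the sides mapped
    to \<open>a 0\<close> are forced.\<close>
  have v0: "v i 0 = a 0" if "i < n" for i
  proof -
    have "H (real i / n, 0) = vertex_point (a 0)" using Hs[OF frac] that p0 by simp
    then have "vertex_point (a 0) \<in> open_star K (v i 0)" using corner[OF that n, of 0 0] by simp
    then show ?thesis by (rule vertex_point_in_open_star)
  qed
  have vn: "v i (n - 1) = a 0" if "i < n" for i
  proof -
    have "H (real i / n, 1) = vertex_point (a 0)" using Hs[OF frac] that p0 by simp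
    moreover have "real (n - 1 + 1) / n = 1" using n by simp
    ultimately have "vertex_point (a 0) \<in> open_star K (v i (n - 1))"
      using corner[OF that, of "n - 1" 0 1] n by simp
    then show ?thesis by (rule vertex_point_in_open_star)
  qed
  have vt: "v (n - 1) j = a 0" if "j < n" for j
  proof -
    have "H (1, real j / n) = vertex_point (a 0)" using H1 p0 by simp
    moreover have "real (n - 1 + 1) / n = 1" using n by simp
    ultimately have "vertex_point (a 0) \<in> open_star K (v (n - 1) j)"
      using corner[OF _ that, of "n - 1" 1 0] n by simp
    then show ?thesis by (rule vertex_point_in_open_star)
  qed
  have edge0: "edge K (a 0) (a 0)"
    using e[OF m] by (auto simp: edge_def)
  have Ts: "T (a 0) (a 0) s = s"
    using edge_transport(2)[OF ls edge0 s] .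
  have row: "transport T (v i) (n - 1) s = transport T (v (Suc i)) (n - 1) s" if i: "Suc i < n" for i
  proof -
    \<comment> \<open>The four squares share the grid point with indices \<open>Suc i\<close>,
      \<open>Suc j\<close>.\<close>
    have sq: "\<exists>t\<in>K. {v i j, v i (Suc j), v (Suc i) j, v (Suc i) (Suc j)} \<subseteq> t" if "j < n - 1" for j
    proof (rule open_star_common_simplex[OF K])
      fix w assume "w \<in> {v i j, v i (Suc j), v (Suc i) j, v (Suc i) (Suc j)}"
      then show "H (real (Suc i) / n, real (Suc j) / n) \<in> open_star K w"
        using corner[of i j 1 1] corner[of i "Suc j" 1 0] corner[of "Suc i" j 0 1]
          corner[of "Suc i" "Suc j" 0 0] i that by auto
    qed simp
    have "T (v i (n - 1)) (v (Suc i) (n - 1)) (transport T (v i) (n - 1) s)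
        = transport T (v (Suc i)) (n - 1) (T (v i 0) (v (Suc i) 0) s)"
    proof (rule ladder[OF ls])
      show "s \<in> S (v i 0)" "edge K (v i 0) (v (Suc i) 0)" using v0 i s edge0 by simp_all
    qed (rule sq)
    moreover have "transport T (v i) (n - 1) s \<in> S (v i (n - 1))"
      by (rule transport_in[OF ls]) (use sq s v0 i in \<open>auto simp: edge_def\<close>)
    ultimately show ?thesis
      using i vn v0 Ts edge_transport(2)[OF ls edge0] by simp
  qed
  have top: "transport T (v (n - 1)) j s = s" if "j < n" for j
    using that by (induction j) (use vt Ts in auto)
  have "transport T (v i) (n - 1) s = transport T (v 0) (n - 1) s" if "i < n" for i
    using that by (induction i) (use row in auto)
  from this[of "n - 1"] have bottom: "transport T (v 0) (n - 1) s = s" using top n by simp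
  \<comment> \<open>Each edge of the loop carries \<open>q\<close> grid segments, and a point of an
    edge is only in the stars of its two ends.\<close>
  have seg: "v 0 j \<in> {a (j div q), a (Suc (j div q))}" "j div q < m" if "j < n" for j
  proof -
    show k: "j div q < m"
      using that q by (simp add: n_def less_mult_imp_div_less)
    have "j div q * q \<le> j" "j \<le> Suc (j div q) * q"
      using q by (simp_all add: dividend_less_times_div div_times_less_eq_dividend order_less_imp_le mult.commute)
    then have "real (j div q) * q \<le> j" "real j \<le> real (Suc (j div q)) * q"
      by (metis of_nat_le_iff of_nat_mult)+
    then have "real (j div q) \<le> real m * (real j / n)" "real m * (real j / n) \<le> real (Suc (j div q))"
      using q m by (simp_all add: n_def field_simps)
    then have "p (real j / n) \<in> closed_cell {a (j div q), a (Suc (j div q))}"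
      unfolding p_def using k edge_path_map_in_cell by blast
    moreover have "p (real j / n) \<in> open_star K (v 0 j)"
      using corner[of 0 j 0 0] that n H0 by simp
    ultimately show "v 0 j \<in> {a (j div q), a (Suc (j div q))}"
      by (force simp: open_star_def closed_cell_def)
  qed
  have e0: "edge K (v 0 j) (v 0 (Suc j))" if "Suc j < n" for j
  proof -
    have "\<exists>t\<in>K. {v 0 j, v 0 (Suc j)} \<subseteq> t"
    proof (rule open_star_common_simplex[OF K])
      fix w assume "w \<in> {v 0 j, v 0 (Suc j)}"
      then show "H (0, real (Suc j) / n) \<in> open_star K w"
        using corner[of 0 j 0 1] corner[of 0 "Suc j" 0 0] that by auto
    qed simp
    then show ?thesis by (auto simp: edge_def)
  qed
  \<comment> \<open>The label may be the far end of the current edge; one transport back inside this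
    edge brings labels and loop into step.\<close>
  have along: "T (v 0 j) (a (j div q)) (transport T (v 0) j s) = transport T a (j div q) s" if "j < n" for j
    using that
  proof (induction j)
    case 0
    then show ?case using v0 n Ts by simp
  next
    case (Suc j)
    let ?k = "j div q"
    let ?X = "transport T (v 0) j s"
    have X: "?X \<in> S (v 0 j)"
      by (rule transport_in[OF ls]) (use e0 Suc.prems s v0 n in auto)
    obtain t where t: "t \<in> K" "a ?k \<in> t" "a (Suc ?k) \<in> t"
      using e[OF seg(2)[of j]] Suc.prems by (auto simp: edge_def)
    have vj: "v 0 j \<in> t" using seg(1)[of j] t Suc.prems by auto
    have IH: "T (v 0 j) (a ?k) ?X = transport T a ?k s" using Suc by simp
    show ?case
    proof (cases "Suc j div q = ?k")
      case True
      then have "v 0 (Suc j) \<in> t" using seg(1)[of "Suc j"] t Suc.prems by auto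
      then show ?thesis
        using True local_systemD(4)[OF ls t(1) vj _ X] t(2) IH by simp
    next
      case False
      then have k0: "Suc j mod q = 0" "Suc j div q = Suc ?k"
        unfolding div_Suc by (auto split: if_splits)
      then have k: "Suc j div q = Suc ?k" "Suc j = Suc ?k * q"
        using div_mult_mod_eq[of "Suc j" q] by simp_all
      \<comment> \<open>The grid point between segments \<open>j\<close> and \<open>Suc j\<close> is
        now a vertex of the loop, which forces both adjacent labels.\<close>
      have "real (Suc j) / n = real (Suc ?k) / m"
        unfolding k(2) n_def of_nat_mult using q by (intro mult_divide_mult_cancel_right) simp
      then have pk: "p (real (Suc j) / n) = vertex_point (a (Suc ?k))"
        using edge_path_map_vertex[of "Suc ?k" m a] seg(2)[of j] Suc.prems m unfolding p_def by simp
      have "v 0 j = a (Suc ?k)" "v 0 (Suc j) = a (Suc ?k)"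
        using corner[of 0 j 0 1] corner[of 0 "Suc j" 0 0] Suc.prems n H0 pk
        by (auto dest: vertex_point_in_open_star)
      note vv = this
      then have X': "?X \<in> S (a (Suc ?k))" using X by simp
      have "T (a ?k) (a (Suc ?k)) (transport T a ?k s) = ?X"
        using local_systemD(3)[OF ls t(1) t(3) t(2) X'] IH vv by simp
      then show ?thesis
        using k(1) vv local_systemD(2)[OF ls t(1) t(3) t(3) X'] by simp
    qed
  qed
  \<comment> \<open>The last label lies on the last edge and is already its end
    \<open>a m = a 0\<close>; only this edge remains to be traversed.\<close>
  have "T (a 0) (a (m - 1)) s = transport T a (m - 1) s"
  proof -
    have "(n - 1) div q = m - 1"
    proof (rule div_nat_eqI)
      have "n = (m - 1) * q + q" unfolding n_def using m by (cases m) auto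
      then show "q * (m - 1) \<le> n - 1" "n - 1 < q * Suc (m - 1)"
        using q m by (auto simp: algebra_simps)
    qed
    then show ?thesis
      using along[of "n - 1"] n vn[OF n] bottom by simp
  qed
  moreover have "edge K (a 0) (a (m - 1))"
    using e[of "m - 1"] m cl edge_sym by force
  ultimately have "T (a (m - 1)) (a 0) (transport T a (m - 1) s) = s"
    using edge_transport(3)[OF ls] s by metis
  then show ?thesis
    using m cl by (metis Suc_pred' transport.simps(2))
qed simp

text \<open>The same labelling for a single path, regarded as a map of the square that is constant
  in the first variable; row 0 gives the edge path.\<close>

lemma edge_connected:
  assumes K: "abstract_complex K" and pc: "path_connected_space (geometric_realization K)"
    and "a \<in> \<Union>K" "b \<in> \<Union>K"
  shows "(edge K)\<^sup>*\<^sup>* a b"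
proof -
  obtain p where p: "pathin (geometric_realization K) p" "p 0 = vertex_point a" "p 1 = vertex_point b"
    using pc vertex_point_in_realization[OF K] assms(3,4) unfolding path_connected_space_def by metis
  have c: "continuous_map (prod_topology (top_of_set {0..1}) (top_of_set {0..1})) (geometric_realization K) (p \<circ> snd)"
    using p(1) unfolding pathin_def by (intro continuous_map_compose[OF continuous_map_snd]) simp
  obtain n v where n: "0 < n" and v:
    "\<And>i j x y. \<lbrakk>i < 1 * n; j < 1 * n; real i / (1 * n) \<le> x; x \<le> real (Suc i) / (1 * n);
       real j / (1 * n) \<le> y; y \<le> real (Suc j) / (1 * n)\<rbrakk> \<Longrightarrow> (p \<circ> snd) (x, y) \<in> open_star K (v i j)"
    using fine_grid[OF K zero_less_one c] by blast
  have vj: "p (real (j + d) / n) \<in> open_star K (v 0 j)" if "j < n" "d \<le> 1" for j d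
  proof -
    have "real j / n \<le> real (j + d) / n" "real (j + d) / n \<le> real (Suc j) / n"
      using that by (auto intro!: divide_right_mono)
    then show ?thesis using v[of 0 j 0 "real (j + d) / n"] that n by simp
  qed
  have "(edge K)\<^sup>*\<^sup>* (v 0 0) (v 0 j)" if "j < n" for j
    using that
  proof (induction j)
    case (Suc j)
    have "\<exists>t\<in>K. {v 0 j, v 0 (Suc j)} \<subseteq> t"
    proof (rule open_star_common_simplex[OF K])
      fix w assume "w \<in> {v 0 j, v 0 (Suc j)}"
      then show "p (real (Suc j) / n) \<in> open_star K w"
        using vj[of j 1] vj[of "Suc j" 0] Suc.prems by auto
    qed simp
    then have "edge K (v 0 j) (v 0 (Suc j))" by (auto simp: edge_def)
    then show ?case using Suc by (simp add: rtranclp.rtrancl_into_rtrancl)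
  qed simp
  from this[of "n - 1"] have "(edge K)\<^sup>*\<^sup>* (v 0 0) (v 0 (n - 1))" using n by simp
  moreover have "v 0 0 = a"
  proof (rule vertex_point_in_open_star)
    show "vertex_point a \<in> open_star K (v 0 0)" using vj[of 0 0] n p by simp
  qed
  moreover have "v 0 (n - 1) = b"
  proof (rule vertex_point_in_open_star)
    have "real (n - 1 + 1) / n = 1" using n by simp
    then show "vertex_point b \<in> open_star K (v 0 (n - 1))" using vj[of "n - 1" 1] n p by simp
  qed
  ultimately show ?thesis by simp
qed

text \<open>\<open>R\<close> moves points of the total space along edges. By connectedness the orbit
  of the given point meets every fibre, and by \<open>edge_loop_transport\<close> it meets each
  fibre only once.\<close>

theorem global_section:
  assumes K: "abstract_complex K" and sc: "simply_connected_space (geometric_realization K)"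
    and ls: "local_system K S T" and a0: "a0 \<in> \<Union>K" and s0: "s0 \<in> S a0"
  obtains \<sigma> where "\<sigma> a0 = s0" "\<And>b. b \<in> \<Union>K \<Longrightarrow> \<sigma> b \<in> S b"
    "\<And>a b. edge K a b \<Longrightarrow> T a b (\<sigma> a) = \<sigma> b"
proof -
  define R where "R = (\<lambda>(a, s) (b, t). edge K a b \<and> s \<in> S a \<and> t = T a b s)"
  have sym: "R\<^sup>*\<^sup>* y x" if "R\<^sup>*\<^sup>* x y" for x y
    using that
  proof (induction rule: rtranclp_induct)
    case (step y z)
    obtain b t where y: "y = (b, t)" by fastforce
    with step.hyps obtain c where c: "z = (c, T b c t)" "edge K b c" "t \<in> S b"
      by (auto simp: R_def)
    have "R z y"
      using edge_transport[OF ls c(2,3)] edge_sym[OF c(2)] by (simp add: R_def y c(1))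
    then show ?case using step.IH by (rule converse_rtranclp_into_rtranclp)
  qed simp
  have loop: "s = t" if "R\<^sup>*\<^sup>* (a, s) (a, t)" "s \<in> S a" for a s t
  proof -
    obtain m where "(R ^^ m) (a, s) (a, t)"
      using rtranclp_imp_relpowp[OF \<open>R\<^sup>*\<^sup>* (a, s) (a, t)\<close>] by blast
    then obtain f where "f 0 = (a, s) \<and> f m = (a, t) \<and> (\<forall>i<m. R (f i) (f (Suc i)))"
      unfolding relpowp_fun_conv by (rule exE)
    then have f: "f 0 = (a, s)" "f m = (a, t)" "\<And>i. i < m \<Longrightarrow> R (f i) (f (Suc i))"
      by simp_all
    have tr: "snd (f k) = transport T (fst \<circ> f) k s" if "k \<le> m" for k
      using that
    proof (induction k)
      case (Suc k)
      then have "R (f k) (f (Suc k))" using f(3) by simp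
      then have "snd (f (Suc k)) = T (fst (f k)) (fst (f (Suc k))) (snd (f k))"
        by (auto simp: R_def split: prod.splits)
      then show ?case using Suc by simp
    qed (use f in simp)
    have "edge K ((fst \<circ> f) k) ((fst \<circ> f) (Suc k))" if "k < m" for k
      using f(3)[OF that] by (auto simp: R_def split: prod.splits)
    then have "transport T (fst \<circ> f) m s = s"
      by (rule edge_loop_transport[OF K sc ls]) (use f that in auto)
    then show ?thesis using tr[of m] f(2) by simp
  qed
  have inS: "t \<in> S b" if "R\<^sup>*\<^sup>* (a0, s0) (b, t)" for b t
    using that
  proof (cases rule: rtranclp.cases)
    case (rtrancl_into_rtrancl y)
    then obtain c u where "edge K c b" "u \<in> S c" "t = T c b u"
      by (auto simp: R_def)
    then show ?thesis using edge_transport(1)[OF ls] by blast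
  qed (use s0 in auto)
  have ex: "\<exists>t. R\<^sup>*\<^sup>* (a0, s0) (b, t)" if "b \<in> \<Union>K" for b
  proof -
    have "path_connected_space (geometric_realization K)"
      using sc by (simp add: simply_connected_space_def)
    then have "(edge K)\<^sup>*\<^sup>* a0 b"
      using edge_connected[OF K _ a0 that] by blast
    then show ?thesis
    proof (induction rule: rtranclp_induct)
      case (step y z)
      then obtain t where t: "R\<^sup>*\<^sup>* (a0, s0) (y, t)" by blast
      then have "R (y, t) (z, T y z t)" using step inS by (auto simp: R_def)
      then show ?case using t by (meson rtranclp.rtrancl_into_rtrancl)
    qed auto
  qed
  define \<sigma> where "\<sigma> = (\<lambda>b. SOME t. R\<^sup>*\<^sup>* (a0, s0) (b, t))"
  have \<sigma>: "R\<^sup>*\<^sup>* (a0, s0) (b, \<sigma> b)" if "b \<in> \<Union>K" for b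
    unfolding \<sigma>_def using ex[OF that] by (rule someI_ex)
  show ?thesis
  proof (rule that)
    show "\<sigma> a0 = s0"
      using loop[OF \<sigma>[OF a0]] s0 by simp
    show "\<sigma> b \<in> S b" if "b \<in> \<Union>K" for b
      using inS[OF \<sigma>[OF that]] .
    fix a b assume e: "edge K a b"
    then have ab: "a \<in> \<Union>K" "b \<in> \<Union>K" by (auto simp: edge_def)
    have "R (a, \<sigma> a) (b, T a b (\<sigma> a))"
      using e inS[OF \<sigma>[OF ab(1)]] by (auto simp: R_def)
    then have *: "R\<^sup>*\<^sup>* (a0, s0) (b, T a b (\<sigma> a))"
      using \<sigma>[OF ab(1)] by (meson rtranclp.rtrancl_into_rtrancl)
    then have "R\<^sup>*\<^sup>* (b, T a b (\<sigma> a)) (b, \<sigma> b)"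
      using sym \<sigma>[OF ab(2)] by (meson rtranclp_trans)
    then show "T a b (\<sigma> a) = \<sigma> b"
      using loop inS[OF *] by blast
  qed
qed

text \<open>Transport is only given downwards, along \<open>R x y\<close>, but is bijective there. Comparing with the
  least vertex of a simplex extends it to all edges.\<close>

theorem global_section_ordered:
  assumes K: "abstract_complex K" and sc: "simply_connected_space (geometric_realization K)"
    and least: "\<And>t. t \<in> K \<Longrightarrow> \<exists>m\<in>t. \<forall>a\<in>t. R m a"
    and total: "\<And>t a b. \<lbrakk>t \<in> K; a \<in> t; b \<in> t\<rbrakk> \<Longrightarrow> R a b \<or> R b a"
    and bij: "\<And>x y. \<lbrakk>edge K x y; R x y\<rbrakk> \<Longrightarrow> bij_betw (D y x) (S y) (S x)"
    and comp: "\<And>t x y z s. \<lbrakk>t \<in> K; x \<in> t; y \<in> t; z \<in> t; R x y; R y z; R x z; s \<in> S z\<rbrakk>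
      \<Longrightarrow> D y x (D z y s) = D z x s"
    and a0: "a0 \<in> \<Union>K" and s0: "s0 \<in> S a0"
  shows "\<exists>\<sigma>. \<sigma> a0 = s0 \<and> (\<forall>b\<in>\<Union>K. \<sigma> b \<in> S b) \<and>
    (\<forall>x y. edge K x y \<longrightarrow> R x y \<longrightarrow> D y x (\<sigma> y) = \<sigma> x)"
proof -
  define T where "T = (\<lambda>a b. if R b a then D a b else inv_into (S b) (D b a))"
  \<comment> \<open>Transport is characterized by agreement after descending to the least vertex
    \<open>m\<close>, where \<open>D\<close> is injective. The cocycle laws follow without cases on
    the order of the vertices.\<close>
  have T: "T a b s \<in> S b \<and> D b m (T a b s) = D a m s"
    if "t \<in> K" "m \<in> t" "\<forall>a\<in>t. R m a" "a \<in> t" "b \<in> t" "s \<in> S a" for t m a b s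
  proof (cases "R b a")
    case True
    have e: "edge K b a" using that by (auto simp: edge_def)
    then show ?thesis
      using True comp[of t m b a s] that bij_betwE[OF bij[OF e True]] by (auto simp: T_def)
  next
    case False
    then have ab: "R a b" using total that by blast
    have e: "edge K a b" using that by (auto simp: edge_def)
    note b = bij[OF e ab]
    have "s \<in> D b a ` S b" using b that by (auto simp: bij_betw_def)
    then have 1: "T a b s \<in> S b" "D b a (T a b s) = s"
      using False by (auto simp: T_def inv_into_into f_inv_into_f)
    then show ?thesis
      using comp[of t m a b "T a b s"] that ab by simp
  qed
  have inj: "s = s'" if "t \<in> K" "m \<in> t" "\<forall>a\<in>t. R m a" "a \<in> t" "s \<in> S a" "s' \<in> S a" "D a m s = D a m s'"
    for t m a s s'
  proof -
    have "edge K m a" using that by (auto simp: edge_def)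
    then have "inj_on (D a m) (S a)" using bij that by (auto simp: bij_betw_def)
    then show ?thesis using that by (auto dest: inj_onD)
  qed
  have "local_system K S T"
    unfolding local_system_def
  proof (intro conjI ballI)
    fix t a b s assume t: "t \<in> K" "a \<in> t" "b \<in> t" "s \<in> S a"
    obtain m where m: "m \<in> t" "\<forall>a\<in>t. R m a" using least[OF t(1)] by blast
    show "T a b s \<in> S b" using T[OF t(1) m t(2-4)] by blast
  next
    fix t a s assume t: "t \<in> K" "a \<in> t" "s \<in> S a"
    obtain m where m: "m \<in> t" "\<forall>a\<in>t. R m a" using least[OF t(1)] by blast
    show "T a a s = s"
      using inj[OF t(1) m t(2)] T[OF t(1) m t(2) t(2) t(3)] t(3) by blast
  next
    fix t a b c s assume t: "t \<in> K" "a \<in> t" "b \<in> t" "c \<in> t" "s \<in> S a"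
    obtain m where m: "m \<in> t" "\<forall>a\<in>t. R m a" using least[OF t(1)] by blast
    note 1 = T[OF t(1) m t(2,3,5)] and 3 = T[OF t(1) m t(2,4,5)]
    note 2 = T[OF t(1) m t(3,4) conjunct1[OF 1]]
    show "T b c (T a b s) = T a c s"
      using inj[OF t(1) m t(4)] 1 2 3 by metis
  qed
  from global_section[OF K sc this a0 s0] obtain \<sigma> where
    \<sigma>: "\<sigma> a0 = s0" "\<And>b. b \<in> \<Union>K \<Longrightarrow> \<sigma> b \<in> S b" "\<And>a b. edge K a b \<Longrightarrow> T a b (\<sigma> a) = \<sigma> b"
    by metis
  have "D y x (\<sigma> y) = \<sigma> x" if "edge K x y" "R x y" for x y
    using \<sigma>(3)[OF edge_sym[OF that(1)]] that(2) by (simp add: T_def)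
  then show ?thesis using \<sigma> by blast
qed

section \<open>Order homotopies\<close>

text \<open>The map of realizations induced by a vertex map; weights of vertices with the same image
  add up.\<close>

definition push :: "('a \<Rightarrow> 'a) \<Rightarrow> ('a \<Rightarrow> real) \<Rightarrow> 'a \<Rightarrow> real" where
  "push g f w = (\<Sum>y\<in>supp f. of_bool (g y = w) * f y)"

definition clamp_to :: "real \<Rightarrow> real \<Rightarrow> real \<Rightarrow> real" where
  "clamp_to a b x = max a (min b x)"

text \<open>The left end of the interval on which the step function of \<open>f\<close> has the
  value \<open>y\<close>.\<close>

definition cumulative :: "('a \<Rightarrow> 'a \<Rightarrow> bool) \<Rightarrow> 'a set \<Rightarrow> ('a \<Rightarrow> real) \<Rightarrow> 'a \<Rightarrow> real" where
  "cumulative lq s f y = sum f {z\<in>s. lq z y \<and> z \<noteq> y}"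

text \<open>A point of a simplex is a monotone step function \<open>[0,1) \<rightarrow> 'a\<close> which takes the value \<open>y\<close> on an
  interval of length \<open>f y\<close>. At time \<open>u\<close>, its value \<open>y\<close> at \<open>\<tau>\<close> is replaced by \<open>F \<lfloor>u + \<tau>\<rfloor> y\<close>. The summand
  below is the length of the part of the interval of \<open>y\<close> on which \<open>\<lfloor>u + \<tau>\<rfloor> = j\<close>.\<close>

definition order_htpy_cell :: "('a \<Rightarrow> 'a \<Rightarrow> bool) \<Rightarrow> (nat \<Rightarrow> 'a \<Rightarrow> 'a) \<Rightarrow> nat \<Rightarrow> 'a set \<Rightarrow>
    real \<Rightarrow> ('a \<Rightarrow> real) \<Rightarrow> 'a \<Rightarrow> real" where
  "order_htpy_cell lq F M s u f w = (\<Sum>y\<in>s. \<Sum>j\<le>M. of_bool (F j y = w) *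
     (clamp_to (cumulative lq s f y) (cumulative lq s f y + f y) (real (Suc j) - u) -
      clamp_to (cumulative lq s f y) (cumulative lq s f y + f y) (real j - u)))"

lemma clamp_to_simps:
  "b \<le> x \<Longrightarrow> a \<le> b \<Longrightarrow> clamp_to a b x = b" "x \<le> a \<Longrightarrow> clamp_to a b x = a" "clamp_to a a x = a"
  by (auto simp: clamp_to_def)

lemma clamp_to_mono: "x \<le> y \<Longrightarrow> clamp_to a b x \<le> clamp_to a b y"
  by (auto simp: clamp_to_def)

text \<open>\<open>cut\<close> is what keeps a point in a simplex between stages: the upper part of
  the chain has already passed to \<open>F (Suc j)\<close>, the lower part still uses
  \<open>F j\<close>, and at \<open>y\<close> both may occur. Stabilization is only required vertex
  by vertex.\<close>

locale order_homotopy =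
  fixes K :: "'a set set" and lq :: "'a \<Rightarrow> 'a \<Rightarrow> bool" and F :: "nat \<Rightarrow> 'a \<Rightarrow> 'a" and G :: "'a \<Rightarrow> 'a"
  assumes K: "abstract_complex K"
    and refl: "\<And>s y. \<lbrakk>s \<in> K; y \<in> s\<rbrakk> \<Longrightarrow> lq y y"
    and total: "\<And>s y z. \<lbrakk>s \<in> K; y \<in> s; z \<in> s\<rbrakk> \<Longrightarrow> lq y z \<or> lq z y"
    and antisym: "\<And>s y z. \<lbrakk>s \<in> K; y \<in> s; z \<in> s; lq y z; lq z y\<rbrakk> \<Longrightarrow> y = z"
    and trans: "\<And>s x y z. \<lbrakk>s \<in> K; x \<in> s; y \<in> s; z \<in> s; lq x y; lq y z\<rbrakk> \<Longrightarrow> lq x z"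
    and cut: "\<And>s y j. \<lbrakk>s \<in> K; y \<in> s\<rbrakk> \<Longrightarrow>
      F j ` {z\<in>s. lq z y} \<union> F (Suc j) ` {z\<in>s. lq y z} \<in> K"
    and stable: "\<And>y. y \<in> \<Union>K \<Longrightarrow> \<exists>N. \<forall>j\<ge>N. F j y = G y"
begin

lemma finite_simplex: "s \<in> K \<Longrightarrow> finite s"
  using K by (auto simp: abstract_complex_def)

lemma least_in_simplex:
  assumes "s \<in> K" "finite A" "A \<noteq> {}" "A \<subseteq> s"
  shows "\<exists>y\<in>A. \<forall>z\<in>A. lq y z"
  using assms(2-4)
proof (induction A rule: finite_ne_induct)
  case (singleton x)
  then show ?case using refl[OF assms(1)] by auto
next
  case (insert x A)
  then obtain y where y: "y \<in> A" "\<forall>z\<in>A. lq y z" by blast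
  have s: "x \<in> s" "y \<in> s" "A \<subseteq> s" using insert.prems y by auto
  show ?case
  proof (cases "lq y x")
    case True
    then show ?thesis using y by blast
  next
    case False
    then have "lq x y" using total[OF assms(1) s(1,2)] by blast
    then have "\<forall>z\<in>A. lq x z"
      using y s trans[OF assms(1) s(1,2)] by blast
    then show ?thesis using refl[OF assms(1) s(1)] by blast
  qed
qed

lemma greatest_in_simplex:
  assumes "s \<in> K" "finite A" "A \<noteq> {}" "A \<subseteq> s"
  shows "\<exists>y\<in>A. \<forall>z\<in>A. lq z y"
  using assms(2-4)
proof (induction A rule: finite_ne_induct)
  case (singleton x)
  then show ?case using refl[OF assms(1)] by auto
next
  case (insert x A)
  then obtain y where y: "y \<in> A" "\<forall>z\<in>A. lq z y" by blast
  have s: "x \<in> s" "y \<in> s" "A \<subseteq> s" using insert.prems y by auto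
  show ?case
  proof (cases "lq x y")
    case True
    then show ?thesis using y by blast
  next
    case False
    then have "lq y x" using total[OF assms(1) s(1,2)] by blast
    then have "\<forall>z\<in>A. lq z x"
      using y s trans[OF assms(1) _ s(2,1)] by blast
    then show ?thesis using refl[OF assms(1) s(1)] by blast
  qed
qed

section \<open>The homotopy on one cell\<close>

lemma cumulative_bounds:
  assumes "s \<in> K" "f \<in> closed_cell s" "y \<in> s"
  shows "0 \<le> cumulative lq s f y" "cumulative lq s f y + f y \<le> 1"
proof -
  have f: "\<And>v. 0 \<le> f v" "sum f s = 1" using assms by (auto simp: closed_cell_def)
  then show "0 \<le> cumulative lq s f y"
    unfolding cumulative_def by (intro sum_nonneg) auto
  have "cumulative lq s f y + f y = sum f (insert y {z\<in>s. lq z y \<and> z \<noteq> y})"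
    unfolding cumulative_def using finite_simplex[OF assms(1)] by simp
  also have "\<dots> \<le> sum f s"
    using assms f finite_simplex[OF assms(1)] by (intro sum_mono2) auto
  finally show "cumulative lq s f y + f y \<le> 1" using f by simp
qed

lemma cumulative_less:
  assumes "s \<in> K" "f \<in> closed_cell s" "y \<in> s" "z \<in> s" "lq z y" "z \<noteq> y"
  shows "cumulative lq s f z + f z \<le> cumulative lq s f y"
proof -
  have f: "\<And>v. 0 \<le> f v" using assms by (auto simp: closed_cell_def)
  have "cumulative lq s f z + f z = sum f (insert z {x\<in>s. lq x z \<and> x \<noteq> z})"
    unfolding cumulative_def using finite_simplex[OF assms(1)] by simp
  also have "\<dots> \<le> cumulative lq s f y"
    unfolding cumulative_def
  proof (rule sum_mono2)
    show "insert z {x\<in>s. lq x z \<and> x \<noteq> z} \<subseteq> {x\<in>s. lq x y \<and> x \<noteq> y}"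
    proof
      fix x assume "x \<in> insert z {x\<in>s. lq x z \<and> x \<noteq> z}"
      then consider "x = z" | "x \<in> s" "lq x z" "x \<noteq> z" by blast
      then show "x \<in> {x\<in>s. lq x y \<and> x \<noteq> y}"
      proof cases
        case 1
        then show ?thesis using assms by blast
      next
        case 2
        have "lq x y" by (rule trans[OF assms(1) 2(1) assms(4,3) 2(2) assms(5)])
        moreover have "x \<noteq> y"
          using antisym[OF assms(1,4,3,5)] 2(2) assms(6) by blast
        ultimately show ?thesis using 2(1) by blast
      qed
    qed
  qed (use f finite_simplex[OF assms(1)] in auto)
  finally show ?thesis .
qed

text \<open>The unit intervals from \<open>j - u\<close> to \<open>j + 1 - u\<close> with
  \<open>j \<le> M\<close> cover \<open>[0,1]\<close> because \<open>0 \<le> u \<le> M\<close>, so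
  the pieces of the interval of \<open>y\<close> telescope to its length.\<close>

lemma cell_weight_sum:
  fixes u :: real
  assumes "s \<in> K" "f \<in> closed_cell s" "y \<in> s" "0 \<le> u" "u \<le> real M"
  shows "(\<Sum>j\<le>M.
     (clamp_to (cumulative lq s f y) (cumulative lq s f y + f y) (real (Suc j) - u) -
      clamp_to (cumulative lq s f y) (cumulative lq s f y + f y) (real j - u))) = f y"
proof -
  let ?c = "\<lambda>j. clamp_to (cumulative lq s f y) (cumulative lq s f y + f y) (real j - u)"
  have "(\<Sum>j\<le>M. ?c (Suc j) - ?c j) = ?c (Suc M) - ?c 0"
    using sum_telescope[of "\<lambda>j. - ?c j" M] by (simp add: algebra_simps)
  moreover have "?c (Suc M) = cumulative lq s f y + f y"
    using cumulative_bounds[OF assms(1-3)] assms(2,5)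
    by (intro clamp_to_simps(1)) (auto simp: closed_cell_def)
  moreover have "?c 0 = cumulative lq s f y"
    using cumulative_bounds[OF assms(1-3)] assms(4)
    by (intro clamp_to_simps(2)) auto
  ultimately show ?thesis by simp
qed

text \<open>If \<open>i\<close> is the integer part of \<open>u\<close>, only \<open>F i\<close> and
  \<open>F (Suc i)\<close> get weight, with the switch at \<open>i + 1 - u\<close>; so the image
  lies in one of the simplices granted by \<open>cut\<close>.\<close>

lemma order_htpy_cell_supp:
  fixes u :: real
  assumes "s \<in> K" "f \<in> closed_cell s" "0 \<le> u" "u \<le> real M"
  shows "\<exists>t\<in>K. order_htpy_cell lq F M s u f \<in> closed_cell t"
proof -
  define a where "a = cumulative lq s f"
  define len where "len = (\<lambda>y j. clamp_to (a y) (a y + f y) (real (Suc j) - u) -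
      clamp_to (a y) (a y + f y) (real j - u))"
  define i where "i = nat \<lfloor>u\<rfloor>"
  have i: "real i \<le> u" "u < real i + 1" using assms(3) unfolding i_def by linarith+
  have f: "\<And>v. 0 \<le> f v" "sum f s = 1" using assms by (auto simp: closed_cell_def)
  have fin: "finite s" using finite_simplex assms by blast
  have len0: "0 \<le> len y j" for y j
    unfolding len_def by (simp add: clamp_to_mono)
  have pos: "(j = i \<and> a y < real (Suc i) - u) \<or> (j = Suc i \<and> real (Suc i) - u < a y + f y)"
    if "y \<in> s" "len y j \<noteq> 0" for y j
  proof -
    have 1: "a y < real (Suc j) - u"
    proof (rule ccontr)
      assume "\<not> ?thesis"
      then have "len y j = 0" unfolding len_def using clamp_to_simps(2) by simp
      then show False using that by simp
    qed
    have 2: "real j - u < a y + f y"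
    proof (rule ccontr)
      assume "\<not> ?thesis"
      then have "len y j = 0" unfolding len_def using clamp_to_simps(1) f(1)[of y] by simp
      then show False using that by simp
    qed
    have "0 \<le> a y" "a y + f y \<le> 1" using cumulative_bounds[OF assms(1,2) that(1)] by (auto simp: a_def)
    then have "real i < real (Suc j)" "real j < real i + 2" using 1 2 i by linarith+
    then have "j = i \<or> j = Suc i" by linarith
    then show ?thesis using 1 2 by auto
  qed
  \<comment> \<open>The vertices whose interval starts before the switch. The greatest of them is
    the \<open>y\<close> for \<open>cut\<close>; the least vertex of \<open>s\<close> shows that
    there is one.\<close>
  define L where "L = {y\<in>s. a y < real (Suc i) - u}"
  have "L \<noteq> {}"
  proof -
    have "\<exists>y\<in>s. \<forall>z\<in>s. lq y z"
      using least_in_simplex[OF assms(1) fin _ order_refl] K assms(1) by (auto simp: abstract_complex_def)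
    then obtain y where y: "y \<in> s" "\<And>z. z \<in> s \<Longrightarrow> lq y z" by blast
    then have "{z\<in>s. lq z y \<and> z \<noteq> y} = {}"
      using antisym[OF assms(1)] by blast
    then have "a y = 0" unfolding a_def cumulative_def by (simp only: sum.empty)
    then have "y \<in> L" using y i by (auto simp: L_def)
    then show ?thesis by blast
  qed
  obtain y where y: "y \<in> L" "\<And>z. z \<in> L \<Longrightarrow> lq z y"
  proof -
    have "L \<subseteq> s" by (auto simp: L_def)
    then have "\<exists>y\<in>L. \<forall>z\<in>L. lq z y"
      using greatest_in_simplex[OF assms(1) _ \<open>L \<noteq> {}\<close>] finite_subset[OF _ fin] by blast
    then show ?thesis using that by blast
  qed
  have ys: "y \<in> s" using y by (simp add: L_def)
  define t where "t = F i ` {z\<in>s. lq z y} \<union> F (Suc i) ` {z\<in>s. lq y z}"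
  have t: "t \<in> K" unfolding t_def using cut[OF assms(1) ys] .
  have in_t: "F j z \<in> t" if "z \<in> s" "len z j \<noteq> 0" for z j
    using pos[OF that]
  proof
    assume "j = i \<and> a z < real (Suc i) - u"
    then show ?thesis using y(2)[of z] that by (auto simp: t_def L_def)
  next
    assume *: "j = Suc i \<and> real (Suc i) - u < a z + f z"
    have "lq y z"
    proof (rule ccontr)
      assume "\<not> lq y z"
      then have "lq z y" "z \<noteq> y" using total[OF assms(1) ys that(1)] refl[OF assms(1)] that by auto
      then have "a z + f z \<le> a y"
        unfolding a_def using cumulative_less[OF assms(1,2) ys that(1)] by blast
      then show False using * y(1) by (auto simp: L_def)
    qed
    then show ?thesis using * that by (auto simp: t_def)
  qed
  have h: "order_htpy_cell lq F M s u f w = (\<Sum>z\<in>s. \<Sum>j\<le>M. of_bool (F j z = w) * len z j)" for w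
    by (simp add: order_htpy_cell_def len_def a_def)
  have "order_htpy_cell lq F M s u f \<in> closed_cell t"
    unfolding closed_cell_def
  proof (intro CollectI conjI allI impI)
    show "0 \<le> order_htpy_cell lq F M s u f w" for w
      unfolding h by (intro sum_nonneg mult_nonneg_nonneg len0) auto
    show "order_htpy_cell lq F M s u f w = 0" if "w \<notin> t" for w
      unfolding h using in_t that by (intro sum.neutral ballI) (metis mult_eq_0_iff of_bool_eq(1))
    have "(\<Sum>w\<in>t. order_htpy_cell lq F M s u f w)
        = (\<Sum>z\<in>s. \<Sum>j\<le>M. \<Sum>w\<in>t. of_bool (F j z = w) * len z j)"
      unfolding h by (subst sum.swap) (auto intro!: sum.cong sum.swap)
    also have "\<dots> = (\<Sum>z\<in>s. \<Sum>j\<le>M. len z j)"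
    proof (intro sum.cong HOL.refl)
      fix z j assume "z \<in> s"
      have "(\<Sum>w\<in>t. of_bool (F j z = w) * len z j) = (\<Sum>w\<in>t. if F j z = w then len z j else 0)"
        by (intro sum.cong) auto
      also have "\<dots> = (if F j z \<in> t then len z j else 0)"
        using finite_simplex[OF t] by simp
      also have "\<dots> = len z j" using in_t[OF \<open>z \<in> s\<close>] by auto
      finally show "(\<Sum>w\<in>t. of_bool (F j z = w) * len z j) = len z j" .
    qed
    also have "\<dots> = (\<Sum>z\<in>s. f z)"
      unfolding len_def a_def using cell_weight_sum[OF assms(1,2) _ assms(3,4)] by (intro sum.cong) auto
    finally show "(\<Sum>w\<in>t. order_htpy_cell lq F M s u f w) = 1" using f by simp
  qed
  then show ?thesis using t by blast
qed

text \<open>Stages beyond \<open>M\<close> start after 1, and vertices of weight 0 have empty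
  intervals. So the value depends on the point alone, and the formulas on different cells
  agree.\<close>

lemma order_htpy_cell_restrict:
  fixes u :: real
  assumes "s \<in> K" "f \<in> closed_cell s" "u \<le> real M" "M \<le> N"
  shows "order_htpy_cell lq F N s u f = order_htpy_cell lq F M (supp f) u f"
proof
  fix w
  have f: "\<And>v. 0 \<le> f v" using assms by (auto simp: closed_cell_def)
  have fin: "finite s" using finite_simplex assms by blast
  have sub: "supp f \<subseteq> s" using closed_cell_supp[OF assms(2) fin] by blast
  have cum: "cumulative lq (supp f) f = cumulative lq s f"
    unfolding cumulative_def using sub fin by (intro ext sum.mono_neutral_left) (auto simp: supp_def)
  define c where "c = (\<lambda>y j. of_bool (F j y = w) *
     (clamp_to (cumulative lq s f y) (cumulative lq s f y + f y) (real (Suc j) - u) -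
      clamp_to (cumulative lq s f y) (cumulative lq s f y + f y) (real j - u)))"
  have "(\<Sum>j\<le>N. c y j) = (\<Sum>j\<le>M. c y j)" if "y \<in> s" for y
  proof (rule sum.mono_neutral_right)
    show "\<forall>j\<in>{..N} - {..M}. c y j = 0"
    proof
      fix j assume "j \<in> {..N} - {..M}"
      then have "real j \<ge> real M + 1" by auto
      then have "1 \<le> real j - u" using assms by linarith
      then have "cumulative lq s f y + f y \<le> real j - u" "cumulative lq s f y + f y \<le> real (Suc j) - u"
        using cumulative_bounds[OF assms(1,2) that] by auto
      then show "c y j = 0" unfolding c_def using f[of y] by (simp add: clamp_to_simps)
    qed
  qed (use assms in auto)
  then have "(\<Sum>y\<in>s. \<Sum>j\<le>N. c y j) = (\<Sum>y\<in>s. \<Sum>j\<le>M. c y j)"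
    by (simp cong: sum.cong)
  also have "\<dots> = (\<Sum>y\<in>supp f. \<Sum>j\<le>M. c y j)"
  proof (rule sum.mono_neutral_right[OF fin sub], intro ballI sum.neutral)
    fix y j assume "y \<in> s - supp f"
    then have "f y = 0" by (simp add: supp_def)
    then show "c y j = 0" unfolding c_def by (simp add: clamp_to_simps)
  qed
  finally show "order_htpy_cell lq F N s u f w = order_htpy_cell lq F M (supp f) u f w"
    unfolding order_htpy_cell_def cum c_def .
qed

text \<open>Only stages whose interval meets \<open>[0,1)\<close> have weight; if they all act as
  \<open>g\<close>, the switch is invisible. This identifies both ends of the homotopy.\<close>

lemma order_htpy_cell_const:
  fixes u :: real
  assumes "s \<in> K" "f \<in> closed_cell s" "0 \<le> u" "u \<le> real M"
    and "\<And>y j. y \<in> s \<Longrightarrow> j \<le> M \<Longrightarrow> real j < u + 1 \<Longrightarrow> u < real (Suc j) \<Longrightarrow> F j y = g y"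
  shows "order_htpy_cell lq F M s u f = push g f"
proof
  fix w
  have f: "\<And>v. 0 \<le> f v" using assms by (auto simp: closed_cell_def)
  have fin: "finite s" using finite_simplex assms by blast
  define len where "len = (\<lambda>y j. (clamp_to (cumulative lq s f y) (cumulative lq s f y + f y) (real (Suc j) - u) -
      clamp_to (cumulative lq s f y) (cumulative lq s f y + f y) (real j - u)))"
  have "order_htpy_cell lq F M s u f w = (\<Sum>y\<in>s. \<Sum>j\<le>M. of_bool (F j y = w) * len y j)"
    by (simp add: order_htpy_cell_def len_def)
  also have "\<dots> = (\<Sum>y\<in>s. \<Sum>j\<le>M. of_bool (g y = w) * len y j)"
  proof (intro sum.cong HOL.refl)
    fix y j assume y: "y \<in> s" "j \<in> {..M}"
    have *: "len y j = 0" if "\<not> (real j < u + 1 \<and> u < real (Suc j))"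
    proof (cases "real j < u + 1")
      case True
      then have "real (Suc j) - u \<le> cumulative lq s f y" "real j - u \<le> cumulative lq s f y"
        using that cumulative_bounds[OF assms(1,2) y(1)] by auto
      then show ?thesis unfolding len_def by (simp add: clamp_to_simps)
    next
      case False
      then have "cumulative lq s f y + f y \<le> real j - u" "cumulative lq s f y + f y \<le> real (Suc j) - u"
        using cumulative_bounds[OF assms(1,2) y(1)] by auto
      then show ?thesis unfolding len_def using f[of y] by (simp add: clamp_to_simps)
    qed
    show "of_bool (F j y = w) * len y j = of_bool (g y = w) * len y j"
    proof (cases "real j < u + 1 \<and> u < real (Suc j)")
      case True
      then have "F j y = g y" using assms(5)[of y j] y by simp
      then show ?thesis by simp
    next
      case False
      then have "len y j = 0" by (rule *)
      then show ?thesis by simp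
    qed
  qed
  also have "\<dots> = (\<Sum>y\<in>s. of_bool (g y = w) * f y)"
    unfolding len_def using cell_weight_sum[OF assms(1,2) _ assms(3,4)]
    by (intro sum.cong HOL.refl) (simp flip: sum_distrib_left)
  also have "\<dots> = push g f w"
    unfolding push_def using closed_cell_supp(1)[OF assms(2) fin] fin
    by (intro sum.mono_neutral_right) (auto simp: supp_def)
  finally show "order_htpy_cell lq F M s u f w = push g f w" .
qed

section \<open>The homotopy on the whole realization\<close>

lemma continuous_order_htpy_cell:
  assumes "continuous_on A u" "continuous_on A f"
  shows "continuous_on A (\<lambda>x. order_htpy_cell lq F M s (u x) (f x) w)"
proof -
  have f: "continuous_on A (\<lambda>x. f x y)" for y
    using assms(2) by (rule continuous_on_product_then_coordinatewise)
  show ?thesis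
    unfolding order_htpy_cell_def cumulative_def clamp_to_def
    by (intro continuous_intros assms f)
qed

text \<open>The time \<open>t / (1 - t)\<close> runs through all stages as \<open>t\<close> tends to
  1. Taking \<open>supp f\<close> and the rounded-up time as parameters makes the definition
  independent of a cell.\<close>

definition order_htpy :: "real \<times> ('a \<Rightarrow> real) \<Rightarrow> 'a \<Rightarrow> real" where
  "order_htpy = (\<lambda>(t, f). if t < 1
     then order_htpy_cell lq F (nat \<lceil>t / (1 - t)\<rceil>) (supp f) (t / (1 - t)) f else push G f)"

text \<open>On one cell nothing changes after stage \<open>N\<close>, so time may be capped there.
  It reaches \<open>N\<close> when \<open>1 - t = 1 / (N + 1)\<close>; hence the \<open>max\<close>
  removes the singularity at 1 without affecting earlier times.\<close>

lemma order_htpy_on_cell: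
  fixes t :: real
  assumes s: "s \<in> K" and N: "\<And>y j. y \<in> s \<Longrightarrow> N \<le> j \<Longrightarrow> F j y = G y"
    and t: "0 \<le> t" "t \<le> 1" and f: "f \<in> closed_cell s"
  shows "order_htpy (t, f)
    = order_htpy_cell lq F N s (min (real N) (t / max (1 - t) (1 / (real N + 1)))) f"
proof (cases "t < 1 \<and> t / (1 - t) < N")
  case True
  then have "t < real N * (1 - t)" by (simp add: divide_less_eq)
  then have "1 / (real N + 1) \<le> 1 - t"
    by (simp add: field_simps)
  then have u: "min (real N) (t / max (1 - t) (1 / (real N + 1))) = t / (1 - t)"
    using True by (simp add: max_absorb1)
  have "order_htpy_cell lq F N s (t / (1 - t)) f
      = order_htpy_cell lq F (nat \<lceil>t / (1 - t)\<rceil>) (supp f) (t / (1 - t)) f"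
    by (rule order_htpy_cell_restrict[OF s f]) (use True in linarith)+
  then show ?thesis using True u by (simp add: order_htpy_def)
next
  case False
  have *: "real N \<le> t / max (1 - t) (1 / (real N + 1))"
  proof -
    have "real N * max (1 - t) (1 / (real N + 1)) \<le> t"
    proof (cases "t < 1")
      case True
      then have "real N * (1 - t) \<le> t" using False by (simp add: not_less le_divide_eq)
      moreover have "real N * (1 / (real N + 1)) \<le> t"
        using calculation by (simp add: field_simps)
      ultimately show ?thesis by (simp add: max_def)
    next
      case False
      then have "t = 1" using t by simp
      then show ?thesis by (simp add: max_def)
    qed
    moreover have "0 < max (1 - t) (1 / (real N + 1))" by (simp add: less_max_iff_disj)
    ultimately show ?thesis by (simp add: le_divide_eq)
  qed
  have big: "order_htpy_cell lq F M s u f = push G f" if "real N \<le> u" "u \<le> real M" for M u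
    by (rule order_htpy_cell_const[OF s f]) (use that N in auto)
  have "order_htpy (t, f) = push G f"
  proof (cases "t < 1")
    case True
    then have "order_htpy (t, f) = order_htpy_cell lq F (nat \<lceil>t / (1 - t)\<rceil>) (supp f) (t / (1 - t)) f"
      by (simp add: order_htpy_def)
    also have "\<dots> = order_htpy_cell lq F (nat \<lceil>t / (1 - t)\<rceil>) s (t / (1 - t)) f"
      by (rule order_htpy_cell_restrict[OF s f, symmetric]) linarith+
    also have "\<dots> = push G f"
      by (rule big) (use True False in linarith)+
    finally show ?thesis .
  qed (simp add: order_htpy_def)
  then show ?thesis using big[of "real N" N] * by (simp add: min_absorb1)
qed

lemma stable_on_simplex:
  assumes "s \<in> K"
  obtains N where "\<And>y j. y \<in> s \<Longrightarrow> N \<le> j \<Longrightarrow> F j y = G y"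
proof -
  have "\<forall>y\<in>s. \<exists>N. \<forall>j\<ge>N. F j y = G y" using stable assms by blast
  then obtain N where N: "\<And>y j. y \<in> s \<Longrightarrow> N y \<le> j \<Longrightarrow> F j y = G y"
    by metis
  have fin: "finite s" using finite_simplex assms by blast
  have "F j y = G y" if "y \<in> s" "Max (N ` s) \<le> j" for y j
  proof -
    have "N y \<le> Max (N ` s)" using fin that by (intro Max_ge) auto
    then show ?thesis using N that by auto
  qed
  then show ?thesis using that by blast
qed

theorem homotopic_push:
  "homotopic_with (\<lambda>_. True) (geometric_realization K) (geometric_realization K) (push (F 0)) (push G)"
proof -
  have "continuous_map (prod_topology (top_of_set {0..1}) (geometric_realization K))
      (geometric_realization K) order_htpy"
  proof (rule continuous_map_prod_realization)
    fix s assume s: "s \<in> K"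
    then obtain N where N: "\<And>y j. y \<in> s \<Longrightarrow> N \<le> j \<Longrightarrow> F j y = G y"
      using stable_on_simplex by blast
    define u where "u = (\<lambda>t::real. min (real N) (t / max (1 - t) (1 / (real N + 1))))"
    have u: "0 \<le> u t" "u t \<le> real N" if "0 \<le> t" for t
    proof -
      have "0 < max (1 - t) (1 / (real N + 1))" by (simp add: less_max_iff_disj)
      then show "0 \<le> u t" "u t \<le> real N" using that by (auto simp: u_def)
    qed
    have eq: "order_htpy (t, f) = order_htpy_cell lq F N s (u t) f"
      if "t \<in> {0..1}" "f \<in> closed_cell s" for t :: real and f
      using order_htpy_on_cell[OF s N _ _ that(2)] that(1) by (simp add: u_def)
    let ?A = "prod_topology (top_of_set {0..1::real}) (top_of_set (closed_cell s))"
    have A: "?A = top_of_set ({0..1} \<times> closed_cell s)"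
      by (simp add: prod_topology_subtopology_eu)
    show "continuous_map ?A (geometric_realization K) order_htpy"
    proof (rule continuous_map_into_realization[OF K, of "\<Union>j\<in>{..N}. F j ` s"])
      show "finite (\<Union>j\<in>{..N}. F j ` s)" using finite_simplex[OF s] by auto
      fix x assume "x \<in> topspace ?A"
      then obtain t f where x: "x = (t, f)" "t \<in> {0..1}" "f \<in> closed_cell s" by auto
      obtain k where k: "k \<in> K" "order_htpy_cell lq F N s (u t) f \<in> closed_cell k"
        using order_htpy_cell_supp[OF s x(3) u] x by auto
      then show "order_htpy x \<in> topspace (geometric_realization K)"
        using x eq by (auto simp: topspace_geometric_realization)
      show "supp (order_htpy x) \<subseteq> (\<Union>j\<in>{..N}. F j ` s)"
      proof
        fix w assume w: "w \<in> supp (order_htpy x)"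
        then have nz: "order_htpy_cell lq F N s (u t) f w \<noteq> 0"
          using eq[OF x(2,3)] x by (simp add: supp_def)
        have "\<exists>y\<in>s. \<exists>j\<le>N. F j y = w"
        proof (rule ccontr)
          assume "\<not> ?thesis"
          then have "order_htpy_cell lq F N s (u t) f w = 0"
            unfolding order_htpy_cell_def by (intro sum.neutral ballI) auto
          then show False using nz by simp
        qed
        then show "w \<in> (\<Union>j\<in>{..N}. F j ` s)" by blast
      qed
    next
      fix w
      have "continuous_on ({0..1} \<times> closed_cell s) (\<lambda>x. order_htpy_cell lq F N s (u (fst x)) (snd x) w)"
      proof (rule continuous_order_htpy_cell)
        have "max (1 - t) (1 / (real N + 1)) \<noteq> 0" for t
          by (metis add_nonneg_pos divide_pos_pos less_max_iff_disj less_numeral_extra(1,3) of_nat_0_le_iff)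
        then show "continuous_on ({0..1} \<times> closed_cell s) (\<lambda>x. u (fst x))"
          unfolding u_def by (intro continuous_intros) auto
      qed (intro continuous_intros)
      then have "continuous_on ({0..1} \<times> closed_cell s) (\<lambda>x. order_htpy x w)"
        by (rule continuous_on_eq) (auto simp: eq)
      then show "continuous_map ?A euclideanreal (\<lambda>x. order_htpy x w)"
        by (simp add: A)
    qed
  qed
  moreover have "order_htpy (0, f) = push (F 0) f" if f: "f \<in> topspace (geometric_realization K)" for f
  proof -
    have *: "supp f \<in> K" "f \<in> closed_cell (supp f)"
      using f in_realization_iff[OF K, of f] by (auto simp: closed_cell_def supp_def)
    have "order_htpy (0, f) = order_htpy_cell lq F 0 (supp f) 0 f"
      by (simp add: order_htpy_def)
    also have "\<dots> = push (F 0) f"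
      by (rule order_htpy_cell_const[OF *]) auto
    finally show ?thesis .
  qed
  moreover have "order_htpy (1, f) = push G f" for f
    by (simp add: order_htpy_def)
  ultimately show ?thesis
    by (subst homotopic_with) auto
qed

end

lemma push_id:
  assumes "abstract_complex K" "f \<in> topspace (geometric_realization K)"
  shows "push (\<lambda>y. y) f = f"
proof
  fix w
  have "finite (supp f)"
    using in_realization_iff[OF assms(1)] assms by (auto simp: abstract_complex_def)
  moreover have "push (\<lambda>y. y) f w = (\<Sum>y\<in>supp f. if y = w then f y else 0)"
    unfolding push_def by (intro sum.cong) auto
  ultimately show "push (\<lambda>y. y) f w = f w" by (auto simp: supp_def)
qed

lemma push_const:
  assumes "abstract_complex K" "f \<in> topspace (geometric_realization K)"
  shows "push (\<lambda>_. a) f = (\<lambda>w. of_bool (a = w))"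
proof
  fix w
  have "sum f (supp f) = 1"
    using in_realization_iff[OF assms(1)] assms by auto
  then show "push (\<lambda>_. a) f w = of_bool (a = w)"
    by (simp add: push_def flip: sum_distrib_left)
qed

section \<open>Simple pairs and their lattices\<close>

locale garside =
  fixes P :: "'a set" and r :: "'a \<Rightarrow> 'a \<Rightarrow> bool" and \<phi> :: "'a \<Rightarrow> 'a"
  assumes wo: "weakly_ordered P r"
    and aut: "automorphism_on P r \<phi>"
    and gt: "\<forall>x\<in>P. r x (\<phi> x) \<and> x \<noteq> \<phi> x"
    and lat: "\<forall>x\<in>P. lattice_on (order_interval P r x (\<phi> x)) r"
begin

definition simple :: "'a \<Rightarrow> 'a \<Rightarrow> bool" where
  "simple a b \<longleftrightarrow> a \<in> P \<and> b \<in> P \<and> r a b \<and> r b (\<phi> a)"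

lemma r_refl: "a \<in> P \<Longrightarrow> r a a"
  using wo by (simp add: weakly_ordered_def)

lemma r_antisym: "\<lbrakk>a \<in> P; b \<in> P; r a b; r b a\<rbrakk> \<Longrightarrow> a = b"
  using wo unfolding weakly_ordered_def by blast

text \<open>The substitute for transitivity. Whenever it is used \<open>r a d\<close> is known, so
  that \<open>r b d\<close> and \<open>r a c\<close> imply each other.\<close>

lemma weak_order:
  assumes "a \<in> P" "b \<in> P" "c \<in> P" "d \<in> P" "r a b" "r b c" "r c d"
  shows "r b d \<and> r a d \<longleftrightarrow> r a c \<and> r a d"
proof -
  have "transitive_triple r b c d \<and> transitive_triple r a b d \<longleftrightarrow>
         transitive_triple r a b c \<and> transitive_triple r a c d"
    using wo assms unfolding weakly_ordered_def by blast
  then show ?thesis using assms by (auto simp: transitive_triple_def)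
qed

lemma phi_in: "a \<in> P \<Longrightarrow> \<phi> a \<in> P"
  using aut by (auto simp: automorphism_on_def bij_betw_def)

lemma r_phi: "a \<in> P \<Longrightarrow> r a (\<phi> a)"
  using gt by blast

lemma r_phi_iff: "\<lbrakk>a \<in> P; b \<in> P\<rbrakk> \<Longrightarrow> r (\<phi> a) (\<phi> b) \<longleftrightarrow> r a b"
  using aut by (auto simp: automorphism_on_def)

lemma up_trans:
  assumes "x \<in> P" "a \<in> P" "b \<in> P" "c \<in> P" "r x a" "r x b" "r x c" "r a b" "r b c"
  shows "r a c"
  using weak_order[of x a b c] assms by blast

lemma simpleD: "simple a b \<Longrightarrow> a \<in> P" "simple a b \<Longrightarrow> b \<in> P" "simple a b \<Longrightarrow> r a b"
  "simple a b \<Longrightarrow> r b (\<phi> a)"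
  by (auto simp: simple_def)

lemma simple_refl: "a \<in> P \<Longrightarrow> simple a a"
  by (simp add: simple_def r_refl r_phi)

lemma simple_phi: "a \<in> P \<Longrightarrow> simple a (\<phi> a)"
  by (simp add: simple_def r_refl r_phi phi_in)

text \<open>In Garside terms, \<open>b \<le> \<phi> a\<close> is the complement of
  \<open>a \<le> b\<close> in the Garside element.\<close>

lemma simple_rotate: "simple a b \<Longrightarrow> simple b (\<phi> a)"
  by (simp add: simple_def phi_in r_phi_iff)

lemma simple_phi_iff: "\<lbrakk>a \<in> P; b \<in> P\<rbrakk> \<Longrightarrow> simple (\<phi> a) (\<phi> b) \<longleftrightarrow> simple a b"
  by (simp add: simple_def phi_in r_phi_iff)

lemma simple_extend:
  assumes "simple x a" "b \<in> P" "r a b" "r b (\<phi> x)"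
  shows "simple x b"
  using weak_order[of x a b "\<phi> x"] assms r_phi phi_in by (auto simp: simple_def)

text \<open>The Garside property that a right factor of a simple is simple; the automorphism
  supplies \<open>\<phi> x \<le> \<phi> a\<close>.\<close>

lemma simple_between:
  assumes "simple x a" "simple x b" "r a b"
  shows "simple a b"
proof -
  have in_P: "x \<in> P" "a \<in> P" "b \<in> P" "\<phi> x \<in> P" "\<phi> a \<in> P"
    using assms by (auto simp: simple_def phi_in)
  have "r a (\<phi> x)" "r b (\<phi> x)" "r (\<phi> x) (\<phi> a)" "r a (\<phi> a)"
    using assms in_P by (auto simp: simple_def r_phi_iff r_phi)
  then have "r b (\<phi> a)"
    using weak_order[of a b "\<phi> x" "\<phi> a"] in_P assms(3) by blast
  then show ?thesis using in_P assms(3) by (simp add: simple_def)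
qed

lemma simple_interval: "x \<in> P \<Longrightarrow> z \<in> order_interval P r x (\<phi> x) \<longleftrightarrow> simple x z"
  by (auto simp: order_interval_def simple_def)

lemma simple_trans:
  assumes "simple x a" "simple x b" "simple x c" "r a b" "r b c"
  shows "r a c"
  using up_trans[of x a b c] assms by (auto simp: simple_def)

lemma glb_exists:
  assumes "simple x a" "simple x b"
  shows "\<exists>m. simple x m \<and> r m a \<and> r m b \<and> (\<forall>z. simple x z \<and> r z a \<and> r z b \<longrightarrow> r z m)"
proof -
  let ?L = "\<lparr>carrier = order_interval P r x (\<phi> x), eq = (=), le = r\<rparr>"
  have x: "x \<in> P" using assms simpleD by blast
  have "lower_semilattice ?L"
    using lat x by (auto simp: lattice_on_def Lattice.lattice_def)
  then obtain m where "greatest ?L m (Lower ?L {a, b})"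
    using lower_semilattice.inf_of_two_exists[of ?L a b] assms simple_interval[OF x] by auto
  then show ?thesis
    using simple_interval[OF x] assms by (auto simp: greatest_def Lower_def)
qed

lemma lub_exists:
  assumes "simple x a" "simple x b"
  shows "\<exists>m. simple x m \<and> r a m \<and> r b m \<and> (\<forall>z. simple x z \<and> r a z \<and> r b z \<longrightarrow> r m z)"
proof -
  let ?L = "\<lparr>carrier = order_interval P r x (\<phi> x), eq = (=), le = r\<rparr>"
  have x: "x \<in> P" using assms simpleD by blast
  have "upper_semilattice ?L"
    using lat x by (auto simp: lattice_on_def Lattice.lattice_def)
  then obtain m where "least ?L m (Upper ?L {a, b})"
    using upper_semilattice.sup_of_two_exists[of ?L a b] assms simple_interval[OF x] by auto
  then show ?thesis
    using simple_interval[OF x] assms by (auto simp: least_def Upper_def)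
qed

definition imeet :: "'a \<Rightarrow> 'a \<Rightarrow> 'a \<Rightarrow> 'a" where
  "imeet x a b = (SOME m. simple x m \<and> r m a \<and> r m b \<and> (\<forall>z. simple x z \<and> r z a \<and> r z b \<longrightarrow> r z m))"

lemma imeet:
  assumes "simple x a" "simple x b"
  shows "simple x (imeet x a b)" "r (imeet x a b) a" "r (imeet x a b) b"
    "\<lbrakk>simple x z; r z a; r z b\<rbrakk> \<Longrightarrow> r z (imeet x a b)"
  using someI_ex[OF glb_exists[OF assms]] unfolding imeet_def by blast+

lemma imeet_eqI:
  assumes "simple x a" "simple x b" "simple x m" "r m a" "r m b"
    and "\<And>z. \<lbrakk>simple x z; r z a; r z b\<rbrakk> \<Longrightarrow> r z m"
  shows "imeet x a b = m"
proof (rule r_antisym)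
  note m = imeet[OF assms(1,2)]
  show "imeet x a b \<in> P" "m \<in> P" using m(1) assms(3) simpleD by blast+
  show "r (imeet x a b) m" by (rule assms(6)[OF m(1-3)])
  show "r m (imeet x a b)" by (rule m(4)[OF assms(3-5)])
qed

lemma imeet_absorb:
  assumes "simple x a" "simple x b" "r a b"
  shows "imeet x a b = a"
  by (rule imeet_eqI) (use assms r_refl simpleD in auto)

section \<open>Powers of the automorphism\<close>

definition psi :: "'a \<Rightarrow> 'a" where
  "psi = inv_into P \<phi>"

definition pw :: "int \<Rightarrow> 'a \<Rightarrow> 'a" where
  "pw j x = (if 0 \<le> j then (\<phi> ^^ nat j) x else (psi ^^ nat (- j)) x)"

lemma psi_in: "a \<in> P \<Longrightarrow> psi a \<in> P"
  using aut unfolding psi_def automorphism_on_def bij_betw_def by (metis inv_into_into)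

lemma phi_psi: "a \<in> P \<Longrightarrow> \<phi> (psi a) = a"
  using aut unfolding psi_def automorphism_on_def bij_betw_def by (metis f_inv_into_f)

lemma psi_phi: "a \<in> P \<Longrightarrow> psi (\<phi> a) = a"
  using aut unfolding psi_def automorphism_on_def bij_betw_def by (metis inv_into_f_f)

lemma pw_in: "x \<in> P \<Longrightarrow> pw j x \<in> P"
proof -
  assume x: "x \<in> P"
  have "(\<phi> ^^ n) x \<in> P" "(psi ^^ n) x \<in> P" for n
    by (induction n) (use x phi_in psi_in in auto)
  then show ?thesis by (simp add: pw_def)
qed

lemma pw_0 [simp]: "pw 0 x = x"
  by (simp add: pw_def)

lemma phi_pw: "x \<in> P \<Longrightarrow> \<phi> (pw j x) = pw (j + 1) x"
proof (cases "0 \<le> j")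
  case True
  then have "nat (j + 1) = Suc (nat j)" by simp
  then show ?thesis using True by (simp add: pw_def)
next
  case False
  assume x: "x \<in> P"
  have n: "nat (- j) = Suc (nat (- (j + 1)))" using False by simp
  have "(psi ^^ n) x \<in> P" for n
    by (induction n) (use x psi_in in auto)
  then have "\<phi> (pw j x) = (psi ^^ nat (- (j + 1))) x"
    using False by (simp add: pw_def n phi_psi)
  also have "\<dots> = pw (j + 1) x"
    using False by (cases "j = -1") (auto simp: pw_def)
  finally show ?thesis .
qed

lemma psi_pw: "x \<in> P \<Longrightarrow> psi (pw j x) = pw (j - 1) x"
  using phi_pw[of x "j - 1"] psi_phi[OF pw_in[of x "j - 1"]] by simp

lemma pw_phi: "x \<in> P \<Longrightarrow> pw j (\<phi> x) = pw (j + 1) x"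
proof (induction j rule: int_induct[where k = 0])
  case base
  then show ?case using phi_pw[of x 0] by simp
next
  case (step1 i)
  then show ?case using phi_pw[of x "i + 1"] phi_pw[of "\<phi> x" i] phi_in by simp
next
  case (step2 i)
  then show ?case using psi_pw[of x "i + 1"] psi_pw[of "\<phi> x" i] phi_in by simp
qed

lemma simple_pw_iff:
  assumes "x \<in> P" "y \<in> P"
  shows "simple (pw j x) (pw j y) \<longleftrightarrow> simple x y"
proof (induction j rule: int_induct[where k = 0])
  case (step1 i)
  then show ?case
    using simple_phi_iff[OF pw_in[OF assms(1)] pw_in[OF assms(2)], of i i] assms by (simp add: phi_pw)
next
  case (step2 i)
  then show ?case
    using simple_phi_iff[OF pw_in[OF assms(1)] pw_in[OF assms(2)], of "i - 1" "i - 1"] assms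
    by (simp add: phi_pw)
qed simp

lemma simple_psi: "simple a b \<Longrightarrow> simple (psi b) a"
  using simple_phi_iff[of "psi b" a] simple_rotate[of a b] psi_in phi_psi simpleD by metis

section \<open>Normal sequences\<close>

text \<open>A normal sequence in \<open>fibre x\<close> encodes the normal form of a morphism from \<open>x\<close> in the groupoid of
  fractions of the category generated by the simple pairs: far to the left it is the orbit of \<open>x\<close> under
  \<open>\<phi>\<close>, which absorbs all powers of the Garside element.\<close>

definition normal :: "(int \<Rightarrow> 'a) \<Rightarrow> bool" where
  "normal u \<longleftrightarrow> (\<forall>i. simple (u i) (u (i + 1))) \<and>
     (\<forall>i w. w \<in> P \<longrightarrow> r (u i) w \<longrightarrow> r w (\<phi> (u (i - 1))) \<longrightarrow> r w (u (i + 1)) \<longrightarrow> w = u i)"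

definition fibre :: "'a \<Rightarrow> (int \<Rightarrow> 'a) set" where
  "fibre x = {u. normal u \<and> (\<exists>N. \<forall>i\<le>N. u i = pw i x)}"

text \<open>Left multiplication of a normal form by the step from \<open>x\<close> to its base
  point. The term \<open>d (i + 1)\<close> advances from \<open>u i\<close> towards
  \<open>u (i + 1)\<close> as far as one Garside step after \<open>d i\<close> permits. The orbit of
  \<open>x\<close> serves as initial value at minus infinity.\<close>

definition lifts :: "'a \<Rightarrow> (int \<Rightarrow> 'a) \<Rightarrow> (int \<Rightarrow> 'a) \<Rightarrow> bool" where
  "lifts x u d \<longleftrightarrow> (\<exists>N. \<forall>i\<le>N. d i = pw i x) \<and> (\<forall>i. d (i + 1) = imeet (u i) (\<phi> (d i)) (u (i + 1)))"

text \<open>The third fact is greediness: a point \<open>w\<close> strictly above \<open>u i\<close>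
  would be a part of the next step that could be moved into the step ending at
  \<open>u i\<close>.\<close>

lemma normalD:
  assumes "normal u"
  shows "simple (u i) (u (i + 1))" "u i \<in> P"
    "\<lbrakk>w \<in> P; r (u i) w; r w (\<phi> (u (i - 1))); r w (u (i + 1))\<rbrakk> \<Longrightarrow> w = u i"
  using assms simpleD(1) unfolding normal_def by blast+

lemma fibre_normal: "u \<in> fibre x \<Longrightarrow> normal u"
  by (simp add: fibre_def)

lemma int_induct_from_below:
  assumes "\<And>i::int. i \<le> N \<Longrightarrow> Q i" "\<And>i. Q i \<Longrightarrow> Q (i + 1)"
  shows "Q i"
proof (cases "i \<le> N")
  case False
  then have "N \<le> i" by simp
  then show ?thesis by (induction i rule: int_ge_induct) (use assms in auto)
qed (use assms in auto)

text \<open>While \<open>u\<close> is still the orbit of \<open>y\<close>, the recursion of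
  \<open>lifts\<close> reproduces the orbit of \<open>x\<close>, so it may be started at any
  sufficiently small index.\<close>

lemma imeet_pw:
  assumes "simple x y"
  shows "imeet (pw i y) (\<phi> (pw i x)) (pw (i + 1) y) = pw (i + 1) x"
proof -
  have x: "x \<in> P" and y: "y \<in> P" using assms simpleD by auto
  have 1: "simple (pw i y) (pw (i + 1) x)"
    using simple_rotate[of "pw i x" "pw i y"] simple_pw_iff[OF x y] assms phi_pw[OF x] by simp
  have 2: "simple (pw i y) (pw (i + 1) y)"
    using simple_phi[OF pw_in[OF y], of i] by (simp add: phi_pw y)
  have "r (pw (i + 1) x) (pw (i + 1) y)"
    using simple_pw_iff[OF x y] assms simpleD(3) by blast
  then show ?thesis
    using imeet_absorb[OF 1 2] by (simp add: phi_pw x)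
qed

section \<open>Lifting normal sequences along a simple pair\<close>

lemma lifts_unique:
  assumes "lifts x u d" "lifts x u e"
  shows "d = e"
proof
  fix i
  obtain M N where "\<forall>i\<le>M. d i = pw i x" "\<forall>i\<le>N. e i = pw i x"
    using assms unfolding lifts_def by blast
  then have "d j = e j" if "j \<le> min M N" for j using that by auto
  moreover have "d (j + 1) = e (j + 1)" if "d j = e j" for j
    using assms that by (simp add: lifts_def)
  ultimately show "d i = e i"
    by (rule int_induct_from_below)
qed

lemma lifts_exists:
  assumes "simple x y" "u \<in> fibre y"
  shows "\<exists>d. lifts x u d"
proof -
  obtain N where N: "\<And>i. i \<le> N \<Longrightarrow> u i = pw i y"
    using assms by (auto simp: fibre_def)
  have x: "x \<in> P" using assms simpleD by blast
  define g where "g = rec_nat (pw N x) (\<lambda>n d. imeet (u (N + int n)) (\<phi> d) (u (N + int n + 1)))"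
  define d where "d = (\<lambda>i. if i \<le> N then pw i x else g (nat (i - N)))"
  have g: "g 0 = pw N x" "g (Suc n) = imeet (u (N + int n)) (\<phi> (g n)) (u (N + int n + 1))" for n
    by (simp_all add: g_def)
  have "d (i + 1) = imeet (u i) (\<phi> (d i)) (u (i + 1))" for i
  proof (cases "i < N")
    case True
    then show ?thesis using imeet_pw[OF assms(1), of i] N by (simp add: d_def)
  next
    case False
    then have "nat (i + 1 - N) = Suc (nat (i - N))" "N + int (nat (i - N)) = i" by auto
    moreover have "d i = g (nat (i - N))"
      using False g(1) by (cases "i = N") (auto simp: d_def)
    ultimately show ?thesis using False g(2)[of "nat (i - N)"] by (simp add: d_def)
  qed
  moreover have "\<forall>i\<le>N. d i = pw i x" by (simp add: d_def)
  ultimately show ?thesis unfolding lifts_def by blast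
qed

lemma lifts_simple:
  assumes "simple x y" "u \<in> fibre y" "lifts x u d"
  shows "simple (d i) (u i)"
proof -
  obtain M N where M: "\<And>i. i \<le> M \<Longrightarrow> u i = pw i y" and N: "\<And>i. i \<le> N \<Longrightarrow> d i = pw i x"
    using assms unfolding fibre_def lifts_def by blast
  show ?thesis
  proof (rule int_induct_from_below)
    show "simple (d i) (u i)" if "i \<le> min M N" for i
      using that M N simple_pw_iff[of x y i] assms(1) simpleD[OF assms(1)] by simp
    fix i assume i: "simple (d i) (u i)"
    have u: "simple (u i) (u (i + 1))" using normalD(1)[OF fibre_normal[OF assms(2)]] .
    note m = imeet[OF simple_rotate[OF i] u]
    have "d (i + 1) = imeet (u i) (\<phi> (d i)) (u (i + 1))" using assms(3) by (simp add: lifts_def)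
    then show "simple (d (i + 1)) (u (i + 1))"
      using simple_between[OF m(1) u m(3)] by simp
  qed
qed

lemma lifts_step:
  assumes "simple x y" "u \<in> fibre y" "lifts x u d"
  shows "simple (u i) (d (i + 1))" "r (d (i + 1)) (\<phi> (d i))" "r (d (i + 1)) (u (i + 1))"
    "\<lbrakk>simple (u i) z; r z (\<phi> (d i)); r z (u (i + 1))\<rbrakk> \<Longrightarrow> r z (d (i + 1))"
    "simple (d i) (d (i + 1))"
proof -
  have i: "simple (d i) (u i)" using lifts_simple[OF assms] .
  have u: "simple (u i) (u (i + 1))" using normalD(1)[OF fibre_normal[OF assms(2)]] .
  have d: "d (i + 1) = imeet (u i) (\<phi> (d i)) (u (i + 1))" using assms(3) by (simp add: lifts_def)
  note m = imeet[OF simple_rotate[OF i] u, folded d]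
  show "simple (u i) (d (i + 1))" "r (d (i + 1)) (\<phi> (d i))" "r (d (i + 1)) (u (i + 1))"
    "\<lbrakk>simple (u i) z; r z (\<phi> (d i)); r z (u (i + 1))\<rbrakk> \<Longrightarrow> r z (d (i + 1))"
    using m by auto
  show "simple (d i) (d (i + 1))"
    using simple_extend[OF i _ simpleD(3)[OF m(1)] m(2)] simpleD(2)[OF m(1)] by blast
qed

text \<open>Let \<open>w\<close> test greediness at \<open>d i\<close>. Its join \<open>j\<close>
  with \<open>u i\<close> tests greediness of \<open>u\<close>, so \<open>j = u i\<close> and
  \<open>w \<le> u i\<close>. Then \<open>w\<close> competes in the meet that defines
  \<open>d i\<close>. Joins in the intervals are used here.\<close>

lemma lifts_normal:
  assumes "simple x y" "u \<in> fibre y" "lifts x u d"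
  shows "normal d"
proof -
  note st = lifts_step[OF assms]
  note nu = normalD[OF fibre_normal[OF assms(2)]]
  have "w = d i" if w: "w \<in> P" "r (d i) w" "r w (\<phi> (d (i - 1)))" "r w (d (i + 1))" for i w
  proof -
    have du: "simple (d i) (u i)" using lifts_simple[OF assms] .
    have du': "simple (d (i - 1)) (u (i - 1))" using lifts_simple[OF assms] .
    have ud: "simple (u (i - 1)) (d i)" using st(1)[of "i - 1"] by simp
    have dd: "simple (d i) (d (i + 1))" using st(5) .
    have dpd: "simple (d i) (\<phi> (d (i - 1)))" using simple_rotate[OF st(5)[of "i - 1"]] by simp
    have dpu: "simple (d i) (\<phi> (u (i - 1)))" using simple_rotate[OF ud] .
    have dw: "simple (d i) w"
    proof -
      have "r w (\<phi> (d i))"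
        using up_trans[of "d i" w "d (i + 1)" "\<phi> (d i)"] w dd simpleD[OF dd] phi_in r_phi by blast
      then show ?thesis using w simpleD[OF dd] by (simp add: simple_def)
    qed
    obtain j where j: "simple (d i) j" "r w j" "r (u i) j"
      "\<And>z. \<lbrakk>simple (d i) z; r w z; r (u i) z\<rbrakk> \<Longrightarrow> r j z"
      using lub_exists[OF dw du] by blast
    have "r j (d (i + 1))"
      using j(4)[OF dd w(4)] st(1)[of i] simpleD(3) by blast
    then have 1: "r j (u (i + 1))"
      using up_trans[of "u i" j "d (i + 1)" "u (i + 1)"] j st(1)[of i] st(3)[of i] nu(1)[of i] simpleD by blast
    have pp: "r (\<phi> (d (i - 1))) (\<phi> (u (i - 1)))"
      using r_phi_iff simpleD[OF du'] by blast
    have "r w (\<phi> (u (i - 1)))"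
      by (rule simple_trans[OF dw dpd dpu w(3) pp])
    moreover have "r (u i) (\<phi> (u (i - 1)))"
      using simpleD(4)[OF nu(1)[of "i - 1"]] by simp
    ultimately have 2: "r j (\<phi> (u (i - 1)))"
      using j(4)[OF dpu] by blast
    have "j = u i"
      using nu(3)[of j i] simpleD(2)[OF j(1)] j(3) 2 1 by blast
    then have wu: "r w (u i)" using j(2) by simp
    have "simple (u (i - 1)) w"
      using simple_extend[OF ud w(1,2)] \<open>r w (\<phi> (u (i - 1)))\<close> by blast
    then have "r w (d i)"
      using st(4)[of "i - 1" w] w(3) wu by simp
    then show "w = d i"
      using r_antisym w(1,2) simpleD(1)[OF dd] by blast
  qed
  then show ?thesis
    unfolding normal_def using st(5) by blast
qed

definition lift :: "'a \<Rightarrow> (int \<Rightarrow> 'a) \<Rightarrow> (int \<Rightarrow> 'a)" where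
  "lift x u = (SOME d. lifts x u d)"

lemma lift_lifts: "\<lbrakk>simple x y; u \<in> fibre y\<rbrakk> \<Longrightarrow> lifts x u (lift x u)"
  unfolding lift_def using lifts_exists by (rule someI_ex)

lemma lift_eqI: "lifts x u d \<Longrightarrow> lift x u = d"
  unfolding lift_def by (metis lifts_unique someI)

lemma lift_fibre:
  assumes "simple x y" "u \<in> fibre y"
  shows "lift x u \<in> fibre x"
  using lifts_normal[OF assms lift_lifts[OF assms]] lift_lifts[OF assms]
  by (simp add: fibre_def lifts_def)

text \<open>By uniqueness it suffices that the double lift \<open>f\<close> obeys the recursion over
  \<open>u\<close>. Each step needs \<open>simple (f i) (u i)\<close>, which does not follow by
  transitivity; it is carried along from the far left, where it is a translate of
  \<open>simple x z\<close>.\<close>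

lemma lift_comp:
  assumes xy: "simple x y" and yz: "simple y z" and xz: "simple x z" and u: "u \<in> fibre z"
  shows "lift x (lift y u) = lift x u"
proof -
  define e where "e = lift y u"
  define f where "f = lift x e"
  have le: "lifts y u e" unfolding e_def using lift_lifts[OF yz u] .
  have e: "e \<in> fibre y" unfolding e_def using lift_fibre[OF yz u] .
  have lf: "lifts x e f" unfolding f_def using lift_lifts[OF xy e] .
  note se = lifts_step[OF yz u le] and sf = lifts_step[OF xy e lf]
  note eu = lifts_simple[OF yz u le] and fe = lifts_simple[OF xy e lf]
  note nu = normalD[OF fibre_normal[OF u]]
  obtain M N where M: "\<And>i. i \<le> M \<Longrightarrow> u i = pw i z" and N: "\<And>i. i \<le> N \<Longrightarrow> f i = pw i x"
    using u lf unfolding fibre_def lifts_def by blast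
  have step: "f (i + 1) = imeet (u i) (\<phi> (f i)) (u (i + 1))" if fu: "simple (f i) (u i)" for i
  proof (rule imeet_eqI[symmetric])
    show 1: "simple (u i) (\<phi> (f i))" using simple_rotate[OF fu] .
    show 2: "simple (u i) (u (i + 1))" using nu(1) .
    \<comment> \<open>The point \<open>u i\<close> itself competes in the meet over
      \<open>e i\<close> that defines \<open>f (i + 1)\<close>.\<close>
    have "r (u i) (f (i + 1))"
      using sf(4)[of i "u i"] eu[of i] simpleD(4)[OF fu] se(1)[of i] simpleD(3) by blast
    then have "r (f (i + 1)) (u (i + 1))"
      using up_trans[of "u i" "f (i + 1)" "e (i + 1)" "u (i + 1)"] sf(3)[of i] se(3)[of i] se(1)[of i]
        2 simpleD sf(1)[of i] by blast
    then show fu1: "r (f (i + 1)) (u (i + 1))" .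
    show "r (f (i + 1)) (\<phi> (f i))" using sf(2) .
    have uf: "r (u i) (f (i + 1))"
      using \<open>r (u i) (f (i + 1))\<close> .
    then show "simple (u i) (f (i + 1))"
      using simple_extend[OF simple_refl[OF nu(2)] _ uf]
        up_trans[of "u i" "f (i + 1)" "u (i + 1)" "\<phi> (u i)"] fu1 simpleD[OF 2] simpleD(2)[OF sf(1)[of i]]
        phi_in r_phi by blast
    fix w assume w: "simple (u i) w" "r w (\<phi> (f i))" "r w (u (i + 1))"
    have ue: "simple (u i) (\<phi> (e i))" using simple_rotate[OF eu] .
    have "r (\<phi> (f i)) (\<phi> (e i))" using r_phi_iff simpleD[OF fe[of i]] by blast
    then have we: "r w (\<phi> (e i))" by (rule simple_trans[OF w(1) 1 ue w(2)])
    then have "r w (e (i + 1))" using se(4)[OF w(1) _ w(3)] by blast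
    moreover have "simple (e i) w"
      using simple_extend[OF eu[of i] simpleD(2)[OF w(1)] simpleD(3)[OF w(1)] we] .
    ultimately show "r w (f (i + 1))" using sf(4)[OF _ w(2)] by blast
  qed
  have fu: "simple (f i) (u i)" for i
  proof (rule int_induct_from_below)
    show "simple (f i) (u i)" if "i \<le> min M N" for i
      using that M N simple_pw_iff[of x z i] xz simpleD[OF xz] by simp
    fix i assume i: "simple (f i) (u i)"
    note m = imeet[OF simple_rotate[OF i] nu(1)[of i], folded step[OF i]]
    show "simple (f (i + 1)) (u (i + 1))"
      using simple_between[OF m(1) nu(1)[of i] m(3)] .
  qed
  have "lifts x u f"
    unfolding lifts_def using step[OF fu] N by blast
  then show ?thesis
    unfolding f_def e_def by (rule lift_eqI[symmetric])
qed

text \<open>Multiplication by the Garside element. For the shifted sequence the recursion demands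
  that the meet of \<open>\<phi> (u (i - 1))\<close> and \<open>u (i + 1)\<close> over
  \<open>u i\<close> be trivial, which is exactly greediness.\<close>

lemma lift_shift:
  assumes "x \<in> P" "u \<in> fibre (\<phi> x)"
  shows "lift x u = (\<lambda>i. u (i - 1))"
proof (rule lift_eqI)
  note nu = normalD[OF fibre_normal[OF assms(2)]]
  obtain N where N: "\<And>i. i \<le> N \<Longrightarrow> u i = pw i (\<phi> x)"
    using assms by (auto simp: fibre_def)
  have "u (i - 1) = pw i x" if "i \<le> N" for i
    using N[of "i - 1"] that pw_phi[OF assms(1), of "i - 1"] by simp
  moreover have "u i = imeet (u i) (\<phi> (u (i - 1))) (u (i + 1))" for i
  proof (rule imeet_eqI[symmetric])
    have u: "simple (u (i - 1)) (u i)" using nu(1)[of "i - 1"] by simp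
    show "simple (u i) (\<phi> (u (i - 1)))" using simple_rotate[OF u] .
    show "simple (u i) (u (i + 1))" using nu(1) .
    show "simple (u i) (u i)" using simple_refl nu(2) .
    show "r (u i) (\<phi> (u (i - 1)))" using simpleD(4)[OF u] .
    show "r (u i) (u (i + 1))" using simpleD(3)[OF nu(1)] .
    fix w assume "simple (u i) w" "r w (\<phi> (u (i - 1)))" "r w (u (i + 1))"
    then have "w = u i" using nu(3)[of w i] simpleD by blast
    then show "r w (u i)" using r_refl nu(2) by simp
  qed
  ultimately show "lifts x u (\<lambda>i. u (i - 1))"
    unfolding lifts_def by auto
qed

lemma shift_fibre:
  assumes "x \<in> P" "u \<in> fibre x"
  shows "(\<lambda>i. u (i + 1)) \<in> fibre (\<phi> x)"
proof -
  note nu = normalD[OF fibre_normal[OF assms(2)]]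
  obtain N where N: "\<And>i. i \<le> N \<Longrightarrow> u i = pw i x"
    using assms by (auto simp: fibre_def)
  have "u (i + 1) = pw i (\<phi> x)" if "i \<le> N - 1" for i
    using N[of "i + 1"] that pw_phi[OF assms(1), of i] by simp
  moreover have "normal (\<lambda>i. u (i + 1))"
    unfolding normal_def
  proof (intro conjI allI impI)
    show "simple (u (i + 1)) (u (i + 1 + 1))" for i using nu(1) .
    show "w = u (i + 1)" if "w \<in> P" "r (u (i + 1)) w" "r w (\<phi> (u (i - 1 + 1)))" "r w (u (i + 1 + 1))" for i w
      using nu(3)[of w "i + 1"] that by simp
  qed
  ultimately show ?thesis unfolding fibre_def by blast
qed

text \<open>A step from a point to its image under \<open>\<phi>\<close> lifts as a shift. Factoring
  such steps as \<open>psi y\<close>, \<open>x\<close>, \<open>y\<close> and as \<open>x\<close>,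
  \<open>y\<close>, \<open>\<phi> x\<close> yields injectivity and surjectivity.\<close>

theorem lift_bij:
  assumes xy: "simple x y"
  shows "bij_betw (lift x) (fibre y) (fibre x)"
proof -
  have in_P: "x \<in> P" "y \<in> P" using xy simpleD by auto
  have "inj_on (lift x) (fibre y)"
  proof (rule inj_onI)
    fix u v assume uv: "u \<in> fibre y" "v \<in> fibre y" "lift x u = lift x v"
    have s: "simple (psi y) x" "simple (psi y) y"
      using simple_psi[OF xy] simple_phi[OF psi_in[OF in_P(2)]] phi_psi in_P by auto
    have "lift (psi y) u = lift (psi y) v"
      using lift_comp[OF s(1) xy s(2)] uv by metis
    then have "u (i - 1) = v (i - 1)" for i
      using lift_shift[OF psi_in[OF in_P(2)]] uv phi_psi[OF in_P(2)] by (metis (mono_tags))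
    from this[of "i + 1" for i] show "u = v" by auto
  qed
  moreover have "lift x ` fibre y = fibre x"
  proof
    show "lift x ` fibre y \<subseteq> fibre x" using lift_fibre[OF xy] by blast
    show "fibre x \<subseteq> lift x ` fibre y"
    proof
      fix v assume v: "v \<in> fibre x"
      define w where "w = (\<lambda>i. v (i + 1))"
      have w: "w \<in> fibre (\<phi> x)" unfolding w_def using shift_fibre[OF in_P(1) v] .
      have yp: "simple y (\<phi> x)" using simple_rotate[OF xy] .
      have "v = lift x w" using lift_shift[OF in_P(1) w] by (simp add: w_def)
      also have "\<dots> = lift x (lift y w)"
        using lift_comp[OF xy yp simple_phi[OF in_P(1)] w] by simp
      finally show "v \<in> lift x ` fibre y"
        using lift_fibre[OF yp w] by blast
    qed
  qed
  ultimately show ?thesis by (simp add: bij_betw_def)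
qed

text \<open>The normal form of the identity at \<open>b\<close>: Garside steps up to index 0, then
  trivial steps. Greediness holds up to index 0 because of the left neighbour, and afterwards
  because of the right one.\<close>

lemma base_fibre:
  assumes b: "b \<in> P"
  shows "(\<lambda>i. pw (min i 0) b) \<in> fibre b"
proof -
  have "normal (\<lambda>i. pw (min i 0) b)"
    unfolding normal_def
  proof (intro conjI allI impI)
    show "simple (pw (min i 0) b) (pw (min (i + 1) 0) b)" for i
    proof (cases "i < 0")
      case True
      then show ?thesis using simple_phi[OF pw_in[OF b], of i] by (simp add: phi_pw b min_def)
    next
      case False
      then show ?thesis using simple_refl[OF b] by (simp add: min_def)
    qed
    fix i w assume w: "w \<in> P" "r (pw (min i 0) b) w" "r w (\<phi> (pw (min (i - 1) 0) b))"
      "r w (pw (min (i + 1) 0) b)"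
    have "r w (pw (min i 0) b)"
      using w(3,4) phi_pw[OF b, of "i - 1"] by (cases "i \<le> 0") (auto simp: min_def split: if_splits)
    then show "w = pw (min i 0) b"
      using w r_antisym pw_in[OF b] by blast
  qed
  moreover have "\<forall>i\<le>0. pw (min i 0) b = pw i b" by simp
  ultimately show ?thesis unfolding fibre_def by blast
qed

end

section \<open>The complex of simple chains\<close>

context garside
begin

abbreviation K :: "'a set set" where
  "K \<equiv> X_complex P r \<phi>"

lemma least_simple:
  assumes "finite s" "s \<noteq> {}" "\<And>a. a \<in> s \<Longrightarrow> simple x a" "\<And>a b. \<lbrakk>a \<in> s; b \<in> s\<rbrakk> \<Longrightarrow> r a b \<or> r b a"
  shows "\<exists>m\<in>s. \<forall>a\<in>s. r m a"
  using assms
proof (induction s rule: finite_ne_induct)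
  case (singleton a)
  then have "r a a" by blast
  then show ?case by blast
next
  case (insert a A)
  have "\<exists>m\<in>A. \<forall>b\<in>A. r m b"
    by (rule insert.IH) (use insert.prems in blast)+
  then obtain m where m: "m \<in> A" "\<And>b. b \<in> A \<Longrightarrow> r m b" by blast
  have sx: "simple x a" "simple x m" using insert.prems(1) m(1) by blast+
  show ?case
  proof (cases "r m a")
    case True
    then have "\<forall>b\<in>insert a A. r m b" using m(2) by simp
    then show ?thesis using m(1) by blast
  next
    case False
    then have am: "r a m" using insert.prems(2)[of a m] m(1) by simp
    have "r a b" if "b \<in> A" for b
      using simple_trans[OF sx insert.prems(1) am m(2)[OF that]] that by simp
    moreover have "r a a" using r_refl simpleD(2)[OF sx(1)] by blast
    ultimately have "\<forall>b\<in>insert a A. r a b" by simp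
    then show ?thesis by blast
  qed
qed

lemma weak_chain_of_finite:
  assumes "finite s" "s \<noteq> {}" "\<And>a. a \<in> s \<Longrightarrow> simple x a" "\<And>a b. \<lbrakk>a \<in> s; b \<in> s\<rbrakk> \<Longrightarrow> r a b \<or> r b a"
  shows "\<exists>cs. weak_chain P r cs \<and> set cs = s"
proof -
  have "\<exists>cs. set cs = s \<and> sorted_wrt (\<lambda>a b. r a b \<and> a \<noteq> b) cs"
    using assms(1,3,4)
  proof (induction s rule: finite_psubset_induct)
    case (psubset s)
    show ?case
    proof (cases "s = {}")
      case False
      obtain m where m: "m \<in> s" "\<And>a. a \<in> s \<Longrightarrow> r m a"
        using least_simple[OF psubset.hyps False psubset.prems] by blast
      have "s - {m} \<subset> s" using m by blast
      then obtain cs where "set cs = s - {m}" "sorted_wrt (\<lambda>a b. r a b \<and> a \<noteq> b) cs"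
        using psubset.IH[of "s - {m}"] psubset.prems by auto
      then have "set (m # cs) = s \<and> sorted_wrt (\<lambda>a b. r a b \<and> a \<noteq> b) (m # cs)"
        using m by auto
      then show ?thesis by blast
    qed simp
  qed
  then obtain cs where cs: "set cs = s" "sorted_wrt (\<lambda>a b. r a b \<and> a \<noteq> b) cs" by blast
  have "successively (\<lambda>a b. r a b \<and> a \<noteq> b) cs"
    using cs(2) by (induction cs rule: induct_list012) auto
  then have "weak_chain P r cs"
    using cs(1) assms(2,3) simpleD(2) unfolding weak_chain_def by force
  then show ?thesis using cs by blast
qed

lemma in_K_I:
  assumes "finite s" "s \<noteq> {}" "\<And>a. a \<in> s \<Longrightarrow> simple x a" "\<And>a b. \<lbrakk>a \<in> s; b \<in> s\<rbrakk> \<Longrightarrow> r a b \<or> r b a"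
  shows "s \<in> K"
proof -
  obtain cs where cs: "weak_chain P r cs" "set cs = s"
    using weak_chain_of_finite[OF assms] by blast
  have x: "x \<in> P" using assms(2,3) simpleD(1) by blast
  then have "set cs \<subseteq> order_interval P r x (\<phi> x)"
    using cs assms(3) simple_interval by blast
  then show ?thesis unfolding X_complex_def using cs x by blast
qed

text \<open>Consecutive comparisons give all comparisons because \<open>r\<close> is transitive
  inside \<open>[x, \<phi> x]\<close>.\<close>

lemma in_K_D:
  assumes "s \<in> K"
  shows "finite s" "s \<noteq> {}" "\<exists>x. \<forall>a\<in>s. simple x a" "\<lbrakk>a \<in> s; b \<in> s\<rbrakk> \<Longrightarrow> r a b \<or> r b a"
proof -
  obtain cs x where cs: "s = set cs" "weak_chain P r cs" and x: "x \<in> P" "set cs \<subseteq> order_interval P r x (\<phi> x)"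
    using assms unfolding X_complex_def by blast
  have sx: "simple x a" if "a \<in> set cs" for a
    using x that simple_interval by blast
  then show "\<exists>x. \<forall>a\<in>s. simple x a" using cs by blast
  show "finite s" "s \<noteq> {}" using cs by (auto simp: weak_chain_def)
  have "successively (\<lambda>a b. r a b \<and> a \<noteq> b) cs" using cs by (simp add: weak_chain_def)
  then have "sorted_wrt (\<lambda>a b. r a b \<and> a \<noteq> b) cs"
  proof (subst (asm) successively_iff_sorted_wrt_strong)
    fix a b c assume "a \<in> set cs" "b \<in> set cs" "c \<in> set cs" "r a b \<and> a \<noteq> b" "r b c \<and> b \<noteq> c"
    note abc = this
    have "r a c" using simple_trans[of x a b c] sx abc by blast
    moreover have "a \<noteq> c"
      using r_antisym[of a b] simpleD(2)[OF sx[OF abc(1)]] simpleD(2)[OF sx[OF abc(2)]] abc(4,5) by blast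
    ultimately show "r a c \<and> a \<noteq> c" by blast
  qed
  then have "\<And>a b. \<lbrakk>a \<in> set cs; b \<in> set cs\<rbrakk> \<Longrightarrow> a = b \<or> r a b \<or> r b a"
    by (induction cs) auto
  moreover have "r a a" if "a \<in> s" for a
    using cs(1) that r_refl[OF simpleD(2)[OF sx]] by blast
  ultimately show "\<lbrakk>a \<in> s; b \<in> s\<rbrakk> \<Longrightarrow> r a b \<or> r b a"
    using cs(1) by blast
qed

lemma K_simple:
  assumes "s \<in> K" "a \<in> s" "b \<in> s"
  shows "simple a b \<or> simple b a"
proof -
  obtain x where x: "\<forall>a\<in>s. simple x a" using in_K_D(3)[OF assms(1)] by blast
  have "simple x a" "simple x b" using x assms by blast+
  then show ?thesis
    using in_K_D(4)[OF assms] simple_between[of x a b] simple_between[of x b a] by blast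
qed

lemma complex_K: "abstract_complex K"
  unfolding abstract_complex_def
proof (intro conjI ballI allI impI)
  fix s t assume s: "s \<in> K" and t: "t \<subseteq> s \<and> t \<noteq> {}"
  obtain x where "\<forall>a\<in>s. simple x a" using in_K_D(3)[OF s] by blast
  then show "t \<in> K"
    using in_K_D(1,4)[OF s] t finite_subset by (intro in_K_I[of t x]) blast+
qed (use in_K_D in auto)

lemma K_least:
  assumes "s \<in> K"
  shows "\<exists>m\<in>s. \<forall>a\<in>s. simple m a"
proof -
  obtain x where x: "\<forall>a\<in>s. simple x a" using in_K_D(3)[OF assms] by blast
  obtain m where m: "m \<in> s" "\<And>a. a \<in> s \<Longrightarrow> r m a"
    using least_simple[OF in_K_D(1,2)[OF assms], of x] x in_K_D(4)[OF assms] by blast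
  then have "simple m a" if "a \<in> s" for a
    using simple_between[of x m a] x that by blast
  then show ?thesis using m(1) by blast
qed

lemma simple_in_K:
  assumes "simple x y"
  shows "{x, y} \<in> K"
proof (rule in_K_I)
  have in_P: "x \<in> P" "y \<in> P" using simpleD[OF assms] by auto
  show "simple x a" if "a \<in> {x, y}" for a
    using that assms simple_refl[OF in_P(1)] by blast
  show "r a b \<or> r b a" if "a \<in> {x, y}" "b \<in> {x, y}" for a b
    using that simpleD(3)[OF assms] r_refl[OF in_P(1)] r_refl[OF in_P(2)] by blast
qed auto

lemma Union_K: "\<Union>K = P"
proof
  show "\<Union>K \<subseteq> P"
  proof
    fix a assume "a \<in> \<Union>K"
    then obtain s where s: "s \<in> K" "a \<in> s" by blast
    then obtain x where "simple x a" using in_K_D(3)[OF s(1)] by blast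
    then show "a \<in> P" by (rule simpleD)
  qed
  show "P \<subseteq> \<Union>K" using simple_in_K[OF simple_refl] by blast
qed

lemma edge_K: "edge K x y \<longleftrightarrow> simple x y \<or> simple y x"
proof
  show "edge K x y \<Longrightarrow> simple x y \<or> simple y x"
    using K_simple unfolding edge_def by blast
  have "edge K a b \<and> edge K b a" if "simple a b" for a b
    using simple_in_K[OF that] unfolding edge_def by blast
  then show "simple x y \<or> simple y x \<Longrightarrow> edge K x y" by blast
qed

end

text \<open>Strictness of chains costs nothing, as stationary steps are dropped when the list is
  built.\<close>

lemma chain_le_iff_rtranclp:
  "chain_le P q a b \<longleftrightarrow> a \<in> P \<and> (\<lambda>a b. a \<in> P \<and> b \<in> P \<and> q a b)\<^sup>*\<^sup>* a b" (is "_ \<longleftrightarrow> _ \<and> ?R\<^sup>*\<^sup>* a b")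
proof
  have "hd cs \<in> P \<and> ?R\<^sup>*\<^sup>* (hd cs) (last cs)" if "weak_chain P q cs" for cs
    using that
  proof (induction cs rule: induct_list012)
    case (3 x y zs)
    then have "?R x y" "?R\<^sup>*\<^sup>* y (last (y # zs))"
      by (auto simp: weak_chain_def)
    then show ?case by (auto intro: converse_rtranclp_into_rtranclp)
  qed (auto simp: weak_chain_def)
  then show "chain_le P q a b \<Longrightarrow> a \<in> P \<and> ?R\<^sup>*\<^sup>* a b"
    unfolding chain_le_def by blast
  assume "a \<in> P \<and> ?R\<^sup>*\<^sup>* a b"
  then have "a \<in> P" "?R\<^sup>*\<^sup>* a b" by auto
  from this(2,1) show "chain_le P q a b"
  proof (induction rule: converse_rtranclp_induct)
    case base
    then have "weak_chain P q [b]" by (simp add: weak_chain_def)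
    then show ?case unfolding chain_le_def by force
  next
    case (step y z)
    then obtain cs where cs: "weak_chain P q cs" "hd cs = z" "last cs = b"
      unfolding chain_le_def by blast
    show ?case
    proof (cases "y = z")
      case False
      have "weak_chain P q (y # cs)" "last (y # cs) = b"
        using cs step False by (auto simp: weak_chain_def successively_Cons)
      then show ?thesis unfolding chain_le_def by force
    qed (use cs in \<open>auto simp: chain_le_def\<close>)
  qed
qed

section \<open>The generated order\<close>

locale garside_simply_connected = garside +
  assumes hom: "homogeneous P r"
    and gen: "generates_rel P r \<phi>"
    and sc: "simply_connected_space (geometric_realization (X_complex P r \<phi>))"
begin

text \<open>Only simple steps are allowed, so that the intervals and \<open>lift\<close> apply to
  each of them; as \<open>\<phi>\<close> generates \<open>r\<close>, the result is still
  \<open>chain_le P r\<close>.\<close>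

definition tle :: "'a \<Rightarrow> 'a \<Rightarrow> bool" where
  "tle a b \<longleftrightarrow> a \<in> P \<and> simple\<^sup>*\<^sup>* a b"

lemma sub_rel_simple: "a \<in> P \<and> b \<in> P \<and> sub_rel P r \<phi> a b \<longleftrightarrow> simple a b"
proof
  assume "a \<in> P \<and> b \<in> P \<and> sub_rel P r \<phi> a b"
  then obtain x where "r a b" "simple x a" "simple x b"
    unfolding sub_rel_def using simple_interval by blast
  then show "simple a b" using simple_between by blast
next
  assume s: "simple a b"
  then have "a \<in> order_interval P r a (\<phi> a)" "b \<in> order_interval P r a (\<phi> a)"
    using simple_interval simple_refl simpleD(1) by blast+
  then show "a \<in> P \<and> b \<in> P \<and> sub_rel P r \<phi> a b"
    unfolding sub_rel_def using s simpleD by blast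
qed

lemma r_imp_tle: "\<lbrakk>a \<in> P; b \<in> P; r a b\<rbrakk> \<Longrightarrow> tle a b"
proof -
  assume ab: "a \<in> P" "b \<in> P" "r a b"
  have "chain_le P (sub_rel P r \<phi>) a b"
    by (rule gen[unfolded generates_rel_def, rule_format, OF ab])
  then show "tle a b"
    by (simp only: chain_le_iff_rtranclp sub_rel_simple tle_def)
qed

lemma tle_refl: "a \<in> P \<Longrightarrow> tle a a"
  by (simp add: tle_def)

lemma tle_trans: "tle a b \<Longrightarrow> tle b c \<Longrightarrow> tle a c"
  by (auto simp: tle_def)

lemma tle_in:
  assumes "tle a b"
  shows "a \<in> P" "b \<in> P"
proof -
  show "a \<in> P" using assms by (simp add: tle_def)
  have "simple\<^sup>*\<^sup>* a b" using assms by (simp add: tle_def)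
  then show "b \<in> P" by (cases rule: rtranclp.cases) (use \<open>a \<in> P\<close> simpleD(2) in auto)
qed

lemma simple_imp_tle: "simple a b \<Longrightarrow> tle a b"
  by (auto simp: tle_def simpleD)

lemma chain_le_tle: "chain_le P r a b \<longleftrightarrow> tle a b"
proof
  assume "chain_le P r a b"
  then have "a \<in> P" "(\<lambda>a b. a \<in> P \<and> b \<in> P \<and> r a b)\<^sup>*\<^sup>* a b"
    by (auto simp: chain_le_iff_rtranclp)
  from this(2,1) show "tle a b"
    by (induction rule: rtranclp_induct) (auto intro: tle_refl tle_trans r_imp_tle)
next
  assume a: "tle a b"
  have "(\<lambda>a b. a \<in> P \<and> b \<in> P \<and> r a b)\<^sup>*\<^sup>* a b"
    by (rule rtranclp_mono[THEN predicate2D, of simple]) (use a simpleD in \<open>auto simp: tle_def\<close>)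
  then show "chain_le P r a b" using a by (simp add: chain_le_iff_rtranclp tle_def)
qed

lemma tle_phi: "tle a b \<Longrightarrow> tle (\<phi> a) (\<phi> b)"
proof -
  assume a: "tle a b"
  then have "simple\<^sup>*\<^sup>* a b" by (simp add: tle_def)
  then have "simple\<^sup>*\<^sup>* (\<phi> a) (\<phi> b)"
  proof (induction rule: rtranclp_induct)
    case (step y z)
    then show ?case
      using simple_phi_iff[of y z] simpleD by (meson rtranclp.rtrancl_into_rtrancl)
  qed simp
  then show ?thesis using a phi_in by (simp add: tle_def)
qed

lemma tle_psi: "tle a b \<Longrightarrow> tle (psi a) (psi b)"
proof -
  assume a: "tle a b"
  then have "simple\<^sup>*\<^sup>* a b" by (simp add: tle_def)
  then have "simple\<^sup>*\<^sup>* (psi a) (psi b)"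
  proof (induction rule: rtranclp_induct)
    case (step y z)
    then have "simple (psi y) (psi z)"
      using simple_phi_iff[of "psi y" "psi z"] psi_in phi_psi simpleD[of y z] by auto
    then show ?case using step by (meson rtranclp.rtrancl_into_rtrancl)
  qed simp
  then show ?thesis using a psi_in by (simp add: tle_def)
qed

lemma tle_pw: "tle a b \<Longrightarrow> tle (pw j a) (pw j b)"
proof (induction j rule: int_induct[where k = 0])
  case (step1 i)
  then show ?case using tle_phi[of "pw i a" "pw i b"] phi_pw tle_in by simp
next
  case (step2 i)
  then show ?case using tle_psi[of "pw i a" "pw i b"] psi_pw tle_in by simp
qed simp

lemma pw_pw: "x \<in> P \<Longrightarrow> pw i (pw j x) = pw (i + j) x"
proof (induction i rule: int_induct[where k = 0])
  case (step1 i)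
  then show ?case using phi_pw[of "pw j x" i] phi_pw[of x "i + j"] pw_in by (simp add: algebra_simps)
next
  case (step2 i)
  then show ?case using psi_pw[of "pw j x" i] psi_pw[of x "i + j"] pw_in by (simp add: algebra_simps)
qed simp

lemma tle_pw_le:
  assumes x: "x \<in> P" and "i \<le> j"
  shows "tle (pw i x) (pw j x)"
  using assms(2)
proof (induction j rule: int_ge_induct)
  case base
  then show ?case using tle_refl pw_in x by blast
next
  case (step j)
  then show ?case
    using tle_trans simple_imp_tle[OF simple_phi[OF pw_in[OF x]], of j] phi_pw[OF x, of j] by metis
qed

text \<open>The length is an additive cocycle, hence a coboundary on a simply connected complex.\<close>

lemma height_exists: "\<exists>h :: 'a \<Rightarrow> int. \<forall>x y. simple x y \<longrightarrow> h x \<le> h y \<and> (h x = h y \<longrightarrow> x = y)"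
proof (cases "P = {}")
  case True
  then show ?thesis using simpleD by blast
next
  case False
  then obtain a0 where a0: "a0 \<in> P" by blast
  obtain len :: "'a \<Rightarrow> 'a \<Rightarrow> nat" where
    "(\<forall>a\<in>P. \<forall>b\<in>P. \<forall>c\<in>P. transitive_triple r a b c \<longrightarrow> len a c = len a b + len b c) \<and>
     (\<forall>a\<in>P. \<forall>b\<in>P. r a b \<longrightarrow> (len a b = 0 \<longleftrightarrow> a = b))"
    using hom unfolding homogeneous_def by (rule exE)
  then have len: "\<And>a b c. \<lbrakk>a \<in> P; b \<in> P; c \<in> P; transitive_triple r a b c\<rbrakk> \<Longrightarrow> len a c = len a b + len b c"
    "\<And>a b. \<lbrakk>a \<in> P; b \<in> P; r a b\<rbrakk> \<Longrightarrow> len a b = 0 \<longleftrightarrow> a = b"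
    by simp_all
  \<comment> \<open>Heights are integers and not natural numbers, so that descending is a bijection
    of the fibre.\<close>
  define D where "D = (\<lambda>y x s. s - int (len x y))"
  have bij: "bij_betw (D y x) UNIV UNIV" for x y
    unfolding D_def by (rule bij_betw_byWitness[where f' = "\<lambda>s. s + int (len x y)"]) auto
  have comp: "D y x (D z y s) = D z x s" if "simple x y" "simple y z" "simple x z" for x y z s
  proof -
    have "len x z = len x y + len y z"
      using that simpleD by (intro len(1)) (auto simp: transitive_triple_def)
    then show ?thesis by (simp add: D_def)
  qed
  have "a0 \<in> \<Union>K" using a0 Union_K by blast
  have "\<exists>h. h a0 = 0 \<and> (\<forall>b\<in>\<Union>K. h b \<in> UNIV) \<and>
    (\<forall>x y. edge K x y \<longrightarrow> simple x y \<longrightarrow> D y x (h y) = h x)"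
  proof (rule global_section_ordered[OF complex_K sc])
    show "\<exists>m\<in>t. \<forall>a\<in>t. simple m a" if "t \<in> K" for t using K_least[OF that] .
    show "simple a b \<or> simple b a" if "t \<in> K" "a \<in> t" "b \<in> t" for t a b using K_simple[OF that] .
    show "bij_betw (D y x) UNIV UNIV" for x y by (rule bij)
    show "D y x (D z y s) = D z x s" if "simple x y" "simple y z" "simple x z" for x y z s
      using comp[OF that] .
  qed (use \<open>a0 \<in> \<Union>K\<close> in simp_all)
  then obtain h where h: "\<And>x y. edge K x y \<Longrightarrow> simple x y \<Longrightarrow> D y x (h y) = h x"
    by blast
  have "h x \<le> h y \<and> (h x = h y \<longrightarrow> x = y)" if xy: "simple x y" for x y
  proof -
    have "edge K x y" using xy edge_K by blast
    from h[OF this xy] have "h x = h y - int (len x y)" by (simp add: D_def)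
    then show ?thesis using len(2)[OF simpleD(1-3)[OF xy]] by auto
  qed
  then show ?thesis by blast
qed

definition ht :: "'a \<Rightarrow> int" where
  "ht = (SOME h. \<forall>x y. simple x y \<longrightarrow> h x \<le> h y \<and> (h x = h y \<longrightarrow> x = y))"

lemma tle_ht:
  assumes "tle a b"
  shows "ht a \<le> ht b" "ht a = ht b \<Longrightarrow> a = b"
proof -
  have s: "ht x \<le> ht y \<and> (ht x = ht y \<longrightarrow> x = y)" if "simple x y" for x y
    using someI_ex[OF height_exists] that unfolding ht_def by blast
  have "simple\<^sup>*\<^sup>* a b" using assms by (simp add: tle_def)
  then have "ht a \<le> ht b \<and> (ht a = ht b \<longrightarrow> a = b)"
  proof (induction rule: rtranclp_induct)
    case (step y z)
    then show ?case using s[of y z] by fastforce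
  qed simp
  then show "ht a \<le> ht b" "ht a = ht b \<Longrightarrow> a = b" by auto
qed

lemma tle_antisym:
  assumes "tle a b" "tle b a"
  shows "a = b"
  by (rule tle_ht(2)[OF assms(1)]) (rule order_antisym[OF tle_ht(1)[OF assms(1)] tle_ht(1)[OF assms(2)]])

lemma partial_order_generated: "generates_partial_order P r"
  unfolding generates_partial_order_def
proof
  assume "\<exists>cs. weak_chain P r cs \<and> 2 \<le> length cs \<and> hd cs = last cs"
  then obtain cs where cs: "weak_chain P r cs" "2 \<le> length cs" "hd cs = last cs" by blast
  then obtain a b zs where z: "cs = a # b # zs"
    by (cases cs; cases "tl cs") auto
  have ab: "a \<in> P" "b \<in> P" "r a b" "a \<noteq> b" and w: "weak_chain P r (b # zs)"
    using cs(1) z by (auto simp: weak_chain_def)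
  have "chain_le P r b (last (b # zs))"
    using w unfolding chain_le_def by force
  then have "tle b a"
    using cs(3) z by (simp add: chain_le_tle)
  then have "a = b"
    by (rule tle_antisym[OF r_imp_tle[OF ab(1-3)]])
  then show False using ab(4) by simp
qed

lemma tle_first_step:
  assumes "tle a b" "a \<noteq> b"
  obtains c where "simple a c" "c \<noteq> a" "tle c b"
proof -
  have "simple\<^sup>*\<^sup>* a b" using assms by (simp add: tle_def)
  then have "a \<noteq> b \<longrightarrow> (\<exists>c. simple a c \<and> c \<noteq> a \<and> tle c b)"
  proof (induction rule: converse_rtranclp_induct)
    case (step y z)
    show ?case
    proof (cases "y = z")
      case False
      moreover have "tle z b"
        using step.hyps(2) simpleD(2)[OF step.hyps(1)] by (simp add: tle_def)
      ultimately show ?thesis using step.hyps(1) by metis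
    next
      case True
      then show ?thesis using step.IH by simp
    qed
  qed simp
  then obtain c where "simple a c \<and> c \<noteq> a \<and> tle c b" using assms(2) by blast
  then show ?thesis by (intro that[of c]) simp_all
qed

section \<open>Heads\<close>

text \<open>The section through the normal form of the identity at \<open>b\<close> assigns to
  \<open>x\<close> the normal form of the way from \<open>x\<close> to \<open>b\<close>. Below
  \<open>b\<close> it follows the orbit up to index 0, so the term at index 1 is the end of the
  first proper step.\<close>

theorem head_exists:
  assumes b: "b \<in> P"
  shows "\<exists>\<alpha>. \<forall>x. tle x b \<longrightarrow> simple x (\<alpha> x) \<and> tle (\<alpha> x) b \<and> (\<forall>z. simple x z \<and> tle z b \<longrightarrow> r z (\<alpha> x))"
proof -
  have "b \<in> \<Union>K" using b Union_K by blast
  have "\<exists>\<sigma>. \<sigma> b = (\<lambda>i. pw (min i 0) b) \<and> (\<forall>x\<in>\<Union>K. \<sigma> x \<in> fibre x) \<and>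
    (\<forall>x y. edge K x y \<longrightarrow> simple x y \<longrightarrow> lift x (\<sigma> y) = \<sigma> x)"
  proof (rule global_section_ordered[OF complex_K sc])
    show "\<exists>m\<in>t. \<forall>a\<in>t. simple m a" if "t \<in> K" for t using K_least[OF that] .
    show "simple a b \<or> simple b a" if "t \<in> K" "a \<in> t" "b \<in> t" for t a b using K_simple[OF that] .
    show "bij_betw (lift x) (fibre y) (fibre x)" if "simple x y" for x y using lift_bij[OF that] .
    show "lift x (lift y s) = lift x s" if "simple x y" "simple y z" "simple x z" "s \<in> fibre z" for x y z s
      using lift_comp[OF that] .
    show "b \<in> \<Union>K" by fact
    show "(\<lambda>i. pw (min i 0) b) \<in> fibre b" using base_fibre[OF b] .
  qed
  then obtain \<sigma> where \<sigma>: "\<sigma> b = (\<lambda>i. pw (min i 0) b) \<and> (\<forall>x\<in>\<Union>K. \<sigma> x \<in> fibre x) \<and>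
    (\<forall>x y. edge K x y \<longrightarrow> simple x y \<longrightarrow> lift x (\<sigma> y) = \<sigma> x)"
    by (rule exE)
  then have \<sigma>b: "\<sigma> b = (\<lambda>i. pw (min i 0) b)"
    and \<sigma>e: "\<And>x y. edge K x y \<Longrightarrow> simple x y \<Longrightarrow> lift x (\<sigma> y) = \<sigma> x"
    by simp_all
  have \<sigma>in: "\<sigma> x \<in> fibre x" if "x \<in> P" for x
    using \<sigma> that unfolding Union_K by simp
  have lf: "lifts x (\<sigma> y) (\<sigma> x)" if "simple x y" for x y
  proof -
    have "edge K x y" using that edge_K by blast
    then have "lift x (\<sigma> y) = \<sigma> x" by (rule \<sigma>e[OF _ that])
    then show ?thesis using lift_lifts[OF that \<sigma>in[OF simpleD(2)[OF that]]] by simp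
  qed
  \<comment> \<open>In general the orbit part of \<open>\<sigma> x\<close> may end anywhere.
    Descending from \<open>b\<close> along a chain of simple pairs keeps it up to index 0.\<close>
  have Q: "\<forall>i\<le>0. \<sigma> x i = pw i x" if "tle x b" for x
  proof -
    have "simple\<^sup>*\<^sup>* x b" using that by (simp add: tle_def)
    then show ?thesis
    proof (induction rule: converse_rtranclp_induct)
      case base
      then show ?case using \<sigma>b by simp
    next
      case (step x y)
      note l = lf[OF step.hyps(1)]
      obtain N where N: "\<And>i. i \<le> N \<Longrightarrow> \<sigma> x i = pw i x" using l unfolding lifts_def by blast
      have "i \<le> 0 \<longrightarrow> \<sigma> x i = pw i x" for i
      proof (rule int_induct_from_below[of N])
        fix i assume i: "i \<le> 0 \<longrightarrow> \<sigma> x i = pw i x"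
        show "i + 1 \<le> 0 \<longrightarrow> \<sigma> x (i + 1) = pw (i + 1) x"
        proof
          assume i0: "i + 1 \<le> 0"
          have "\<sigma> x (i + 1) = imeet (\<sigma> y i) (\<phi> (\<sigma> x i)) (\<sigma> y (i + 1))"
            using l by (simp add: lifts_def)
          then show "\<sigma> x (i + 1) = pw (i + 1) x"
            using i i0 step.IH imeet_pw[OF step.hyps(1), of i] by simp
        qed
      qed (use N in simp)
      then show ?case by blast
    qed
  qed
  define \<alpha> where "\<alpha> = (\<lambda>x. \<sigma> x 1)"
  have sa: "simple x (\<alpha> x)" if "tle x b" for x
    using normalD(1)[OF fibre_normal[OF \<sigma>in[OF tle_in(1)[OF that]]], of 0] Q[OF that] by (simp add: \<alpha>_def)
  have \<alpha>: "\<alpha> x = imeet y (\<phi> x) (\<alpha> y)" if "simple x y" "tle y b" for x y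
  proof -
    have "tle x b" using that simple_imp_tle tle_trans by blast
    moreover have "\<sigma> x (0 + 1) = imeet (\<sigma> y 0) (\<phi> (\<sigma> x 0)) (\<sigma> y (0 + 1))"
      using lf[OF that(1)] unfolding lifts_def by blast
    ultimately show ?thesis using Q[of x] Q[OF that(2)] by (simp add: \<alpha>_def)
  qed
  \<comment> \<open>The meet at index 0 is taken over \<open>y\<close>, so
    \<open>y \<le> \<alpha> x\<close> is automatic. As \<open>y\<close> may be any simple successor
    of \<open>x\<close> below \<open>b\<close>, this is the maximality of the head.\<close>
  have m: "simple y (\<alpha> x)" "simple (\<alpha> x) (\<alpha> y)" if "simple x y" "tle y b" for x y
  proof -
    note m = imeet[OF simple_rotate[OF that(1)] sa[OF that(2)], folded \<alpha>[OF that]]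
    show "simple y (\<alpha> x)" using m(1) .
    show "simple (\<alpha> x) (\<alpha> y)" using simple_between[OF m(1) sa[OF that(2)] m(3)] .
  qed
  have below: "tle (\<alpha> x) b" if "tle x b" for x
  proof -
    have "simple\<^sup>*\<^sup>* x b" using that by (simp add: tle_def)
    then show ?thesis
    proof (induction rule: converse_rtranclp_induct)
      case base
      then show ?case using \<sigma>b tle_refl[OF b] by (simp add: \<alpha>_def)
    next
      case (step x y)
      have "tle y b" using step simpleD(2) by (auto simp: tle_def)
      then show ?case using m(2)[OF step.hyps(1)] step.IH simple_imp_tle tle_trans by blast
    qed
  qed
  have "simple x (\<alpha> x) \<and> tle (\<alpha> x) b \<and> (\<forall>z. simple x z \<and> tle z b \<longrightarrow> r z (\<alpha> x))" if "tle x b" for x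
    using sa[OF that] below[OF that] m(1) simpleD(3) by blast
  then show ?thesis by blast
qed

definition head :: "'a \<Rightarrow> 'a \<Rightarrow> 'a" where
  "head b = (SOME \<alpha>. \<forall>x. tle x b \<longrightarrow> simple x (\<alpha> x) \<and> tle (\<alpha> x) b \<and> (\<forall>z. simple x z \<and> tle z b \<longrightarrow> r z (\<alpha> x)))"

lemma head:
  assumes "tle x b"
  shows "simple x (head b x)" "tle (head b x) b" "\<lbrakk>simple x z; tle z b\<rbrakk> \<Longrightarrow> r z (head b x)"
  using someI_ex[OF head_exists[OF tle_in(2)[OF assms]]] assms unfolding head_def by blast+

text \<open>If the head \<open>w\<close> of \<open>z\<close> at \<open>x\<close> is not
  \<open>z\<close>, take a next simple step to \<open>v\<close> below \<open>z\<close>. Over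
  \<open>w\<close> the point \<open>\<phi> x\<close> is its own head, so
  \<open>v \<le> \<phi> x\<close> holds for \<open>r\<close>; then \<open>v\<close> is simple over
  \<open>x\<close>, against the maximality of \<open>w\<close>.\<close>

lemma simple_iff_tle: "simple x z \<longleftrightarrow> tle x z \<and> tle z (\<phi> x)"
proof
  assume "simple x z"
  then show "tle x z \<and> tle z (\<phi> x)" using simple_imp_tle simple_rotate by blast
next
  assume a: "tle x z \<and> tle z (\<phi> x)"
  define w where "w = head z x"
  have w: "simple x w" "tle w z" using head[of x z] a by (auto simp: w_def)
  show "simple x z"
  proof (cases "w = z")
    case False
    then obtain v where v: "simple w v" "v \<noteq> w" "tle v z"
      using tle_first_step[OF w(2)] by blast
    have wx: "simple w (\<phi> x)" using simple_rotate[OF w(1)] .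
    note hd = head[OF simple_imp_tle[OF wx]]
    have "tle (\<phi> x) (head (\<phi> x) w)"
      using hd(3)[OF wx] tle_refl r_imp_tle simpleD(2)[OF wx] simpleD(2)[OF hd(1)] by blast
    then have "head (\<phi> x) w = \<phi> x" using hd(2) tle_antisym by blast
    then have "r v (\<phi> x)" using hd(3)[OF v(1)] v(3) a tle_trans by metis
    then have "simple x v" using simple_extend[OF w(1) simpleD(2)[OF v(1)] simpleD(3)[OF v(1)]] by blast
    then have "r v w" unfolding w_def using head(3)[of x z v] a v(3) by blast
    then show ?thesis using r_antisym simpleD[OF v(1)] v(2) by blast
  qed (use w in simp)
qed

section \<open>The generated order is a lattice\<close>

text \<open>Induction on the height from \<open>x\<close> to \<open>a\<close>. Here \<open>y\<close>
  is the greatest lower bound among the points simple over \<open>x\<close>, and every lower bound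
  other than \<open>x\<close> begins with a simple step to some \<open>c \<le> y\<close>.\<close>

lemma glb_above:
  assumes "tle x a" "tle x b"
  shows "\<exists>m. tle x m \<and> tle m a \<and> tle m b \<and> (\<forall>z. tle x z \<and> tle z a \<and> tle z b \<longrightarrow> tle z m)"
  using assms
proof (induction "nat (ht a - ht x)" arbitrary: x rule: less_induct)
  case less
  note a = head[OF less.prems(1)] and b = head[OF less.prems(2)]
  define y where "y = imeet x (head a x) (head b x)"
  note y = imeet[OF a(1) b(1), folded y_def]
  have below: "tle z a \<and> tle z b" if "simple x z" "r z (head a x)" "r z (head b x)" for z
    using that a(1,2) b(1,2) simpleD(2) r_imp_tle tle_trans by meson
  have IH: "\<exists>m. tle z m \<and> tle m a \<and> tle m b \<and> (\<forall>v. tle z v \<and> tle v a \<and> tle v b \<longrightarrow> tle v m)"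
    if z: "simple x z" "z \<noteq> x" "tle z a" "tle z b" for z
  proof (rule less.hyps)
    have "ht x < ht z" using tle_ht[OF simple_imp_tle[OF z(1)]] z(2) by fastforce
    then show "nat (ht a - ht z) < nat (ht a - ht x)" using tle_ht(1)[OF z(3)] by linarith
  qed (use z in auto)
  have first: "\<exists>c. simple x c \<and> c \<noteq> x \<and> tle c z \<and> tle c a \<and> tle c b \<and> r c y"
    if z: "tle x z" "tle z a" "tle z b" "z \<noteq> x" for z
  proof -
    obtain c where c: "simple x c" "c \<noteq> x" "tle c z" using tle_first_step[OF z(1)] z(4) by metis
    then have "tle c a" "tle c b" using z tle_trans by blast+
    then show ?thesis using c y(4)[of c] a(3) b(3) by blast
  qed
  show ?case
  proof (cases "y = x")
    case True
    have "tle z x" if "tle x z" "tle z a" "tle z b" for z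
    proof (cases "z = x")
      case False
      then show ?thesis using first[OF that] True r_antisym simpleD by blast
    qed (use that in simp)
    then show ?thesis using less.prems tle_refl tle_in(1) by blast
  next
    case False
    note yb = below[OF y(1-3)]
    obtain m where m: "tle y m" "tle m a" "tle m b" "\<And>z. \<lbrakk>tle y z; tle z a; tle z b\<rbrakk> \<Longrightarrow> tle z m"
      using IH[OF y(1) False] yb by blast
    have xm: "tle x m" using simple_imp_tle[OF y(1)] m(1) tle_trans by blast
    have "tle z m" if z: "tle x z" "tle z a" "tle z b" for z
    proof (cases "z = x")
      case False
      then obtain c where c: "simple x c" "c \<noteq> x" "tle c z" "tle c a" "tle c b" "r c y"
        using first[OF z] by blast
      obtain m' where m': "tle m' a" "tle m' b" "\<And>z. \<lbrakk>tle c z; tle z a; tle z b\<rbrakk> \<Longrightarrow> tle z m'"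
        using IH[OF c(1,2,4,5)] by blast
      have cy: "tle c y" using r_imp_tle c(1,6) y(1) simpleD(2) by blast
      \<comment> \<open>As \<open>y\<close> is a lower bound above \<open>c\<close>, the meet
        \<open>m'\<close> above \<open>c\<close> is also a lower bound above \<open>y\<close> and
        hence below \<open>m\<close>.\<close>
      have "tle y m'" using m'(3)[OF cy] yb by blast
      then have "tle m' m" using m(4) m'(1,2) by blast
      then show ?thesis using m'(3)[OF c(3) z(2,3)] tle_trans by blast
    qed (use xm in simp)
    then show ?thesis using m xm by blast
  qed
qed

text \<open>Along an edge path from \<open>x\<close> to \<open>y\<close>, an upward edge is free and
  a downward edge from \<open>y\<close> to \<open>z\<close> costs one power of
  \<open>\<phi>\<close>, because \<open>psi y \<le> z\<close>.\<close>

lemma orbit_below: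
  assumes x: "x \<in> P" and y: "y \<in> P"
  shows "\<exists>n::nat. tle (pw (- int n) x) y"
proof -
  have "(edge K)\<^sup>*\<^sup>* x y"
    using edge_connected[OF complex_K] sc x y Union_K by (simp add: simply_connected_space_def)
  then show ?thesis
  proof (induction rule: rtranclp_induct)
    case base
    then show ?case using tle_refl[OF x] by (intro exI[of _ 0]) simp
  next
    case (step y z)
    then obtain n :: nat where n: "tle (pw (- int n) x) y" by blast
    have "simple y z \<or> simple z y" using step.hyps(2) edge_K by blast
    then show ?case
    proof
      assume "simple y z"
      then show ?thesis using n simple_imp_tle tle_trans by blast
    next
      assume "simple z y"
      then have "tle (psi y) z" using simple_psi simple_imp_tle by blast
      moreover have "tle (pw (- int (Suc n)) x) (psi y)"
      proof -
        have "- int (Suc n) = - int n - 1" by simp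
        then show ?thesis using tle_psi[OF n] psi_pw[OF x, of "- int n"] by metis
      qed
      ultimately show ?thesis using tle_trans by blast
    qed
  qed
qed

lemma orbit_above:
  assumes x: "x \<in> P" and y: "y \<in> P"
  shows "\<exists>n::nat. tle y (pw (int n) x)"
proof -
  obtain n :: nat where "tle (pw (- int n) y) x" using orbit_below[OF y x] by blast
  from tle_pw[OF this, of "int n"] show ?thesis using pw_pw[OF y] by auto
qed

lemma common_lower_bound:
  assumes "a \<in> P" "b \<in> P"
  obtains x where "tle x a" "tle x b"
proof -
  obtain n :: nat where "tle (pw (- int n) a) b" using orbit_below assms by blast
  moreover have "tle (pw (- int n) a) a" using tle_pw_le[OF assms(1), of "- int n" 0] by simp
  ultimately show ?thesis using that by blast
qed

text \<open>The meet above \<open>x\<close> also dominates a lower bound \<open>z\<close> not above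
  \<open>x\<close>: compare it with the meet above a common lower bound of \<open>x\<close> and
  \<open>z\<close>.\<close>

lemma glb_global:
  assumes a: "a \<in> P" and b: "b \<in> P"
  shows "\<exists>m. tle m a \<and> tle m b \<and> (\<forall>z. tle z a \<and> tle z b \<longrightarrow> tle z m)"
proof -
  obtain x where x: "tle x a" "tle x b" using common_lower_bound[OF a b] .
  obtain m where m: "tle x m" "tle m a" "tle m b" "\<And>z. \<lbrakk>tle x z; tle z a; tle z b\<rbrakk> \<Longrightarrow> tle z m"
    using glb_above[OF x] by blast
  have "tle z m" if z: "tle z a" "tle z b" for z
  proof -
    obtain y where y: "tle y x" "tle y z" using common_lower_bound[of x z] x z tle_in(1) by metis
    have "tle y a" "tle y b" using y(1) x tle_trans by blast+
    then obtain m' where m': "tle m' a" "tle m' b" "\<And>z. \<lbrakk>tle y z; tle z a; tle z b\<rbrakk> \<Longrightarrow> tle z m'"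
      using glb_above by blast
    have "tle x m'" using m'(3)[OF y(1) x] .
    then have "tle m' m" using m(4) m' by blast
    then show ?thesis using m'(3)[OF y(2) z] tle_trans by blast
  qed
  then show ?thesis using m by blast
qed

text \<open>An upper bound \<open>u\<close> of least height is the join. Its meet with another upper
  bound is again an upper bound, so it has the height of \<open>u\<close> and equals
  \<open>u\<close>.\<close>

lemma lub_global:
  assumes a: "a \<in> P" and b: "b \<in> P"
  shows "\<exists>m. tle a m \<and> tle b m \<and> (\<forall>z. tle a z \<and> tle b z \<longrightarrow> tle m z)"
proof -
  obtain n :: nat where n: "tle b (pw (int n) a)" using orbit_above[OF a b] by blast
  have "tle a (pw (int n) a)" using tle_pw_le[OF a, of 0 "int n"] by simp
  then have "\<exists>u. tle a u \<and> tle b u" using n by blast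
  then obtain u where u: "tle a u \<and> tle b u"
    "\<forall>v. tle a v \<and> tle b v \<longrightarrow> nat (ht u - ht a) \<le> nat (ht v - ht a)"
    using ex_has_least_nat[of "\<lambda>u. tle a u \<and> tle b u" _ "\<lambda>u. nat (ht u - ht a)"] by blast
  have "tle u z" if z: "tle a z" "tle b z" for z
  proof -
    obtain m where m: "tle m u" "tle m z" "\<And>v. \<lbrakk>tle v u; tle v z\<rbrakk> \<Longrightarrow> tle v m"
      using glb_global[of u z] u(1) z tle_in(2) by blast
    have am: "tle a m" "tle b m" using m(3) u(1) z by blast+
    then have "nat (ht u - ht a) \<le> nat (ht m - ht a)" using u(2) by blast
    then have "ht m = ht u" using tle_ht(1)[OF am(1)] tle_ht(1)[OF m(1)] by linarith
    then have "m = u" using tle_ht(2)[OF m(1)] by blast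
    then show ?thesis using m(2) by simp
  qed
  then show ?thesis using u(1) by blast
qed

lemma lattice_on_tle:
  assumes A: "A \<subseteq> P"
    and glb: "\<And>a b m. \<lbrakk>a \<in> A; b \<in> A; tle m a; tle m b; \<forall>z. tle z a \<and> tle z b \<longrightarrow> tle z m\<rbrakk> \<Longrightarrow> m \<in> A"
    and lub: "\<And>a b m. \<lbrakk>a \<in> A; b \<in> A; tle a m; tle b m; \<forall>z. tle a z \<and> tle b z \<longrightarrow> tle m z\<rbrakk> \<Longrightarrow> m \<in> A"
  shows "lattice_on A tle"
proof -
  let ?L = "\<lparr>carrier = A, eq = (=), le = tle\<rparr>"
  have po: "partial_order ?L"
    by unfold_locales (use A tle_refl tle_antisym tle_trans in auto)
  have "upper_semilattice ?L"
  proof (intro upper_semilattice.intro upper_semilattice_axioms.intro po)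
    fix a b assume "a \<in> carrier ?L" "b \<in> carrier ?L"
    then have ab: "a \<in> A" "b \<in> A" by auto
    then obtain m where "tle a m" "tle b m" "\<forall>z. tle a z \<and> tle b z \<longrightarrow> tle m z"
      using lub_global[of a b] A by blast
    then have "least ?L m (Upper ?L {a, b})"
      using lub[OF ab, of m] ab by (auto simp: least_def Upper_def)
    then show "\<exists>s. least ?L s (Upper ?L {a, b})" by blast
  qed
  moreover have "lower_semilattice ?L"
  proof (intro lower_semilattice.intro lower_semilattice_axioms.intro po)
    fix a b assume "a \<in> carrier ?L" "b \<in> carrier ?L"
    then have ab: "a \<in> A" "b \<in> A" by auto
    then obtain m where "tle m a" "tle m b" "\<forall>z. tle z a \<and> tle z b \<longrightarrow> tle z m"
      using glb_global[of a b] A by blast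
    then have "greatest ?L m (Lower ?L {a, b})"
      using glb[OF ab, of m] ab by (auto simp: greatest_def Lower_def)
    then show "\<exists>s. greatest ?L s (Lower ?L {a, b})" by blast
  qed
  ultimately show ?thesis
    by (simp add: lattice_on_def Lattice.lattice_def)
qed

lemma lattice_up_set: "x \<in> P \<Longrightarrow> lattice_on (up_set P tle x) tle"
  by (rule lattice_on_tle) (auto simp: up_set_def tle_in intro: tle_trans)

lemma lattice_down_set: "x \<in> P \<Longrightarrow> lattice_on (down_set P tle x) tle"
  by (rule lattice_on_tle) (auto simp: down_set_def tle_in intro: tle_trans)

text \<open>The length is the difference of heights; \<open>nat\<close> loses nothing as heights
  increase along \<open>tle\<close>.\<close>

lemma homogeneous_tle:
  assumes "A \<subseteq> P"
  shows "homogeneous A tle"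
proof -
  have "nat (ht c - ht a) = nat (ht b - ht a) + nat (ht c - ht b)" if "transitive_triple tle a b c" for a b c
    using that tle_ht(1)[of a b] tle_ht(1)[of b c] unfolding transitive_triple_def by linarith
  moreover have "nat (ht b - ht a) = 0 \<longleftrightarrow> a = b" if "tle a b" for a b
    using tle_ht[OF that] by auto
  ultimately show ?thesis
    unfolding homogeneous_def by (intro exI[of _ "\<lambda>a b. nat (ht b - ht a)"]) simp
qed

section \<open>Contractibility\<close>

definition tmeet :: "'a \<Rightarrow> 'a \<Rightarrow> 'a" where
  "tmeet a b = (SOME m. tle m a \<and> tle m b \<and> (\<forall>z. tle z a \<and> tle z b \<longrightarrow> tle z m))"

definition tjoin :: "'a \<Rightarrow> 'a \<Rightarrow> 'a" where
  "tjoin a b = (SOME m. tle a m \<and> tle b m \<and> (\<forall>z. tle a z \<and> tle b z \<longrightarrow> tle m z))"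

lemma tmeet:
  assumes "a \<in> P" "b \<in> P"
  shows "tle (tmeet a b) a" "tle (tmeet a b) b" "\<lbrakk>tle z a; tle z b\<rbrakk> \<Longrightarrow> tle z (tmeet a b)"
proof -
  have "tle (tmeet a b) a \<and> tle (tmeet a b) b \<and> (\<forall>z. tle z a \<and> tle z b \<longrightarrow> tle z (tmeet a b))"
    unfolding tmeet_def using glb_global[OF assms] by (rule someI_ex)
  then show "tle (tmeet a b) a" "tle (tmeet a b) b" "\<lbrakk>tle z a; tle z b\<rbrakk> \<Longrightarrow> tle z (tmeet a b)"
    by simp_all
qed

lemma tjoin:
  assumes "a \<in> P" "b \<in> P"
  shows "tle a (tjoin a b)" "tle b (tjoin a b)" "\<lbrakk>tle a z; tle b z\<rbrakk> \<Longrightarrow> tle (tjoin a b) z"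
proof -
  have "tle a (tjoin a b) \<and> tle b (tjoin a b) \<and> (\<forall>z. tle a z \<and> tle b z \<longrightarrow> tle (tjoin a b) z)"
    unfolding tjoin_def using lub_global[OF assms] by (rule someI_ex)
  then show "tle a (tjoin a b)" "tle b (tjoin a b)" "\<lbrakk>tle a z; tle b z\<rbrakk> \<Longrightarrow> tle (tjoin a b) z"
    by simp_all
qed

section \<open>Monotone maps and simplices\<close>

lemma tmeet_absorb:
  assumes "tle a b"
  shows "tmeet a b = a" "tmeet b a = a"
proof -
  note in_P = tle_in[OF assms]
  show "tmeet a b = a"
    by (rule tle_antisym[OF tmeet(1)[OF in_P] tmeet(3)[OF in_P tle_refl[OF in_P(1)] assms]])
  show "tmeet b a = a"
    by (rule tle_antisym[OF tmeet(2)[OF in_P(2,1)] tmeet(3)[OF in_P(2,1) assms tle_refl[OF in_P(1)]]])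
qed

lemma tjoin_absorb:
  assumes "tle b a"
  shows "tjoin a b = a"
proof -
  note in_P = tle_in[OF assms]
  show ?thesis
    by (rule tle_antisym[OF tjoin(3)[OF in_P(2,1) tle_refl[OF in_P(2)] assms] tjoin(1)[OF in_P(2,1)]])
qed

lemma tmeet_mono:
  assumes "tle a c" "tle b d"
  shows "tle (tmeet a b) (tmeet c d)"
proof (rule tmeet(3))
  note ab = tmeet[OF tle_in(1)[OF assms(1)] tle_in(1)[OF assms(2)]]
  show "tle (tmeet a b) c" using ab(1) assms(1) by (rule tle_trans)
  show "tle (tmeet a b) d" using ab(2) assms(2) by (rule tle_trans)
qed (use assms tle_in in auto)

lemma tjoin_mono:
  assumes "tle a c" "tle b d"
  shows "tle (tjoin a b) (tjoin c d)"
proof (rule tjoin(3))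
  note cd = tjoin[OF tle_in(2)[OF assms(1)] tle_in(2)[OF assms(2)]]
  show "tle a (tjoin c d)" using assms(1) cd(1) by (rule tle_trans)
  show "tle b (tjoin c d)" using assms(2) cd(2) by (rule tle_trans)
qed (use assms tle_in in auto)

text \<open>Here \<open>simple_iff_tle\<close> turns inequalities of the generated order back into
  relations of \<open>r\<close>.\<close>

lemma in_K_tle:
  assumes "finite s" "s \<noteq> {}" "\<And>a. a \<in> s \<Longrightarrow> tle m a \<and> tle a (\<phi> m)"
    and "\<And>a b. \<lbrakk>a \<in> s; b \<in> s\<rbrakk> \<Longrightarrow> tle a b \<or> tle b a"
  shows "s \<in> K"
proof (rule in_K_I[OF assms(1,2)])
  show "simple m a" if "a \<in> s" for a
    using assms(3)[OF that] simple_iff_tle by blast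
  have "r a b" if "a \<in> s" "b \<in> s" "tle a b" for a b
  proof -
    have "tle b (\<phi> a)" using assms(3) that tle_phi tle_trans by blast
    then show ?thesis using that(3) simple_iff_tle simpleD(3) by blast
  qed
  then show "r a b \<or> r b a" if "a \<in> s" "b \<in> s" for a b
    using assms(4) that by blast
qed

lemma K_tle_total:
  assumes "s \<in> K" "a \<in> s" "b \<in> s"
  shows "tle a b \<or> tle b a"
  using K_simple[OF assms] simple_imp_tle by blast

text \<open>For the least vertex \<open>m\<close>, all points lie between \<open>f m\<close> and
  \<open>\<phi> (f m)\<close>. Comparisons between the two parts pass through
  \<open>f y \<le> g y\<close>.\<close>

lemma cut_in_K:
  assumes s: "s \<in> K" and y: "y \<in> s"
    and f: "\<And>a b. tle a b \<Longrightarrow> tle (f a) (f b)" and g: "\<And>a b. tle a b \<Longrightarrow> tle (g a) (g b)"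
    and fg: "\<And>a. a \<in> P \<Longrightarrow> tle (f a) (g a)"
    and gf: "\<And>w z. simple w z \<Longrightarrow> tle (g z) (\<phi> (f w))"
  shows "f ` {z\<in>s. tle z y} \<union> g ` {z\<in>s. tle y z} \<in> K" (is "?A \<union> ?B \<in> K")
proof -
  obtain m where m: "m \<in> s" "\<And>a. a \<in> s \<Longrightarrow> simple m a"
    using K_least[OF s] by blast
  have in_P: "a \<in> P" if "a \<in> s" for a using m(2)[OF that] by (rule simpleD)
  show ?thesis
  proof (rule in_K_tle)
    show "finite (?A \<union> ?B)" using in_K_D(1)[OF s] by simp
    show "?A \<union> ?B \<noteq> {}" using y tle_refl[OF in_P] by blast
    have le_f: "tle (f m) (f z)" and le_g: "tle (g z) (\<phi> (f m))" and fz: "tle (f z) (g z)"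
      if "z \<in> s" for z
      using f[OF simple_imp_tle[OF m(2)[OF that]]] gf[OF m(2)[OF that]] fg[OF in_P[OF that]] by auto
    show "tle (f m) a \<and> tle a (\<phi> (f m))" if a: "a \<in> ?A \<union> ?B" for a
    proof -
      obtain z where "z \<in> s" "a = f z \<or> a = g z" using a by blast
      then show ?thesis using le_f le_g fz tle_trans by metis
    qed
    show "tle a b \<or> tle b a" if ab: "a \<in> ?A \<union> ?B" "b \<in> ?A \<union> ?B" for a b
    proof -
      have cross: "tle (f z) (g w)" if "z \<in> s" "tle z y" "tle y w" for z w
        using f[OF that(2)] fz[OF y] g[OF that(3)] tle_trans by blast
      have AA: "tle a b \<or> tle b a" if AA: "a \<in> ?A" "b \<in> ?A"
      proof -
        obtain z w where "z \<in> s" "w \<in> s" "a = f z" "b = f w" using AA by blast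
        then show ?thesis using K_tle_total[OF s, of z w] f by blast
      qed
      have BB: "tle a b \<or> tle b a" if BB: "a \<in> ?B" "b \<in> ?B"
      proof -
        obtain z w where "z \<in> s" "w \<in> s" "a = g z" "b = g w" using BB by blast
        then show ?thesis using K_tle_total[OF s, of z w] g by blast
      qed
      have AB: "tle c d" if "c \<in> ?A" "d \<in> ?B" for c d
        using that cross by blast
      show ?thesis using ab AA BB AB by blast
    qed
  qed
qed

text \<open>Stage 0 is constant with value \<open>x\<close>, because the join with \<open>x\<close>
  lies above \<open>x\<close>; cofinality of the orbit removes the cap at each vertex
  eventually.\<close>

lemma order_homotopy_up:
  assumes x: "x \<in> P"
  shows "order_homotopy K tle (\<lambda>j y. tmeet (tjoin y x) (pw (int j) x)) (\<lambda>y. tjoin y x)"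
proof (rule order_homotopy.intro[OF complex_K])
  have j_in: "tjoin a x \<in> P" if "a \<in> P" for a using tjoin(1)[OF that x] by (rule tle_in)
  have p_in: "pw j x \<in> P" for j using pw_in[OF x] .
  show "tle y y" if "s \<in> K" "y \<in> s" for s y using K_tle_total[OF that that(2)] by blast
  show "tle y z \<or> tle z y" if "s \<in> K" "y \<in> s" "z \<in> s" for s y z using K_tle_total[OF that] .
  show "y = z" if "tle y z" "tle z y" for y z using tle_antisym[OF that] .
  show "tle a c" if "tle a b" "tle b c" for a b c using tle_trans[OF that] .
  show "(\<lambda>y. tmeet (tjoin y x) (pw (int j) x)) ` {z \<in> s. tle z y} \<union>
      (\<lambda>y. tmeet (tjoin y x) (pw (int (Suc j)) x)) ` {z \<in> s. tle y z} \<in> K"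
    if "s \<in> K" "y \<in> s" for s y j
  proof (rule cut_in_K[OF that])
    show "tle (tmeet (tjoin a x) (pw i x)) (tmeet (tjoin b x) (pw i x))" if "tle a b" for a b i
      using tmeet_mono[OF tjoin_mono[OF that tle_refl[OF x]] tle_refl[OF p_in]] .
    then show "tle (tmeet (tjoin a x) (pw i x)) (tmeet (tjoin b x) (pw i x))" if "tle a b" for a b i
      using that by blast
    show "tle (tmeet (tjoin a x) (pw (int j) x)) (tmeet (tjoin a x) (pw (int (Suc j)) x))" if "a \<in> P" for a
      by (rule tmeet_mono[OF tle_refl[OF j_in[OF that]] tle_pw_le[OF x]]) simp
    fix w z assume wz: "simple w z"
    have w: "w \<in> P" "z \<in> P" using wz simpleD by auto
    define v where "v = tmeet (tjoin z x) (pw (int (Suc j)) x)"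
    note v = tmeet(1,2)[OF j_in[OF w(2)] p_in[of "int (Suc j)"], folded v_def]
    have phi: "tle (tjoin w x) (\<phi> (tjoin w x))" using simple_imp_tle[OF simple_phi[OF j_in[OF w(1)]]] .
    have "tle z (\<phi> (tjoin w x))"
      using tle_trans[OF _ tle_phi[OF tjoin(1)[OF w(1) x]]] wz simple_iff_tle by blast
    moreover have "tle x (\<phi> (tjoin w x))" using tle_trans[OF tjoin(2)[OF w(1) x] phi] .
    ultimately have "tle v (\<phi> (tjoin w x))" using tle_trans[OF v(1) tjoin(3)[OF w(2) x]] by blast
    \<comment> \<open>Applying \<open>psi\<close> reduces the bound to the universal property of the
      meet, without commuting \<open>\<phi>\<close> past \<open>tmeet\<close>; it also lowers the
      cap from \<open>j + 1\<close> to \<open>j\<close>.\<close>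
    from tle_psi[OF this] have "tle (psi v) (tjoin w x)" using psi_phi[OF j_in[OF w(1)]] by simp
    moreover have "tle (psi v) (pw (int j) x)"
      using tle_psi[OF v(2)] psi_pw[OF x, of "int (Suc j)"] by simp
    ultimately have "tle (psi v) (tmeet (tjoin w x) (pw (int j) x))"
      by (rule tmeet(3)[OF j_in[OF w(1)] p_in])
    from tle_phi[OF this] show "tle (tmeet (tjoin z x) (pw (int (Suc j)) x)) (\<phi> (tmeet (tjoin w x) (pw (int j) x)))"
      using phi_psi[OF tle_in(1)[OF v(1)]] by (simp add: v_def)
  qed
  fix y assume "y \<in> \<Union>K"
  then have y: "y \<in> P" using Union_K by blast
  obtain n :: nat where n: "tle (tjoin y x) (pw (int n) x)" using orbit_above[OF x j_in[OF y]] by blast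
  have "tmeet (tjoin y x) (pw (int j) x) = tjoin y x" if "n \<le> j" for j
  proof (rule tmeet_absorb(1)[OF tle_trans[OF n]])
    show "tle (pw (int n) x) (pw (int j) x)" using that by (intro tle_pw_le[OF x]) simp
  qed
  then show "\<exists>N. \<forall>j\<ge>N. tmeet (tjoin y x) (pw (int j) x) = tjoin y x" by blast
qed

text \<open>The stages decrease with \<open>j\<close>, whence the reversed order. Stage 0 is the
  join with \<open>x\<close>, the final map of the other homotopy.\<close>

lemma order_homotopy_down:
  assumes x: "x \<in> P"
  shows "order_homotopy K (\<lambda>a b. tle b a) (\<lambda>j y. tjoin y (pw (- int j) x)) (\<lambda>y. y)"
proof (rule order_homotopy.intro[OF complex_K])
  have p_in: "pw j x \<in> P" for j using pw_in[OF x] .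
  show "tle y y" if "s \<in> K" "y \<in> s" for s y using K_tle_total[OF that that(2)] by blast
  show "tle z y \<or> tle y z" if "s \<in> K" "y \<in> s" "z \<in> s" for s y z using K_tle_total[OF that] by blast
  show "y = z" if "tle z y" "tle y z" for y z using tle_antisym[OF that(2,1)] .
  show "tle c a" if "tle b a" "tle c b" for a b c using tle_trans[OF that(2,1)] .
  show "(\<lambda>y. tjoin y (pw (- int j) x)) ` {z \<in> s. tle y z} \<union>
      (\<lambda>y. tjoin y (pw (- int (Suc j)) x)) ` {z \<in> s. tle z y} \<in> K"
    if "s \<in> K" "y \<in> s" for s y j
  \<comment> \<open>In the order of \<open>tle\<close>, the lower map \<open>f\<close> is stage
    \<open>Suc j\<close> and the upper map \<open>g\<close> is stage \<open>j\<close>.\<close>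
  proof (subst Un_commute, rule cut_in_K[OF that])
    show "tle (tjoin a (pw i x)) (tjoin b (pw i x))" if "tle a b" for a b i
      using tjoin_mono[OF that tle_refl[OF p_in]] .
    then show "tle (tjoin a (pw i x)) (tjoin b (pw i x))" if "tle a b" for a b i
      using that by blast
    show "tle (tjoin a (pw (- int (Suc j)) x)) (tjoin a (pw (- int j) x))" if "a \<in> P" for a
      by (rule tjoin_mono[OF tle_refl[OF that] tle_pw_le[OF x]]) simp
    fix w z assume wz: "simple w z"
    have w: "w \<in> P" "z \<in> P" using wz simpleD by auto
    note u = tjoin(1,2)[OF w(1) p_in[of "- int (Suc j)"]]
    have "\<phi> (pw (- int (Suc j)) x) = pw (- int j) x"
      using phi_pw[OF x, of "- int (Suc j)"] by simp
    then have "tle (pw (- int j) x) (\<phi> (tjoin w (pw (- int (Suc j)) x)))"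
      using tle_phi[OF u(2)] by simp
    moreover have "tle z (\<phi> (tjoin w (pw (- int (Suc j)) x)))"
      using tle_trans[OF _ tle_phi[OF u(1)]] wz simple_iff_tle by blast
    ultimately show "tle (tjoin z (pw (- int j) x)) (\<phi> (tjoin w (pw (- int (Suc j)) x)))"
      using tjoin(3)[OF w(2) p_in] by blast
  qed
  fix y assume "y \<in> \<Union>K"
  then have y: "y \<in> P" using Union_K by blast
  obtain n :: nat where n: "tle (pw (- int n) x) y" using orbit_below[OF x y] by blast
  have "tjoin y (pw (- int j) x) = y" if "n \<le> j" for j
  proof (rule tjoin_absorb[OF tle_trans[OF _ n]])
    show "tle (pw (- int j) x) (pw (- int n) x)" using that by (intro tle_pw_le[OF x]) simp
  qed
  then show "\<exists>N. \<forall>j\<ge>N. tjoin y (pw (- int j) x) = y" by blast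
qed

theorem contractible_K: "contractible_space (geometric_realization K)"
proof (cases "P = {}")
  case True
  then have "K = {}" using Union_K in_K_D(2) by blast
  then have "topspace (geometric_realization K) = {}"
    by (simp add: topspace_geometric_realization)
  then show ?thesis by (simp add: contractible_space_empty null_topspace_iff_trivial)
next
  case False
  then obtain x where x: "x \<in> P" by blast
  let ?X = "geometric_realization K"
  have h1: "homotopic_with (\<lambda>_. True) ?X ?X (push (\<lambda>y. tmeet (tjoin y x) (pw (int 0) x))) (push (\<lambda>y. tjoin y x))"
    using order_homotopy.homotopic_push[OF order_homotopy_up[OF x]] .
  have h2: "homotopic_with (\<lambda>_. True) ?X ?X (push (\<lambda>y. tjoin y (pw (- int 0) x))) (push (\<lambda>y. y))"
    using order_homotopy.homotopic_push[OF order_homotopy_down[OF x]] .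
  \<comment> \<open>The homotopies meet in the map induced by the join with \<open>x\<close>, as
    \<open>pw 0 x = x\<close>.\<close>
  have "homotopic_with (\<lambda>_. True) ?X ?X (push (\<lambda>y. tmeet (tjoin y x) (pw (int 0) x))) (push (\<lambda>y. y))"
    using homotopic_with_trans[OF h1] h2 by simp
  then have "homotopic_with (\<lambda>_. True) ?X ?X (\<lambda>_ w. of_bool (x = w)) id"
  proof (rule homotopic_with_eq)
    fix f assume f: "f \<in> topspace ?X"
    show "id f = push (\<lambda>y. y) f" using push_id[OF complex_K f] by simp
    have "supp f \<subseteq> P" using in_realization_iff[OF complex_K] f Union_K by blast
    then have "tmeet (tjoin y x) (pw (int 0) x) = x" if "y \<in> supp f" for y
      using tmeet_absorb(2)[OF tjoin(2)[OF _ x]] that by auto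
    then have "push (\<lambda>y. tmeet (tjoin y x) (pw (int 0) x)) f = push (\<lambda>_. x) f"
      unfolding push_def by (intro ext sum.cong) auto
    then show "(\<lambda>w. of_bool (x = w)) = push (\<lambda>y. tmeet (tjoin y x) (pw (int 0) x)) f"
      using push_const[OF complex_K f] by simp
  qed simp
  then show ?thesis
    unfolding contractible_space_def using homotopic_with_symD by blast
qed

end

theorem theorem1p3:
  fixes P :: "'a set" and r :: "'a \<Rightarrow> 'a \<Rightarrow> bool" and \<phi> :: "'a \<Rightarrow> 'a"
  assumes "weakly_ordered P r"
    and "homogeneous P r"
    and "automorphism_on P r \<phi>"
    and "generates_rel P r \<phi>"
    and "\<forall>x\<in>P. r x (\<phi> x) \<and> x \<noteq> \<phi> x"
    and "simply_connected_space (geometric_realization (X_complex P r \<phi>))"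
    and "\<forall>x\<in>P. lattice_on (order_interval P r x (\<phi> x)) r"
  shows "generates_partial_order P r \<and>
    (\<forall>x\<in>P.
       lattice_on (up_set P (chain_le P r) x) (chain_le P r) \<and>
       homogeneous (up_set P (chain_le P r) x) (chain_le P r) \<and>
       lattice_on (down_set P (chain_le P r) x) (chain_le P r) \<and>
       homogeneous (down_set P (chain_le P r) x) (chain_le P r)) \<and>
    contractible_space (geometric_realization (X_complex P r \<phi>))"
proof -
  interpret garside_simply_connected P r \<phi>
    using assms by unfold_locales
  have "chain_le P r = tle"
    by (intro ext) (rule chain_le_tle)
  moreover have "homogeneous (up_set P tle x) tle" "homogeneous (down_set P tle x) tle" for x
    by (auto intro!: homogeneous_tle simp: up_set_def down_set_def)
  ultimately show ?thesis
    using partial_order_generated lattice_up_set lattice_down_set contractible_K by simp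
qed

end
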